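(* Let $\{B(t):t\in\mathbb R\}$ be a standard two-sided Brownian motion. For each choice of sign $\pm$, the random field $\{\tilde X^{\pm}_H(t):(H,t)\in(0,1)\times[0,\infty)\}$ is a continuous modification of $\{X^{\pm}_H(t):(H,t)\in(0,1)\times[0,\infty)\}$, where $$X^+_H(t)=\int_{-\infty}^0\big[(t-s)^{H-\frac12}-(-s)^{H-\frac12}\big]dB(s)+\int_0^t(t-s)^{H-\frac12}dB(s),$$ $$X^-_H(t)=-\int_0^ts^{H-\frac12}dB(s)-\int_t^\infty\big[s^{H-\frac12}-(s-t)^{H-\frac12}\big]dB(s),$$ and $$\tilde X_H^+(t)=t^{H-\frac12}B(t)-(H-\tfrac12)\int_0^t(t-s)^{H-\frac32}\big(B(t)-B(s)\big)ds+(H-\tfrac12)\int_{-\infty}^0\big[(t-s)^{H-\frac32}-(-s)^{H-\frac32}\big]B(s)\,ds,$$ $$\tilde X_H^-(t)=-t^{H-\frac12}B(t)+(H-\tfrac12)\int_0^ts^{H-\frac32}B(s)\,ds+(H-\tfrac12)\int_t^\infty\big[s^{H-\frac32}-(s-t)^{H-\frac32}\big]\big(B(s)-B(t)\big)ds.$$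
   Context: The integrals against $dB$ are Wiener integrals; those against $ds$ are pathwise Lebesgue integrals. At $t=0$ all four quantities are taken to be $0$. A field $\tilde X$ is a continuous modification of $X$ if almost every sample path of $\tilde X$ is (jointly) continuous in $(H,t)\in(0,1)\times[0,\infty)$ and, for every fixed $(H,t)$, $\tilde X_H(t)=X_H(t)$ almost surely. *)

theory Defs
  imports "HOL-Probability.Probability"
begin

text \<open>
  Brownian motion indexed by the whole real line. Path continuity and \<open>B 0 = 0\<close> are only
  required almost surely. The increments over any finite chain
  \<open>ts ! 0 < ts ! 1 < \<dots>\<close> of possibly negative times are independent.
\<close>

definition two_sided_brownian_motion :: "'a measure \<Rightarrow> (real \<Rightarrow> 'a \<Rightarrow> real) \<Rightarrow> bool" where
  "two_sided_brownian_motion M B \<longleftrightarrow>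
     prob_space M \<and>
     (\<forall>t. B t \<in> borel_measurable M) \<and>
     (AE \<omega> in M. B 0 \<omega> = 0) \<and>
     (\<forall>ts. sorted_wrt (<) ts \<longrightarrow>
        prob_space.indep_vars M (\<lambda>_. borel)
          (\<lambda>i \<omega>. B (ts ! Suc i) \<omega> - B (ts ! i) \<omega>) {..<length ts - 1}) \<and>
     (\<forall>s t. s < t \<longrightarrow>
        distributed M lborel (\<lambda>\<omega>. B t \<omega> - B s \<omega>)
          (\<lambda>x. ennreal (normal_density 0 (sqrt (t - s)) x))) \<and>
     (AE \<omega> in M. continuous_on UNIV (\<lambda>t. B t \<omega>))"

text \<open>
  A list of triples \<open>(c, a, b)\<close> with \<open>a \<le> b\<close> represents the step function
  \<open>\<Sum> c * indicator {a<..b}\<close>, whose elementary integral is \<open>\<Sum> c * (B b - B a)\<close>.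
  The intervals may overlap.
\<close>

definition step_list :: "(real \<times> real \<times> real) list \<Rightarrow> bool" where
  "step_list xs \<longleftrightarrow> (\<forall>(c, a, b) \<in> set xs. a \<le> b)"

definition step_fun :: "(real \<times> real \<times> real) list \<Rightarrow> real \<Rightarrow> real" where
  "step_fun xs s = (\<Sum>(c, a, b)\<leftarrow>xs. c * indicator {a<..b} s)"

definition step_integral ::
    "(real \<Rightarrow> 'a \<Rightarrow> real) \<Rightarrow> (real \<times> real \<times> real) list \<Rightarrow> 'a \<Rightarrow> real" where
  "step_integral B xs \<omega> = (\<Sum>(c, a, b)\<leftarrow>xs. c * (B b \<omega> - B a \<omega>))"

text \<open>
  The Wiener integral is the continuous extension of the elementary integral from step functions
  to square-integrable functions. The \<open>L\<^sup>2\<close> distances are nonnegative Lebesgue integrals, so their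
  convergence to \<open>0\<close> forces \<open>f\<close> (and then \<open>Y\<close>) to be square integrable.
\<close>

definition has_wiener_integral ::
    "'a measure \<Rightarrow> (real \<Rightarrow> 'a \<Rightarrow> real) \<Rightarrow> (real \<Rightarrow> real) \<Rightarrow> ('a \<Rightarrow> real) \<Rightarrow> bool" where
  "has_wiener_integral M B f Y \<longleftrightarrow>
     f \<in> borel_measurable lborel \<and> Y \<in> borel_measurable M \<and>
     (\<exists>\<phi>. (\<forall>n. step_list (\<phi> n)) \<and>
        (\<lambda>n. \<integral>\<^sup>+ s. ennreal ((step_fun (\<phi> n) s - f s)\<^sup>2) \<partial>lborel) \<longlonglongrightarrow> 0 \<and>
        (\<lambda>n. \<integral>\<^sup>+ \<omega>. ennreal ((step_integral B (\<phi> n) \<omega> - Y \<omega>)\<^sup>2) \<partial>M) \<longlonglongrightarrow> 0)"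

text \<open>
  A representative of the Wiener integral over \<open>A\<close>. The choice is immaterial, since by the
  Wiener isometry all representatives agree almost surely.
\<close>

definition wiener_integral ::
    "'a measure \<Rightarrow> (real \<Rightarrow> 'a \<Rightarrow> real) \<Rightarrow> real set \<Rightarrow> (real \<Rightarrow> real) \<Rightarrow> 'a \<Rightarrow> real" where
  "wiener_integral M B A f = (SOME Y. has_wiener_integral M B (\<lambda>s. indicator A s * f s) Y)"

definition X_plus :: "'a measure \<Rightarrow> (real \<Rightarrow> 'a \<Rightarrow> real) \<Rightarrow> real \<Rightarrow> real \<Rightarrow> 'a \<Rightarrow> real" where
  "X_plus M B H t \<omega> =
     (if t = 0 then 0 else
        wiener_integral M B {..0} (\<lambda>s. (t - s) powr (H - 1/2) - (- s) powr (H - 1/2)) \<omega>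
      + wiener_integral M B {0..t} (\<lambda>s. (t - s) powr (H - 1/2)) \<omega>)"

definition X_minus :: "'a measure \<Rightarrow> (real \<Rightarrow> 'a \<Rightarrow> real) \<Rightarrow> real \<Rightarrow> real \<Rightarrow> 'a \<Rightarrow> real" where
  "X_minus M B H t \<omega> =
     (if t = 0 then 0 else
      - wiener_integral M B {0..t} (\<lambda>s. s powr (H - 1/2)) \<omega>
      - wiener_integral M B {t..} (\<lambda>s. s powr (H - 1/2) - (s - t) powr (H - 1/2)) \<omega>)"

definition Xt_plus :: "(real \<Rightarrow> 'a \<Rightarrow> real) \<Rightarrow> real \<Rightarrow> real \<Rightarrow> 'a \<Rightarrow> real" where
  "Xt_plus B H t \<omega> =
     (if t = 0 then 0 else
        t powr (H - 1/2) * B t \<omega>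
      - (H - 1/2) * (LINT s:{0..t}|lborel. (t - s) powr (H - 3/2) * (B t \<omega> - B s \<omega>))
      + (H - 1/2) * (LINT s:{..0}|lborel.
                       ((t - s) powr (H - 3/2) - (- s) powr (H - 3/2)) * B s \<omega>))"

definition Xt_minus :: "(real \<Rightarrow> 'a \<Rightarrow> real) \<Rightarrow> real \<Rightarrow> real \<Rightarrow> 'a \<Rightarrow> real" where
  "Xt_minus B H t \<omega> =
     (if t = 0 then 0 else
      - (t powr (H - 1/2)) * B t \<omega>
      + (H - 1/2) * (LINT s:{0..t}|lborel. s powr (H - 3/2) * B s \<omega>)
      + (H - 1/2) * (LINT s:{t..}|lborel.
                       (s powr (H - 3/2) - (s - t) powr (H - 3/2)) * (B s \<omega> - B t \<omega>)))"

text \<open>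
  The Bochner integral is \<open>0\<close> on non-integrable functions; the next two predicates say that the
  pathwise integrals above exist as genuine Lebesgue integrals.
\<close>

definition Xt_plus_exists :: "(real \<Rightarrow> 'a \<Rightarrow> real) \<Rightarrow> real \<Rightarrow> real \<Rightarrow> 'a \<Rightarrow> bool" where
  "Xt_plus_exists B H t \<omega> \<longleftrightarrow>
     set_integrable lborel {0..t} (\<lambda>s. (t - s) powr (H - 3/2) * (B t \<omega> - B s \<omega>)) \<and>
     set_integrable lborel {..0}
       (\<lambda>s. ((t - s) powr (H - 3/2) - (- s) powr (H - 3/2)) * B s \<omega>)"

definition Xt_minus_exists :: "(real \<Rightarrow> 'a \<Rightarrow> real) \<Rightarrow> real \<Rightarrow> real \<Rightarrow> 'a \<Rightarrow> bool" where
  "Xt_minus_exists B H t \<omega> \<longleftrightarrow>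
     set_integrable lborel {0..t} (\<lambda>s. s powr (H - 3/2) * B s \<omega>) \<and>
     set_integrable lborel {t..}
       (\<lambda>s. (s powr (H - 3/2) - (s - t) powr (H - 3/2)) * (B s \<omega> - B t \<omega>))"

text \<open>
  Fields are indexed by \<open>(H, t) \<in> (0, 1) \<times> [0, \<infinity>)\<close>. Measurability is with respect to the
  completion, because a function determined only almost surely need not be measurable with
  respect to \<open>M\<close> itself.
\<close>

definition random_field :: "'a measure \<Rightarrow> (real \<Rightarrow> real \<Rightarrow> 'a \<Rightarrow> real) \<Rightarrow> bool" where
  "random_field M X \<longleftrightarrow> (\<forall>H\<in>{0<..<1}. \<forall>t\<ge>0. X H t \<in> borel_measurable (completion M))"

definition continuous_modification ::
    "'a measure \<Rightarrow> (real \<Rightarrow> real \<Rightarrow> 'a \<Rightarrow> real) \<Rightarrow> (real \<Rightarrow> real \<Rightarrow> 'a \<Rightarrow> real) \<Rightarrow> bool" where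
  "continuous_modification M Y X \<longleftrightarrow>
     random_field M X \<and> random_field M Y \<and>
     (AE \<omega> in M. continuous_on ({0<..<1} \<times> {0..}) (\<lambda>(H, t). Y H t \<omega>)) \<and>
     (\<forall>H\<in>{0<..<1}. \<forall>t\<ge>0. AE \<omega> in M. Y H t \<omega> = X H t \<omega>)"

end

theory Submission
  imports Defs
begin

text \<open>
  Almost every Brownian path \<open>b\<close> satisfies, for every small \<open>\<delta> > 0\<close>,
  \<open>\<bar>b s - b t\<bar> \<le> C * T powr (2 * \<delta>) * \<bar>s - t\<bar> powr (1/2 - \<delta>)\<close> whenever \<open>\<bar>s\<bar>, \<bar>t\<bar> \<le> T\<close> and \<open>T \<ge> 1\<close>
  (dyadic chaining with Gaussian moments). Substituting \<open>s = t * v\<close> turns the pathwise integrals into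
  \<open>t powr (H - 1/2)\<close> times integrals over \<open>v\<close> whose integrands are dominated, locally uniformly in
  \<open>(H, t)\<close> up to \<open>t = 0\<close>, by the path estimate; dominated convergence gives existence and joint
  continuity.

  For fixed \<open>(H, t)\<close> the kernels are truncated to compact intervals away from their singularities.
  There the Wiener integral of a \<open>C\<^sup>1\<close> function equals the pathwise expression obtained by integration
  by parts, because both are limits of the same Riemann-Stieltjes sums. Letting the truncation
  disappear, the boundary terms vanish by the path estimate, the kernels converge in \<open>L\<^sup>2\<close>, and the
  Wiener integral is closed under such limits.
\<close>

section \<open>Hoelder continuity and growth of Brownian paths\<close>

text \<open>The exponents pull in opposite directions. For \<open>H < 1/2\<close> the power
  \<open>H - 3/2\<close> is not integrable at its singularity, so existence rests on path increments
  of order \<open>1/2 - \<delta>\<close>; the product has exponent \<open>H - 1 - \<delta>\<close>,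
  integrable at 0 only for \<open>\<delta> < H\<close>. At infinity the cancellation of two powers
  leaves \<open>H - 5/2\<close>, the path grows like \<open>1/2 + \<delta>\<close>, and
  \<open>H - 2 + \<delta>\<close> is integrable only for \<open>\<delta> < 1 - H\<close>. No single
  \<delta> serves all \<open>H\<close>, yet one null set has to serve all \<open>(H, t)\<close>.
  Hence the path estimate is demanded along a sequence of \<delta> tending to 0, and continuity is
  proved on boxes \<open>{h1..h2} \<times> {0..T}\<close>, each with its own \<delta>. The same two
  conditions make the boundary terms vanish. In the integrations by parts the path is shifted by its
  value at the singular endpoint, 0 or \<open>B t\<close>; this is where the increments in the
  pathwise formulas come from.\<close>

lemma dyadic_refine:
  fixes x :: real
  assumes "0 \<le> x" "x \<le> 1"
  obtains j :: "nat \<Rightarrow> nat" where "\<And>n. j n \<le> 2^n" "\<And>n. real (j n) / 2^n \<le> x" "\<And>n. x \<le> real (j n) / 2^n + 1/2^n"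
    "\<And>n. j (Suc n) = 2 * j n \<or> j (Suc n) = Suc (2 * j n)"
proof -
  \<comment> \<open>Truncated binary expansion: passing to the next level appends one digit. At
    \<open>x = 1\<close> it yields \<open>2^n\<close>, the right end of the last cell.\<close>
  define j where "j n = nat \<lfloor>x * 2^n\<rfloor>" for n
  have nn: "0 \<le> x * 2^n" for n using assms by simp
  have jr: "real (j n) = of_int \<lfloor>x * 2^n\<rfloor>" for n
    using nn[of n] by (simp add: j_def)
  show thesis
  proof (rule that[of j])
    fix n
    have "x * 2^n \<le> 2^n" using assms by (simp add: mult_left_le_one_le)
    then have "real (j n) \<le> 2^n" unfolding jr by linarith
    then show "j n \<le> 2^n" unfolding of_nat_le_numeral_power_cancel_iff .
    show "real (j n) / 2^n \<le> x" unfolding jr by (simp add: field_simps)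
    have "x * 2^n \<le> real (j n) + 1" unfolding jr by linarith
    then show "x \<le> real (j n) / 2^n + 1/2^n" by (simp add: field_simps)
    have "2 * (x*2^n) = x * 2^(Suc n)" by simp
    then have "\<lfloor>x * 2^(Suc n)\<rfloor> = 2 * \<lfloor>x * 2^n\<rfloor> \<or> \<lfloor>x * 2^(Suc n)\<rfloor> = 2 * \<lfloor>x * 2^n\<rfloor> + 1"
      by linarith
    then have "real (j (Suc n)) = 2 * real (j n) \<or> real (j (Suc n)) = 2 * real (j n) + 1"
      unfolding jr by auto
    then show "j (Suc n) = 2 * j n \<or> j (Suc n) = Suc (2 * j n)" by linarith
  qed
qed

text \<open>Each point is joined to its level-\<open>n\<close> approximant by a telescoping sum with
  geometric tail \<open>K * q^n / (1 - q)\<close>. At the level where \<open>2^-n\<close> is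
  comparable to the distance of the points, the two approximants are at most two cells apart. Two
  cells and two tails give \<open>2 * K * (1 + 1 / (1 - q))\<close>; the factor
  \<open>2 powr \<gamma>\<close> pays for replacing \<open>q^n\<close> by a power of the
  distance.\<close>

lemma dyadic_hoelder:
  fixes g :: "real \<Rightarrow> real" and K \<gamma> :: real
  assumes cont: "continuous_on {0..1} g" and \<gamma>: "0 < \<gamma>" and K: "0 \<le> K"
    and inc: "\<And>n j. j < 2^n \<Longrightarrow> \<bar>g (real (Suc j) / 2^n) - g (real j / 2^n)\<bar> \<le> K * (2 powr -\<gamma>)^n"
    and xy: "x \<in> {0..1}" "y \<in> {0..1}"
  shows "\<bar>g x - g y\<bar> \<le> 2 * K * (1 + 1 / (1 - 2 powr -\<gamma>)) * 2 powr \<gamma> * \<bar>x - y\<bar> powr \<gamma>"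
proof -
  define q where "q = 2 powr -\<gamma>"
  have q: "0 < q" "q < 1" using \<gamma> by (auto simp: q_def powr_less_one)
  have tail: "\<bar>g x - g (real (j n) / 2^n)\<bar> \<le> K * q^n / (1 - q)"
    if x: "x \<in> {0..1}" and j: "\<And>n. j n \<le> 2^n" "\<And>n. real (j n) / 2^n \<le> x" "\<And>n. x \<le> real (j n) / 2^n + 1/2^n"
      "\<And>n. j (Suc n) = 2 * j n \<or> j (Suc n) = Suc (2 * j n)" for x n and j :: "nat \<Rightarrow> nat"
  proof -
    define p where "p n = real (j n) / 2^n" for n
    have pin: "p n \<in> {0..1}" for n
    proof -
      have "real (j n) \<le> real (2^n)" using j(1)[of n] of_nat_le_iff by blast
      then show ?thesis by (simp add: p_def)
    qed
    have step: "\<bar>g (p (Suc k)) - g (p k)\<bar> \<le> K * q^k" for k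
    proof -
      have pk: "p k = real (2 * j k) / 2^(Suc k)" by (simp add: p_def)
      from j(4)[of k] show ?thesis
      proof
        assume a: "j (Suc k) = 2 * j k"
        then have "p (Suc k) = p k" by (simp add: p_def)
        then show ?thesis using K q by simp
      next
        assume a: "j (Suc k) = Suc (2 * j k)"
        \<comment> \<open>A new digit 1 moves the approximant right by exactly one cell of level
          \<open>Suc k\<close>; a digit 0 leaves it in place.\<close>
        then have lt: "2 * j k < 2^(Suc k)" using j(1)[of "Suc k"] by simp
        have "p (Suc k) = real (Suc (2 * j k)) / 2^(Suc k)" using a by (simp add: p_def)
        then have "\<bar>g (p (Suc k)) - g (p k)\<bar> \<le> K * q ^ Suc k"
          using inc[OF lt] pk by (simp add: q_def)
        also have "\<dots> \<le> K * q ^ k" using K q by (intro mult_left_mono) (auto simp: mult_left_le_one_le)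
        finally show ?thesis .
      qed
    qed
    have fin: "\<bar>g (p (n + m)) - g (p n)\<bar> \<le> K * q^n * (\<Sum>i<m. q^i)" for m
    proof (induction m)
      case (Suc m)
      have "\<bar>g (p (n + Suc m)) - g (p n)\<bar> \<le> \<bar>g (p (Suc (n + m))) - g (p (n+m))\<bar> + \<bar>g (p (n + m)) - g (p n)\<bar>" by simp
      also have "\<dots> \<le> K * q^(n+m) + K * q^n * (\<Sum>i<m. q^i)" using step[of "n+m"] Suc by linarith
      also have "\<dots> = K * q^n * (\<Sum>i<Suc m. q^i)" by (simp add: power_add algebra_simps)
      finally show ?case .
    qed simp
    have geo: "(\<Sum>i<m. q^i) \<le> 1 / (1 - q)" for m
    proof -
      have "(\<Sum>i<m. q^i) = (1 - q^m) / (1 - q)" using q by (simp add: sum_gp_strict)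
      also have "\<dots> \<le> 1 / (1 - q)" using q by (intro divide_right_mono) auto
      finally show ?thesis .
    qed
    have fin': "\<bar>g (p (n + m)) - g (p n)\<bar> \<le> K * q^n / (1 - q)" for m
      using fin[of m] mult_left_mono[OF geo[of m], of "K * q^n"] K q by simp
    have "(\<lambda>m. p m) \<longlonglongrightarrow> x"
    proof (rule tendsto_sandwich[of "\<lambda>m. x - 1/2^m" _ _ "\<lambda>m. x"])
      show "\<forall>\<^sub>F m in sequentially. x - 1/2^m \<le> p m" using j(3) by (auto simp: p_def algebra_simps)
      show "\<forall>\<^sub>F m in sequentially. p m \<le> x" using j(2) by (auto simp: p_def)
      have "(\<lambda>m. x - (1/2)^m) \<longlonglongrightarrow> x - 0" by (intro tendsto_intros) (auto intro: LIMSEQ_power_zero)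
      then show "(\<lambda>m. x - 1/2^m) \<longlonglongrightarrow> x" by (simp add: power_divide)
    qed auto
    then have "(\<lambda>m. p (n + m)) \<longlonglongrightarrow> x" using LIMSEQ_ignore_initial_segment[of p x n] by (simp add: add.commute)
    then have "(\<lambda>m. g (p (n + m))) \<longlonglongrightarrow> g x"
      using cont x pin by (auto simp: continuous_on_sequentially comp_def)
    then have "(\<lambda>m. \<bar>g (p (n + m)) - g (p n)\<bar>) \<longlonglongrightarrow> \<bar>g x - g (p n)\<bar>" by (intro tendsto_intros)
    from LIMSEQ_le_const2[OF this] fin' show ?thesis unfolding p_def by blast
  qed
  have main: "\<bar>g x - g y\<bar> \<le> 2 * K * (1 + 1 / (1 - q)) * 2 powr \<gamma> * \<bar>x - y\<bar> powr \<gamma>"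
    if xy: "x \<in> {0..1}" "y \<in> {0..1}" "x < y" for x y
  proof -
    obtain j where j: "\<And>n. j n \<le> 2^n" "\<And>n. real (j n) / 2^n \<le> x" "\<And>n. x \<le> real (j n) / 2^n + 1/2^n"
      "\<And>n. j (Suc n) = 2 * j n \<or> j (Suc n) = Suc (2 * j n)"
      using dyadic_refine[of x] xy by auto
    obtain i where i: "\<And>n. i n \<le> 2^n" "\<And>n. real (i n) / 2^n \<le> y" "\<And>n. y \<le> real (i n) / 2^n + 1/2^n"
      "\<And>n. i (Suc n) = 2 * i n \<or> i (Suc n) = Suc (2 * i n)"
      using dyadic_refine[of y] xy by auto
    have "\<exists>n. (1/2)^n < y - x" using xy by (intro real_arch_pow_inv) auto
    \<comment> \<open>Minimality yields \<open>y - x \<le> (1/2)^n\<close>; for \<open>n = 0\<close>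
      this holds because both points lie in the unit interval.\<close>
    define n where "n = (LEAST n. (1/2)^Suc n < y - x)"
    have n1: "(1/2)^Suc n < y - x"
    proof -
      obtain m where "(1/2)^m < y - x" using \<open>\<exists>n. (1/2)^n < y - x\<close> by blast
      moreover have "(1/2::real)^Suc m \<le> (1/2)^m" by simp
      ultimately have "(1/2)^Suc m < y - x" by linarith
      then show ?thesis unfolding n_def by (rule LeastI)
    qed
    have n2: "y - x \<le> (1/2)^n"
    proof (cases n)
      case 0 then show ?thesis using xy by simp
    next
      case (Suc k)
      then have "\<not> (1/2)^Suc k < y - x" using not_less_Least[of k "\<lambda>n. (1/2)^Suc n < y - x"] by (simp add: n_def)
      then show ?thesis using Suc by simp
    qed
    \<comment> \<open>As floors may round either way, the index of \<open>y\<close> lies between one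
      cell left and two cells right of that of \<open>x\<close>.\<close>
    have "real (i n) / 2^n \<le> real (j n)/2^n + 2/2^n"
    proof -
      have "real (i n)/2^n \<le> x + (1/2)^n" using i(2)[of n] n2 by linarith
      also have "\<dots> \<le> real (j n)/2^n + 1/2^n + (1/2)^n" using j(3)[of n] by linarith
      finally show ?thesis by (simp add: power_divide)
    qed
    then have "real (i n) \<le> real (j n) + 2" by (simp add: field_simps)
    then have up: "i n \<le> j n + 2" by linarith
    have "real (j n)/2^n \<le> real (i n)/2^n + 1/2^n" using j(2)[of n] i(3)[of n] xy by linarith
    then have "real (j n) \<le> real (i n) + 1" by (simp add: field_simps)
    then have lo: "j n \<le> i n + 1" by linarith
    have st: "\<bar>g (real (i n) / 2^n) - g (real (j n) / 2^n)\<bar> \<le> 2 * (K * q^n)"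
    proof -
      have s: "\<bar>g (real (Suc k) / 2^n) - g (real k / 2^n)\<bar> \<le> K * q^n" if "Suc k \<le> 2^n" for k
        using inc[of k n] that by (simp add: q_def)
      have nn: "0 \<le> K * q^n" using K q by simp
      consider "i n = j n" | "i n = Suc (j n)" | "j n = Suc (i n)" | "i n = Suc (Suc (j n))" using up lo by linarith
      then show ?thesis
      proof cases
        case 1 then show ?thesis using nn by simp
      next
        case 2 then show ?thesis using s[of "j n"] i(1)[of n] nn by simp
      next
        case 3 then show ?thesis using s[of "i n"] j(1)[of n] nn by (simp add: abs_minus_commute)
      next
        case 4
        have "\<bar>g (real (Suc (Suc (j n))) / 2^n) - g (real (Suc (j n)) / 2^n)\<bar> \<le> K * q^n"
          "\<bar>g (real (Suc (j n)) / 2^n) - g (real (j n) / 2^n)\<bar> \<le> K * q^n"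
          using s[of "j n"] s[of "Suc (j n)"] i(1)[of n] 4 by auto
        then show ?thesis unfolding 4 by linarith
      qed
    qed
    have "\<bar>g x - g y\<bar> \<le> 2 * (K * q^n) + 2 * (K * q^n / (1 - q))"
      using st tail[OF xy(1) j, of n] tail[OF xy(2) i, of n] by linarith
    also have "\<dots> = 2 * (K * (1 + 1 / (1 - q)) * q^n)" by (simp add: algebra_simps)
    finally have le: "\<bar>g x - g y\<bar> \<le> 2 * K * (1 + 1 / (1 - q)) * q^n" by (simp only: mult.assoc)
    have half: "(1/2::real)^Suc n = 2 powr (- real (Suc n))"
      by (simp only: powr_minus powr_realpow[OF zero_less_numeral] power_one_over inverse_eq_divide)
    have qn: "q^n = 2 powr (- \<gamma> * real n)"
      by (simp add: q_def powr_realpow[symmetric] powr_powr)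
    have "2 powr (- \<gamma> * real n) = 2 powr (\<gamma> + - real (Suc n) * \<gamma>)" by (simp add: algebra_simps)
    then have "q^n = 2 powr \<gamma> * ((1/2)^Suc n) powr \<gamma>"
      unfolding half qn powr_powr powr_add .
    moreover have "((1/2)^Suc n) powr \<gamma> \<le> \<bar>x - y\<bar> powr \<gamma>" using n1 \<gamma> xy by (intro powr_mono2) (simp_all del: power_Suc)
    ultimately have "q^n \<le> 2 powr \<gamma> * \<bar>x - y\<bar> powr \<gamma>" by simp
    then have "2 * K * (1 + 1 / (1 - q)) * q^n \<le> 2 * K * (1 + 1 / (1 - q)) * (2 powr \<gamma> * \<bar>x - y\<bar> powr \<gamma>)"
      using K q by (intro mult_left_mono) auto
    with le show ?thesis by (simp only: mult.assoc)
  qed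
  consider "x < y" | "y < x" | "x = y" by linarith
  then show ?thesis
  proof cases
    case 1 then show ?thesis using main[OF xy] unfolding q_def by blast
  next
    case 2 then show ?thesis using main[OF xy(2,1)] unfolding q_def by (simp only: abs_minus_commute)
  next
    case 3
    show ?thesis unfolding 3 by (simp only: diff_self abs_zero powr_0 mult_zero_right order_refl)
  qed
qed

text \<open>With \<open>T\<close> tied to the size of the arguments, this single estimate contains both the local Hoelder
  continuity of order \<open>1/2 - \<delta>\<close> and the growth bound \<open>\<bar>b s\<bar> = O(\<bar>s\<bar> powr (1/2 + \<delta>))\<close> at infinity.\<close>

definition hoelder_growth :: "real \<Rightarrow> (real \<Rightarrow> real) \<Rightarrow> bool" where
  "hoelder_growth \<delta> b \<longleftrightarrow>
     (\<exists>C\<ge>0. \<forall>T\<ge>1. \<forall>s\<in>{-T..T}. \<forall>t\<in>{-T..T}. \<bar>b s - b t\<bar> \<le> C * T powr (2 * \<delta>) * \<bar>s - t\<bar> powr (1/2 - \<delta>))"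

section \<open>Gaussian moments and almost sure path estimates\<close>

locale brownian =
  fixes M :: "'a measure" and B :: "real \<Rightarrow> 'a \<Rightarrow> real"
  assumes bm: "two_sided_brownian_motion M B"
begin

sublocale prob_space M
  using bm by (simp add: two_sided_brownian_motion_def)

lemma measurable_B [measurable]: "B t \<in> borel_measurable M"
  using bm by (simp add: two_sided_brownian_motion_def)

lemma AE_B_zero: "AE \<omega> in M. B 0 \<omega> = 0"
  using bm by (simp add: two_sided_brownian_motion_def)

lemma AE_continuous: "AE \<omega> in M. continuous_on UNIV (\<lambda>t. B t \<omega>)"
  using bm by (simp add: two_sided_brownian_motion_def)

text \<open>High \<open>p\<close> brings the Hoelder exponent close to 1/2 in the chaining;
  \<open>p = 1\<close> is the variance behind the isometry.\<close>

lemma nn_moment_increment: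
  assumes "s < t"
  shows "(\<integral>\<^sup>+ \<omega>. ennreal ((B t \<omega> - B s \<omega>) ^ (2 * p)) \<partial>M) = ennreal (fact (2 * p) / (2 ^ p * fact p) * (t - s) ^ p)"
proof -
  have D: "distributed M lborel (\<lambda>\<omega>. B t \<omega> - B s \<omega>) (\<lambda>x. ennreal (normal_density 0 (sqrt (t - s)) x))"
    using bm assms by (simp add: two_sided_brownian_motion_def)
  have "(\<integral>\<^sup>+ \<omega>. ennreal ((B t \<omega> - B s \<omega>) ^ (2 * p)) \<partial>M)
      = (\<integral>\<^sup>+ x. ennreal (normal_density 0 (sqrt (t - s)) x) * ennreal (x ^ (2 * p)) \<partial>lborel)"
    by (rule distributed_nn_integral[OF D, symmetric]) simp
  also have "\<dots> = (\<integral>\<^sup>+ x. ennreal (normal_density 0 (sqrt (t - s)) x * (x - 0) ^ (2 * p)) \<partial>lborel)"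
    by (simp add: ennreal_mult)
  also have "\<dots> = ennreal (fact (2 * p) / ((2 / (sqrt (t - s))\<^sup>2) ^ p * fact p))"
  proof -
    have m: "has_bochner_integral lborel (\<lambda>x. normal_density 0 (sqrt (t - s)) x * (x - 0) ^ (2 * p))
        (fact (2 * p) / ((2 / (sqrt (t - s))\<^sup>2) ^ p * fact p))"
      using assms by (intro normal_moment_even) simp
    show ?thesis
      unfolding has_bochner_integral_integral_eq[OF m, symmetric]
      by (intro nn_integral_eq_integral integrable.intros[OF m]) auto
  qed
  also have "fact (2 * p) / ((2 / (sqrt (t - s))\<^sup>2) ^ p * fact p) = fact (2 * p) / (2 ^ p * fact p) * (t - s) ^ p"
    using assms by (simp add: power_divide)
  finally show ?thesis .
qed

text \<open>The dyadic point \<open>j / 2^n\<close> carried affinely from the unit interval to the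
  interval from \<open>-2^m\<close> to \<open>2^m\<close>. Letting \<open>m\<close> grow is what
  captures the behaviour at infinity.\<close>

definition grid :: "nat \<Rightarrow> nat \<Rightarrow> nat \<Rightarrow> real" where
  "grid m n j = - (2 ^ m) + 2 ^ Suc m * (real j / 2 ^ n)"

text \<open>The sum over all scales \<open>m\<close>, levels \<open>n\<close> and cells \<open>j\<close> of the normalized \<open>2 * p\<close>-th powers has
  finite expectation as soon as \<open>\<delta> * p > 2\<close>, hence is finite almost surely.\<close>

lemma AE_grid_increments:
  fixes \<delta> :: real
  assumes \<delta>: "0 < \<delta>" "\<delta> < 1/2"
  shows "AE \<omega> in M. \<exists>S\<ge>0. \<forall>m n j. j < 2 ^ n \<longrightarrow>
    \<bar>B (grid m n (Suc j)) \<omega> - B (grid m n j) \<omega>\<bar> \<le> S * ((2 powr (1/2 + \<delta>)) ^ m * (2 powr - (1/2 - \<delta>)) ^ n)"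
proof -
  obtain p :: nat where p: "2 / \<delta> < real p" using reals_Archimedean2 by blast
  have p0: "0 < p"
  proof (rule ccontr)
    assume "\<not> 0 < p"
    with p \<delta> show False by (simp add: field_simps)
  qed
  have pd: "2 < \<delta> * real p" using p \<delta> by (simp add: field_simps)
  \<comment> \<open>The increment over a grid cell has standard deviation
    \<open>2 powr ((m + 1 - n) / 2)\<close>. Up to a constant, \<open>w\<close> exceeds it by
    \<open>2 powr (\<delta> * (m + n))\<close>, so the normalized moments of order
    \<open>2 * p\<close> decay like \<open>2 powr (- 2 * \<delta> * p * (m + n))\<close>.\<close>
  define w where "w m n = (2 powr (1/2 + \<delta>)) ^ m * (2 powr - (1/2 - \<delta>)) ^ n" for m n :: nat
  have w: "0 < w m n" for m n by (simp add: w_def)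
  define X where "X m n j \<omega> = (B (grid m n (Suc j)) \<omega> - B (grid m n j) \<omega>) / w m n" for m n j \<omega>
  have [measurable]: "X m n j \<in> borel_measurable M" for m n j
    unfolding X_def by measurable
  define c :: real where "c = fact (2 * p) / (2 ^ p * fact p) * 2 ^ p"
  have c: "0 \<le> c" by (simp add: c_def)
  define S where "S \<omega> = (\<Sum>m. \<Sum>n. \<Sum>j<2^n. ennreal (X m n j \<omega> ^ (2 * p)))" for \<omega>
  have one: "(\<integral>\<^sup>+ \<omega>. ennreal (X m n j \<omega> ^ (2 * p)) \<partial>M) \<le> ennreal (c * (1/4) ^ m * (1/4)^n)" (is "?I \<le> _") for m n j
  proof -
    have d: "grid m n (Suc j) - grid m n j = 2 ^ Suc m / 2 ^ n"
      by (simp add: grid_def field_simps)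
    have lt: "grid m n j < grid m n (Suc j)" using d by (smt (verit) divide_pos_pos zero_less_power)
    have "?I = (\<integral>\<^sup>+ \<omega>. ennreal (1 / w m n ^ (2*p)) * ennreal ((B (grid m n (Suc j)) \<omega> - B (grid m n j) \<omega>) ^ (2 * p)) \<partial>M)"
      unfolding X_def power_divide using w[of m n] by (subst ennreal_mult[symmetric]) auto
    also have "\<dots> = ennreal (1 / w m n ^ (2*p)) * ennreal (fact (2 * p) / (2 ^ p * fact p) * (2 ^ Suc m / 2 ^ n) ^ p)"
      by (subst nn_integral_cmult) (simp_all add: nn_moment_increment[OF lt] d)
    also have "\<dots> = ennreal (1 / w m n ^ (2*p) * (fact (2 * p) / (2 ^ p * fact p) * (2 ^ Suc m / 2 ^ n) ^ p))"
      using w[of m n] by (intro ennreal_mult[symmetric]) auto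
    also have "1 / w m n ^ (2*p) * (fact (2 * p) / (2 ^ p * fact p) * (2 ^ Suc m / 2 ^ n) ^ p)
        = c * (2 powr (- (2 * \<delta> * p))) ^ m * (2 powr (- (2 * \<delta> * p))) ^ n"
    proof -
      have a: "(2 ^ Suc m / 2 ^ n :: real) ^ p = 2 ^ p * 2 powr (real m * p - real n * p)"
        by (simp add: power_divide power_mult_distrib powr_diff powr_realpow[symmetric] powr_powr)
      have b: "w m n ^ (2 * p) = 2 powr ((1/2 + \<delta>) * m * (2 * p) - (1/2 - \<delta>) * n * (2 * p))"
        by (simp add: w_def powr_realpow[symmetric] powr_powr powr_mult powr_add[symmetric] algebra_simps
              del: powr_power)
      have e: "2 powr (real m * p - real n * p) / 2 powr ((1/2 + \<delta>) * m * (2 * p) - (1/2 - \<delta>) * n * (2 * p))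
        = (2 powr (- (2 * \<delta> * p))) ^ m * (2 powr (- (2 * \<delta> * p))) ^ n"
        unfolding powr_diff[symmetric]
        by (simp add: powr_realpow[symmetric] powr_powr powr_add[symmetric] algebra_simps del: powr_power)
      have "1 / w m n ^ (2*p) * (fact (2 * p) / (2 ^ p * fact p) * (2 ^ Suc m / 2 ^ n) ^ p) =
        c * (2 powr (real m * p - real n * p) / 2 powr ((1/2 + \<delta>) * m * (2 * p) - (1/2 - \<delta>) * n * (2 * p)))"
        unfolding a b c_def by simp
      then show ?thesis unfolding e by simp
    qed
    \<comment> \<open>The ratio 1/4 survives the multiplication by the \<open>2^n\<close> cells of
      level \<open>n\<close>, which leaves the summable \<open>(1/2)^n\<close>.\<close>
    also have "\<dots> \<le> c * (1/4)^m * (1/4)^n"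
    proof -
      have "2 powr (- (2 * \<delta> * p)) \<le> 2 powr (-2)" using pd by simp
      also have "\<dots> = (1/4::real)" by (simp add: powr_minus_divide)
      finally have "2 powr (- (2 * \<delta> * p)) \<le> (1/4::real)" .
      then show ?thesis using c by (intro mult_mono power_mono) auto
    qed
    finally show ?thesis by (simp add: ennreal_leI)
  qed
  have "(\<integral>\<^sup>+ \<omega>. S \<omega> \<partial>M) = (\<Sum>m. \<Sum>n. \<Sum>j<2^n. (\<integral>\<^sup>+ \<omega>. ennreal (X m n j \<omega> ^ (2 * p)) \<partial>M))"
    unfolding S_def by (simp add: nn_integral_suminf nn_integral_sum del: sum_ennreal)
  also have "\<dots> \<le> (\<Sum>m. \<Sum>n. ennreal (c * (1/2)^m * (1/2)^n))"
  proof (intro suminf_le summableI)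
    fix m n
    have "(\<Sum>j<2^n. (\<integral>\<^sup>+ \<omega>. ennreal (X m n j \<omega> ^ (2 * p)) \<partial>M)) \<le> (\<Sum>j<2^n::nat. ennreal (c * (1/4) ^ m * (1/4)^n))"
      by (intro sum_mono one)
    also have "\<dots> = ennreal (real (2^n) * (c * (1/4)^m * (1/4)^n))"
      using c by (subst sum_ennreal) auto
    also have "\<dots> \<le> ennreal (c * (1/2)^m * (1/2)^n)"
    proof (rule ennreal_leI)
      have "real (2^n) * (c * (1/4)^m * (1/4)^n) = c * (1/4)^m * (1/2)^n"
        by (simp add: power_divide field_simps power_mult_distrib[symmetric])
      also have "\<dots> \<le> c * (1/2)^m * (1/2)^n"
        using c by (intro mult_right_mono mult_left_mono power_mono) auto
      finally show "real (2^n) * (c * (1/4)^m * (1/4)^n) \<le> c * (1/2)^m * (1/2)^n" .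
    qed
    finally show "(\<Sum>j<2^n. (\<integral>\<^sup>+ \<omega>. ennreal (X m n j \<omega> ^ (2 * p)) \<partial>M)) \<le> ennreal (c * (1/2)^m * (1/2)^n)" .
  qed
  also have "\<dots> = ennreal (4 * c)"
  proof -
    have g: "(\<lambda>n. (1/2::real)^n) sums 2" using geometric_sums[of "1/2::real"] by simp
    have "(\<Sum>n. ennreal (c * (1/2)^m * (1/2)^n)) = ennreal (c * (1/2)^m * 2)" for m
      using c by (intro suminf_ennreal_eq sums_mult g) auto
    moreover have "(\<Sum>m. ennreal (c * (1/2)^m * 2)) = ennreal (c * 2 * 2)"
      using c by (intro suminf_ennreal_eq sums_mult2 sums_mult g) auto
    ultimately show ?thesis by (simp add: mult.commute)
  qed
  finally have "(\<integral>\<^sup>+ \<omega>. S \<omega> \<partial>M) < \<infinity>" by (simp add: le_less_trans)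
  moreover have "S \<in> borel_measurable M" unfolding S_def by measurable
  ultimately have "AE \<omega> in M. S \<omega> \<noteq> \<infinity>" by (intro nn_integral_PInf_AE) auto
  then show ?thesis
  proof eventually_elim
    case (elim \<omega>)
    define s where "s = enn2real (S \<omega>)"
    have s: "S \<omega> = ennreal s" "0 \<le> s" using elim by (simp_all add: s_def less_top)
    show ?case
    \<comment> \<open>The maximum with 1 avoids a root of order \<open>2 * p\<close>: a value above
      1 is at most its own power, hence at most \<open>s\<close>.\<close>
    proof (intro exI[of _ "max 1 s"] conjI allI impI)
      fix m n j :: nat assume j: "j < 2^n"
      have "ennreal (X m n j \<omega> ^ (2 * p)) \<le> (\<Sum>j<2^n. ennreal (X m n j \<omega> ^ (2 * p)))"
        using j by (intro member_le_sum) auto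
      also have "\<dots> \<le> (\<Sum>n. \<Sum>j<2^n. ennreal (X m n j \<omega> ^ (2 * p)))"
        using sum_le_suminf[OF summableI, of "{n}" "\<lambda>n. \<Sum>j<2^n. ennreal (X m n j \<omega> ^ (2 * p))"] by simp
      also have "\<dots> \<le> S \<omega>"
        using sum_le_suminf[OF summableI, of "{m}" "\<lambda>m. \<Sum>n. \<Sum>j<2^n. ennreal (X m n j \<omega> ^ (2 * p))"] by (simp add: S_def)
      finally have le: "X m n j \<omega> ^ (2 * p) \<le> s" using s by simp
      have "\<bar>X m n j \<omega>\<bar> \<le> max 1 s"
      proof (rule ccontr)
        assume "\<not> \<bar>X m n j \<omega>\<bar> \<le> max 1 s"
        then have g: "1 < \<bar>X m n j \<omega>\<bar>" "s < \<bar>X m n j \<omega>\<bar>" by auto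
        have "\<bar>X m n j \<omega>\<bar> ^ 1 \<le> \<bar>X m n j \<omega>\<bar> ^ (2 * p)"
          using g p0 by (intro power_increasing) auto
        with g le show False by (simp add: power_even_abs)
      qed
      then show "\<bar>B (grid m n (Suc j)) \<omega> - B (grid m n j) \<omega>\<bar> \<le> max 1 s * ((2 powr (1/2 + \<delta>)) ^ m * (2 powr - (1/2 - \<delta>)) ^ n)"
        using w[of m n] unfolding X_def abs_divide w_def[symmetric] by (simp add: pos_divide_le_eq)
    qed simp
  qed
qed

text \<open>Chaining on the interval of half-length \<open>2^m\<close>, rescaled to the unit
  interval. The rescaling costs \<open>2 powr (- m * \<gamma>)\<close>, and
  \<open>(1/2 + \<delta>) - \<gamma> = 2 * \<delta>\<close> is the growth exponent of
  \<open>T\<close>.\<close>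

lemma AE_hoelder_growth:
  fixes \<delta> :: real
  assumes \<delta>: "0 < \<delta>" "\<delta> < 1/2"
  shows "AE \<omega> in M. hoelder_growth \<delta> (\<lambda>t. B t \<omega>)"
  using AE_grid_increments[OF \<delta>] AE_continuous
proof eventually_elim
  case (elim \<omega>)
  define b where "b t = B t \<omega>" for t
  define \<gamma> where "\<gamma> = 1/2 - \<delta>"
  have \<gamma>: "0 < \<gamma>" using \<delta> by (simp add: \<gamma>_def)
  from elim(1) obtain S where S: "0 \<le> S" and inc: "\<And>m n j. j < 2 ^ n \<Longrightarrow>
    \<bar>b (grid m n (Suc j)) - b (grid m n j)\<bar> \<le> S * ((2 powr (1/2 + \<delta>)) ^ m * (2 powr - \<gamma>) ^ n)"
    unfolding b_def \<gamma>_def by blast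
  have cont: "continuous_on UNIV b" using elim(2) by (simp add: b_def[abs_def])
  define A where "A = 2 * (1 + 1 / (1 - 2 powr -\<gamma>)) * 2 powr \<gamma>"
  have "2 powr -\<gamma> < 1" using \<gamma> by (simp add: powr_less_one)
  then have A: "0 \<le> A" unfolding A_def by (intro mult_nonneg_nonneg add_nonneg_nonneg divide_nonneg_nonneg) auto
  have box: "\<bar>b s - b t\<bar> \<le> S * A * (2 ^ m) powr (2 * \<delta>) * \<bar>s - t\<bar> powr \<gamma>"
    if st: "s \<in> {-(2^m)..2^m}" "t \<in> {-(2^m)..2^m}" for s t and m :: nat
  proof -
    define g where "g x = b (- (2^m) + 2 ^ Suc m * x)" for x
    define x where "x s = (s + 2^m) / 2 ^ Suc m" for s :: real
    have gx: "g (x s) = b s" for s unfolding g_def x_def by simp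
    have xin: "x s \<in> {0..1}" if "s \<in> {-(2^m)..2^m}" for s using that by (simp add: x_def field_simps)
    have xd: "\<bar>x s - x t\<bar> = \<bar>s - t\<bar> / 2 ^ Suc m" by (simp add: x_def diff_divide_distrib[symmetric])
    have "\<bar>g (x s) - g (x t)\<bar> \<le> 2 * (S * (2 powr (1/2 + \<delta>)) ^ m) * (1 + 1 / (1 - 2 powr -\<gamma>)) * 2 powr \<gamma> * \<bar>x s - x t\<bar> powr \<gamma>"
    proof (rule dyadic_hoelder[OF _ \<gamma>])
      show "continuous_on {0..1} g" unfolding g_def
        by (intro continuous_on_compose2[OF cont] continuous_intros) auto
      show "0 \<le> S * (2 powr (1/2 + \<delta>)) ^ m" using S by simp
      show "\<bar>g (real (Suc j) / 2 ^ n) - g (real j / 2 ^ n)\<bar> \<le> S * (2 powr (1 / 2 + \<delta>)) ^ m * (2 powr - \<gamma>) ^ n"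
        if "j < 2^n" for j n
        using inc[OF that, of m] by (simp only: g_def grid_def mult.assoc)
      show "x s \<in> {0..1}" "x t \<in> {0..1}" using st xin by auto
    qed
    also have "\<dots> = S * A * (((2 powr (1/2 + \<delta>)) ^ m) * (\<bar>s - t\<bar> / 2 ^ Suc m) powr \<gamma>)"
      unfolding A_def xd by (simp only: mult_ac)
    also have "((2 powr (1/2 + \<delta>)) ^ m) * (\<bar>s - t\<bar> / 2 ^ Suc m) powr \<gamma> \<le> (2 ^ m) powr (2 * \<delta>) * \<bar>s - t\<bar> powr \<gamma>"
    proof -
      have "(\<bar>s - t\<bar> / 2 ^ Suc m) powr \<gamma> \<le> (\<bar>s - t\<bar> / 2 ^ m) powr \<gamma>"
        using \<gamma> by (intro powr_mono2 divide_left_mono) auto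
      also have "\<dots> = \<bar>s - t\<bar> powr \<gamma> / 2 powr (m * \<gamma>)"
        by (simp add: powr_divide powr_realpow[symmetric] powr_powr)
      finally have "((2 powr (1/2 + \<delta>)) ^ m) * (\<bar>s - t\<bar> / 2 ^ Suc m) powr \<gamma>
          \<le> ((2 powr (1/2 + \<delta>)) ^ m) * (\<bar>s - t\<bar> powr \<gamma> / 2 powr (m * \<gamma>))"
        by (intro mult_left_mono) auto
      also have "\<dots> = 2 powr ((1/2 + \<delta>) * m - m * \<gamma>) * \<bar>s - t\<bar> powr \<gamma>"
        by (simp add: powr_diff powr_realpow[symmetric] powr_powr del: powr_power)
      also have "(1/2 + \<delta>) * m - m * \<gamma> = m * (2 * \<delta>)" by (simp add: \<gamma>_def algebra_simps)
      also have "2 powr (m * (2 * \<delta>)) = (2^m) powr (2 * \<delta>)" by (simp add: powr_realpow[symmetric] powr_powr del: powr_power)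
      finally show ?thesis .
    qed
    finally show ?thesis using S A unfolding gx by (simp add: mult_left_mono mult.assoc)
  qed
  show ?case unfolding hoelder_growth_def b_def[symmetric] \<gamma>_def[symmetric]
  proof (intro exI[of _ "S * A * 2 powr (2 * \<delta>)"] conjI allI impI ballI)
    show "0 \<le> S * A * 2 powr (2 * \<delta>)" using S A by simp
    fix T s t :: real assume T: "1 \<le> T" and st: "s \<in> {-T..T}" "t \<in> {-T..T}"
    \<comment> \<open>\<open>T\<close> is rounded up to a power of two with
      \<open>2^m \<le> 2 * T\<close>, which costs the factor
      \<open>2 powr (2 * \<delta>)\<close>.\<close>
    define m where "m = nat \<lceil>log 2 T\<rceil>"
    have l0: "0 \<le> log 2 T" using T by simp
    have mr: "real m = of_int \<lceil>log 2 T\<rceil>" using l0 by (simp add: m_def)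
    have "T = 2 powr (log 2 T)" using T by simp
    also have "\<dots> \<le> 2 powr (real m)" unfolding mr by (intro powr_mono) auto
    finally have T1: "T \<le> 2 ^ m" by (simp add: powr_realpow)
    have "2 powr (real m) \<le> 2 powr (log 2 T + 1)" unfolding mr by (intro powr_mono) linarith+
    also have "\<dots> = 2 * T" using T by (simp add: powr_add)
    finally have T2: "2 ^ m \<le> 2 * T" by (simp add: powr_realpow)
    have "\<bar>b s - b t\<bar> \<le> S * A * (2 ^ m) powr (2 * \<delta>) * \<bar>s - t\<bar> powr \<gamma>"
      using st T1 by (intro box) auto
    also have "\<dots> \<le> S * A * (2 * T) powr (2 * \<delta>) * \<bar>s - t\<bar> powr \<gamma>"
      using S A T2 \<delta> by (intro mult_right_mono mult_left_mono powr_mono2) auto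
    also have "\<dots> = S * A * 2 powr (2 * \<delta>) * T powr (2 * \<delta>) * \<bar>s - t\<bar> powr \<gamma>"
      using T by (simp add: powr_mult)
    finally show "\<bar>b s - b t\<bar> \<le> S * A * 2 powr (2 * \<delta>) * T powr (2 * \<delta>) * \<bar>s - t\<bar> powr \<gamma>" .
  qed
qed

end

section \<open>Wiener integrals\<close>

lemma nn_integral_square_add_le:
  fixes u v :: "'b \<Rightarrow> real"
  assumes [measurable]: "u \<in> borel_measurable N" "v \<in> borel_measurable N"
  shows "(\<integral>\<^sup>+ x. ennreal ((u x + v x)\<^sup>2) \<partial>N) \<le> 2 * (\<integral>\<^sup>+ x. ennreal ((u x)\<^sup>2) \<partial>N) + 2 * (\<integral>\<^sup>+ x. ennreal ((v x)\<^sup>2) \<partial>N)"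
proof -
  have "(\<integral>\<^sup>+ x. ennreal ((u x + v x)\<^sup>2) \<partial>N) \<le> (\<integral>\<^sup>+ x. 2 * ennreal ((u x)\<^sup>2) + 2 * ennreal ((v x)\<^sup>2) \<partial>N)"
  proof (rule nn_integral_mono)
    fix x
    have "(u x + v x)\<^sup>2 \<le> 2 * (u x)\<^sup>2 + 2 * (v x)\<^sup>2"
      using zero_le_power2[of "u x - v x"] by (simp add: power2_eq_square algebra_simps)
    then have "ennreal ((u x + v x)\<^sup>2) \<le> ennreal (2 * (u x)\<^sup>2 + 2 * (v x)\<^sup>2)" by (rule ennreal_leI)
    also have "\<dots> = 2 * ennreal ((u x)\<^sup>2) + 2 * ennreal ((v x)\<^sup>2)"
      by (simp add: ennreal_mult)
    finally show "ennreal ((u x + v x)\<^sup>2) \<le> 2 * ennreal ((u x)\<^sup>2) + 2 * ennreal ((v x)\<^sup>2)" .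
  qed
  also have "\<dots> = 2 * (\<integral>\<^sup>+ x. ennreal ((u x)\<^sup>2) \<partial>N) + 2 * (\<integral>\<^sup>+ x. ennreal ((v x)\<^sup>2) \<partial>N)"
    by (simp add: nn_integral_add nn_integral_cmult)
  finally show ?thesis .
qed

text \<open>Triangle inequality for squared distances at the price of a factor 2. Staying in
  \<open>ennreal\<close> spares roots and integrability conditions.\<close>

lemma nn_integral_square_diff_triangle:
  fixes u v w :: "'b \<Rightarrow> real"
  assumes [measurable]: "u \<in> borel_measurable N" "v \<in> borel_measurable N" "w \<in> borel_measurable N"
  shows "(\<integral>\<^sup>+ x. ennreal ((u x - w x)\<^sup>2) \<partial>N) \<le> 2 * (\<integral>\<^sup>+ x. ennreal ((u x - v x)\<^sup>2) \<partial>N) + 2 * (\<integral>\<^sup>+ x. ennreal ((v x - w x)\<^sup>2) \<partial>N)"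
  using nn_integral_square_add_le[of "\<lambda>x. u x - v x" N "\<lambda>x. v x - w x"] by simp

lemma nn_integral_square_diff_commute:
  fixes u v :: "'b \<Rightarrow> real" and N :: "'b measure"
  shows "(\<integral>\<^sup>+ x. ennreal ((u x - v x)\<^sup>2) \<partial>N) = (\<integral>\<^sup>+ x. ennreal ((v x - u x)\<^sup>2) \<partial>N)"
  by (simp add: power2_commute)

text \<open>The overlap is expressed through distances of endpoints because polarization delivers
  the covariance of two increments in this form.\<close>

lemma integral_indicator_Ioc_mult:
  fixes a b c d :: real
  assumes "a \<le> b" "c \<le> d"
  shows "integrable lborel (\<lambda>s. indicator {a<..b} s * indicator {c<..d} s :: real)"
    and "(\<integral>s. indicator {a<..b} s * indicator {c<..d} s \<partial>lborel) = (\<bar>b - c\<bar> + \<bar>a - d\<bar> - \<bar>b - d\<bar> - \<bar>a - c\<bar>) / 2"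
proof -
  have e: "(\<lambda>s. indicator {a<..b} s * indicator {c<..d} s :: real) = indicator {max a c<..min b d}"
    by (auto simp: fun_eq_iff split: split_indicator)
  show "integrable lborel (\<lambda>s. indicator {a<..b} s * indicator {c<..d} s :: real)"
  proof (cases "max a c \<le> min b d")
    case True
    then show ?thesis unfolding e by (simp add: integrable_indicator_iff del: min.bounded_iff max.bounded_iff)
  next
    case False
    then have eq: "{max a c<..min b d} = {}" by auto
    show ?thesis unfolding e eq by simp
  qed
  have "(\<integral>s. indicator {a<..b} s * indicator {c<..d} s \<partial>lborel) = measure lborel {max a c<..min b d}"
    unfolding e by simp
  also have "\<dots> = (if max a c \<le> min b d then min b d - max a c else 0)"
  proof (cases "max a c \<le> min b d")
    case False
    then have eq: "{max a c<..min b d} = {}" by auto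
    show ?thesis unfolding eq using False by (simp only: measure_empty if_False)
  qed (simp del: min.bounded_iff max.bounded_iff)
  finally show "(\<integral>s. indicator {a<..b} s * indicator {c<..d} s \<partial>lborel) = (\<bar>b - c\<bar> + \<bar>a - d\<bar> - \<bar>b - d\<bar> - \<bar>a - c\<bar>) / 2"
    using assms by (simp split: if_splits) linarith
qed

lemma borel_measurable_step_fun [measurable]: "step_fun xs \<in> borel_measurable borel"
proof (induction xs)
  case Nil
  then show ?case by (simp add: step_fun_def[abs_def])
next
  case (Cons x xs)
  obtain c a b where x: "x = (c, a, b)" by (cases x)
  have "step_fun (x # xs) = (\<lambda>s. c * indicator {a<..b} s + step_fun xs s)"
    by (simp add: step_fun_def[abs_def] x)
  then show ?case using Cons by simp
qed

lemma step_fun_Cons: "step_fun ((c, a, b) # xs) s = c * indicator {a<..b} s + step_fun xs s"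
  by (simp add: step_fun_def)

lemma step_integral_Cons: "step_integral B ((c, a, b) # xs) \<omega> = c * (B b \<omega> - B a \<omega>) + step_integral B xs \<omega>"
  by (simp add: step_integral_def)

text \<open>Makes the difference of two step functions a single list, so that the isometry for
  differences is an instance of the product formula.\<close>

definition step_neg :: "(real \<times> real \<times> real) list \<Rightarrow> (real \<times> real \<times> real) list" where
  "step_neg = map (\<lambda>(c, a, b). (- c, a, b))"

lemma step_neg_simps:
  "step_list (xs @ step_neg ys) \<longleftrightarrow> step_list xs \<and> step_list ys"
  "step_fun (xs @ step_neg ys) s = step_fun xs s - step_fun ys s"
  "step_integral B (xs @ step_neg ys) \<omega> = step_integral B xs \<omega> - step_integral B ys \<omega>"
proof -
  show "step_list (xs @ step_neg ys) \<longleftrightarrow> step_list xs \<and> step_list ys"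
    by (force simp: step_list_def step_neg_def)
  have "step_fun (step_neg ys) s = - step_fun ys s"
    by (induction ys) (auto simp: step_neg_def step_fun_def)
  then show "step_fun (xs @ step_neg ys) s = step_fun xs s - step_fun ys s"
    by (simp add: step_fun_def)
  have "step_integral B (step_neg ys) \<omega> = - step_integral B ys \<omega>"
    by (induction ys) (auto simp: step_neg_def step_integral_def algebra_simps)
  then show "step_integral B (xs @ step_neg ys) \<omega> = step_integral B xs \<omega> - step_integral B ys \<omega>"
    by (simp add: step_integral_def)
qed

section \<open>Isometry, uniqueness and closedness of the Wiener integral\<close>

context brownian
begin

lemma
  shows integrable_increment_square: "integrable M (\<lambda>\<omega>. (B t \<omega> - B s \<omega>)\<^sup>2)"
    and expectation_increment_square: "expectation (\<lambda>\<omega>. (B t \<omega> - B s \<omega>)\<^sup>2) = \<bar>t - s\<bar>"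
proof -
  have *: "has_bochner_integral M (\<lambda>\<omega>. (B t \<omega> - B s \<omega>)\<^sup>2) (t - s)" if "s < t" for s t
    using nn_moment_increment[OF that, of 1] that
    by (intro has_bochner_integral_nn_integral) auto
  have "has_bochner_integral M (\<lambda>\<omega>. (B t \<omega> - B s \<omega>)\<^sup>2) \<bar>t - s\<bar>"
    using *[of s t] *[of t s] by (cases s t rule: linorder_cases) (auto simp: power2_commute)
  then show "integrable M (\<lambda>\<omega>. (B t \<omega> - B s \<omega>)\<^sup>2)" "expectation (\<lambda>\<omega>. (B t \<omega> - B s \<omega>)\<^sup>2) = \<bar>t - s\<bar>"
    by (auto simp: has_bochner_integral_iff)
qed

lemma
  assumes "a \<le> b" "c \<le> d"
  shows integrable_increment_mult: "integrable M (\<lambda>\<omega>. (B b \<omega> - B a \<omega>) * (B d \<omega> - B c \<omega>))"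
    and expectation_increment_mult: "expectation (\<lambda>\<omega>. (B b \<omega> - B a \<omega>) * (B d \<omega> - B c \<omega>))
      = (\<integral>s. indicator {a<..b} s * indicator {c<..d} s \<partial>lborel)"
proof -
  \<comment> \<open>By polarization the covariance of increments is determined by their variances;
      independence is not needed.\<close>
  have e: "(B b \<omega> - B a \<omega>) * (B d \<omega> - B c \<omega>) = ((B b \<omega> - B c \<omega>)\<^sup>2 + (B a \<omega> - B d \<omega>)\<^sup>2
      - (B b \<omega> - B d \<omega>)\<^sup>2 - (B a \<omega> - B c \<omega>)\<^sup>2) / 2" for \<omega>
    by (simp add: power2_eq_square field_simps)
  show "integrable M (\<lambda>\<omega>. (B b \<omega> - B a \<omega>) * (B d \<omega> - B c \<omega>))"
    unfolding e by (intro integrable_divide Bochner_Integration.integrable_diff Bochner_Integration.integrable_add integrable_increment_square)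
  show "expectation (\<lambda>\<omega>. (B b \<omega> - B a \<omega>) * (B d \<omega> - B c \<omega>))
      = (\<integral>s. indicator {a<..b} s * indicator {c<..d} s \<partial>lborel)"
    unfolding e integral_indicator_Ioc_mult(2)[OF assms]
    by (simp add: integrable_increment_square expectation_increment_square)
qed

lemma measurable_step_integral [measurable]: "step_integral B xs \<in> borel_measurable M"
proof (induction xs)
  case Nil
  then show ?case by (simp add: step_integral_def[abs_def])
next
  case (Cons x xs)
  obtain c a b where x: "x = (c, a, b)" by (cases x)
  have "step_integral B (x # xs) = (\<lambda>\<omega>. c * (B b \<omega> - B a \<omega>) + step_integral B xs \<omega>)"
    by (simp add: step_integral_def[abs_def] x)
  then show ?case using Cons by simp
qed

text \<open>Bilinear extension of the covariance formula, one argument at a time. Integrability is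
  carried through the induction because additivity of the integrals relies on it.\<close>

lemma expectation_increment_step_integral:
  assumes "a \<le> b" "step_list ys"
  shows "integrable M (\<lambda>\<omega>. (B b \<omega> - B a \<omega>) * step_integral B ys \<omega>) \<and>
    integrable lborel (\<lambda>s. indicator {a<..b} s * step_fun ys s) \<and>
    expectation (\<lambda>\<omega>. (B b \<omega> - B a \<omega>) * step_integral B ys \<omega>) = (\<integral>s. indicator {a<..b} s * step_fun ys s \<partial>lborel)"
  using assms(2)
proof (induction ys)
  case Nil
  then show ?case by (simp add: step_integral_def step_fun_def)
next
  case (Cons y ys)
  obtain c u v where y: "y = (c, u, v)" by (cases y)
  have uv: "u \<le> v" and l: "step_list ys" using Cons.prems by (auto simp: step_list_def y)
  note IH = Cons.IH[OF l]
  have e1: "(B b \<omega> - B a \<omega>) * step_integral B (y # ys) \<omega>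
      = c * ((B b \<omega> - B a \<omega>) * (B v \<omega> - B u \<omega>)) + (B b \<omega> - B a \<omega>) * step_integral B ys \<omega>" for \<omega>
    by (simp add: step_integral_Cons y algebra_simps)
  have e2: "indicator {a<..b} s * step_fun (y # ys) s
      = c * (indicator {a<..b} s * indicator {u<..v} s) + indicator {a<..b} s * step_fun ys s" for s
    by (simp add: step_fun_Cons y algebra_simps)
  show ?case
    unfolding e1 e2 using IH integrable_increment_mult[OF assms(1) uv] integral_indicator_Ioc_mult(1)[OF assms(1) uv]
    by (simp add: expectation_increment_mult[OF assms(1) uv])
qed

lemma expectation_step_integral_mult:
  assumes "step_list xs" "step_list ys"
  shows "integrable M (\<lambda>\<omega>. step_integral B xs \<omega> * step_integral B ys \<omega>) \<and>
    integrable lborel (\<lambda>s. step_fun xs s * step_fun ys s) \<and>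
    expectation (\<lambda>\<omega>. step_integral B xs \<omega> * step_integral B ys \<omega>) = (\<integral>s. step_fun xs s * step_fun ys s \<partial>lborel)"
  using assms(1)
proof (induction xs)
  case Nil
  then show ?case by (simp add: step_integral_def step_fun_def)
next
  case (Cons x xs)
  obtain c a b where x: "x = (c, a, b)" by (cases x)
  have ab: "a \<le> b" and l: "step_list xs" using Cons.prems by (auto simp: step_list_def x)
  have e1: "step_integral B (x # xs) \<omega> * step_integral B ys \<omega>
      = c * ((B b \<omega> - B a \<omega>) * step_integral B ys \<omega>) + step_integral B xs \<omega> * step_integral B ys \<omega>" for \<omega>
    by (simp add: step_integral_Cons x algebra_simps)
  have e2: "step_fun (x # xs) s * step_fun ys s
      = c * (indicator {a<..b} s * step_fun ys s) + step_fun xs s * step_fun ys s" for s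
    by (simp add: step_fun_Cons x algebra_simps)
  show ?case
    unfolding e1 e2 using Cons.IH[OF l] expectation_increment_step_integral[OF ab assms(2)]
    by simp
qed

lemma step_integral_isometry:
  assumes "step_list xs" "step_list ys"
  shows "(\<integral>\<^sup>+ \<omega>. ennreal ((step_integral B xs \<omega> - step_integral B ys \<omega>)\<^sup>2) \<partial>M)
    = (\<integral>\<^sup>+ s. ennreal ((step_fun xs s - step_fun ys s)\<^sup>2) \<partial>lborel)"
proof -
  have l: "step_list (xs @ step_neg ys)" using assms by (simp add: step_neg_simps)
  note e = expectation_step_integral_mult[OF l l, unfolded step_neg_simps, folded power2_eq_square]
  show ?thesis
    using e by (simp add: nn_integral_eq_integral)
qed

lemma has_wiener_integral_step:
  "step_list xs \<Longrightarrow> has_wiener_integral M B (step_fun xs) (step_integral B xs)"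
  unfolding has_wiener_integral_def by (intro conjI exI[of _ "\<lambda>_. xs"]) simp_all

text \<open>The isometry up to a constant, which is all that uniqueness and closedness need.\<close>

lemma has_wiener_integral_distance_le:
  assumes "has_wiener_integral M B f Y" "has_wiener_integral M B g Z"
  shows "(\<integral>\<^sup>+ \<omega>. ennreal ((Y \<omega> - Z \<omega>)\<^sup>2) \<partial>M) \<le> 16 * (\<integral>\<^sup>+ s. ennreal ((f s - g s)\<^sup>2) \<partial>lborel)"
proof -
  have [measurable]: "Y \<in> borel_measurable M" "Z \<in> borel_measurable M" "f \<in> borel_measurable lborel" "g \<in> borel_measurable lborel"
    using assms by (simp_all add: has_wiener_integral_def)
  obtain \<phi> where \<phi>: "\<And>n. step_list (\<phi> n)"
    and \<phi>f: "(\<lambda>n. \<integral>\<^sup>+ s. ennreal ((step_fun (\<phi> n) s - f s)\<^sup>2) \<partial>lborel) \<longlonglongrightarrow> 0"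
    and \<phi>Y: "(\<lambda>n. \<integral>\<^sup>+ \<omega>. ennreal ((step_integral B (\<phi> n) \<omega> - Y \<omega>)\<^sup>2) \<partial>M) \<longlonglongrightarrow> 0"
    using assms(1) unfolding has_wiener_integral_def by blast
  obtain \<psi> where \<psi>: "\<And>n. step_list (\<psi> n)"
    and \<psi>g: "(\<lambda>n. \<integral>\<^sup>+ s. ennreal ((step_fun (\<psi> n) s - g s)\<^sup>2) \<partial>lborel) \<longlonglongrightarrow> 0"
    and \<psi>Z: "(\<lambda>n. \<integral>\<^sup>+ \<omega>. ennreal ((step_integral B (\<psi> n) \<omega> - Z \<omega>)\<^sup>2) \<partial>M) \<longlonglongrightarrow> 0"
    using assms(2) unfolding has_wiener_integral_def by blast
  define a where "a n = (\<integral>\<^sup>+ s. ennreal ((step_fun (\<phi> n) s - f s)\<^sup>2) \<partial>lborel)" for n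
  define b where "b n = (\<integral>\<^sup>+ \<omega>. ennreal ((step_integral B (\<phi> n) \<omega> - Y \<omega>)\<^sup>2) \<partial>M)" for n
  define c where "c n = (\<integral>\<^sup>+ s. ennreal ((step_fun (\<psi> n) s - g s)\<^sup>2) \<partial>lborel)" for n
  define d where "d n = (\<integral>\<^sup>+ \<omega>. ennreal ((step_integral B (\<psi> n) \<omega> - Z \<omega>)\<^sup>2) \<partial>M)" for n
  define e where "e = (\<integral>\<^sup>+ s. ennreal ((f s - g s)\<^sup>2) \<partial>lborel)"
  \<comment> \<open>The chain runs from \<open>Y\<close> to the elementary integral of
    \<open>\<phi> n\<close>, then to that of \<open>\<psi> n\<close>, then to \<open>Z\<close>. The
    isometry moves the middle link to functions, where it passes through \<open>f\<close> and
    \<open>g\<close>. Four triangle inequalities enclose \<open>e\<close>, hence the constant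
    \<open>2^4 = 16\<close>.\<close>
  have bound: "(\<integral>\<^sup>+ \<omega>. ennreal ((Y \<omega> - Z \<omega>)\<^sup>2) \<partial>M) \<le> 2 * b n + 2 * (2 * (2 * a n + 2 * (2 * e + 2 * c n)) + 2 * d n)" for n
  proof -
    have "(\<integral>\<^sup>+ \<omega>. ennreal ((Y \<omega> - Z \<omega>)\<^sup>2) \<partial>M) \<le> 2 * b n + 2 * (\<integral>\<^sup>+ \<omega>. ennreal ((step_integral B (\<phi> n) \<omega> - Z \<omega>)\<^sup>2) \<partial>M)"
      unfolding b_def nn_integral_square_diff_commute[where u="step_integral B (\<phi> n)" and v=Y]
      by (intro nn_integral_square_diff_triangle) measurable
    also have "(\<integral>\<^sup>+ \<omega>. ennreal ((step_integral B (\<phi> n) \<omega> - Z \<omega>)\<^sup>2) \<partial>M)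
        \<le> 2 * (\<integral>\<^sup>+ \<omega>. ennreal ((step_integral B (\<phi> n) \<omega> - step_integral B (\<psi> n) \<omega>)\<^sup>2) \<partial>M) + 2 * d n"
      unfolding d_def by (intro nn_integral_square_diff_triangle) measurable
    also have "(\<integral>\<^sup>+ \<omega>. ennreal ((step_integral B (\<phi> n) \<omega> - step_integral B (\<psi> n) \<omega>)\<^sup>2) \<partial>M)
        = (\<integral>\<^sup>+ s. ennreal ((step_fun (\<phi> n) s - step_fun (\<psi> n) s)\<^sup>2) \<partial>lborel)"
      by (rule step_integral_isometry[OF \<phi> \<psi>])
    also have "\<dots> \<le> 2 * a n + 2 * (\<integral>\<^sup>+ s. ennreal ((f s - step_fun (\<psi> n) s)\<^sup>2) \<partial>lborel)"
      unfolding a_def by (intro nn_integral_square_diff_triangle) measurable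
    also have "(\<integral>\<^sup>+ s. ennreal ((f s - step_fun (\<psi> n) s)\<^sup>2) \<partial>lborel) \<le> 2 * e + 2 * c n"
      unfolding c_def e_def nn_integral_square_diff_commute[where u="step_fun (\<psi> n)" and v=g]
      by (intro nn_integral_square_diff_triangle) measurable
    finally show ?thesis by (simp add: add_left_mono mult_left_mono)
  qed
  have "(\<lambda>n. 2 * b n + 2 * (2 * (2 * a n + 2 * (2 * e + 2 * c n)) + 2 * d n))
     \<longlonglongrightarrow> 2 * 0 + 2 * (2 * (2 * 0 + 2 * (2 * e + 2 * 0)) + 2 * 0)"
    by (intro tendsto_add ennreal_tendsto_cmult tendsto_const)
       (use \<phi>f \<phi>Y \<psi>g \<psi>Z in \<open>simp_all add: a_def b_def c_def d_def\<close>)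
  then have "(\<integral>\<^sup>+ \<omega>. ennreal ((Y \<omega> - Z \<omega>)\<^sup>2) \<partial>M) \<le> 2 * 0 + 2 * (2 * (2 * 0 + 2 * (2 * e + 2 * 0)) + 2 * 0)"
    by (rule LIMSEQ_le_const) (use bound in auto)
  also have "\<dots> = 16 * e" by (simp add: mult.assoc[symmetric])
  finally show ?thesis by (simp add: e_def)
qed

definition ae_wiener :: "(real \<Rightarrow> real) \<Rightarrow> ('a \<Rightarrow> real) \<Rightarrow> bool" where
  "ae_wiener f Z \<longleftrightarrow> (\<exists>Y. has_wiener_integral M B f Y \<and> (AE \<omega> in M. Y \<omega> = Z \<omega>))"

lemma ae_wiener_AE_eq:
  assumes "ae_wiener f Z" "has_wiener_integral M B f Y"
  shows "AE \<omega> in M. Y \<omega> = Z \<omega>"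
proof -
  from assms(1) obtain W where W: "has_wiener_integral M B f W" "AE \<omega> in M. W \<omega> = Z \<omega>"
    unfolding ae_wiener_def by blast
  have [measurable]: "Y \<in> borel_measurable M" "W \<in> borel_measurable M"
    using assms W by (simp_all add: has_wiener_integral_def)
  have "(\<integral>\<^sup>+ \<omega>. ennreal ((Y \<omega> - W \<omega>)\<^sup>2) \<partial>M) = 0"
    using has_wiener_integral_distance_le[OF assms(2) W(1)] by simp
  then have "AE \<omega> in M. ennreal ((Y \<omega> - W \<omega>)\<^sup>2) = 0"
    by (subst (asm) nn_integral_0_iff_AE) auto
  with W(2) show ?thesis by eventually_elim simp
qed

text \<open>Almost sure convergence of the integrals is enough: Fatou's lemma upgrades it to convergence in
  \<open>L\<^sup>2\<close>, since by the previous bound the integrals form a Cauchy sequence there.\<close>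

lemma ae_wiener_closed:
  assumes f [measurable]: "f \<in> borel_measurable borel"
    and w: "\<And>n. ae_wiener (g n) (Z n)"
    and gf: "(\<lambda>n. \<integral>\<^sup>+ s. ennreal ((g n s - f s)\<^sup>2) \<partial>lborel) \<longlonglongrightarrow> 0"
    and Z: "AE \<omega> in M. (\<lambda>n. Z n \<omega>) \<longlonglongrightarrow> Z' \<omega>"
  shows "ae_wiener f Z'"
proof -
  obtain Y where Y: "\<And>n. has_wiener_integral M B (g n) (Y n)" and YZ: "\<And>n. AE \<omega> in M. Y n \<omega> = Z n \<omega>"
    using w unfolding ae_wiener_def by metis
  have [measurable]: "Y n \<in> borel_measurable M" "g n \<in> borel_measurable borel" for n
    using Y[of n] by (simp_all add: has_wiener_integral_def)
  \<comment> \<open>A measurable stand-in for \<open>Z'\<close>, which is known only as an almost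
    sure limit.\<close>
  define L where "L \<omega> = lim (\<lambda>n. Y n \<omega>)" for \<omega>
  have [measurable]: "L \<in> borel_measurable M" unfolding L_def by measurable
  have "AE \<omega> in M. \<forall>n. Y n \<omega> = Z n \<omega>" using YZ by (simp add: AE_all_countable)
  with Z have conv: "AE \<omega> in M. (\<lambda>n. Y n \<omega>) \<longlonglongrightarrow> L \<omega> \<and> L \<omega> = Z' \<omega>"
    by eventually_elim (simp add: L_def limI)
  define e where "e n = (\<integral>\<^sup>+ s. ennreal ((g n s - f s)\<^sup>2) \<partial>lborel)" for n
  have e0: "e \<longlonglongrightarrow> 0" using gf by (simp add: e_def[abs_def])
  \<comment> \<open>32 is the constant 16 of the distance bound times the factor 2 of the triangle
    inequality; the term \<open>e m\<close> disappears in the limit inferior.\<close>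
  have YL: "(\<integral>\<^sup>+ \<omega>. ennreal ((Y n \<omega> - L \<omega>)\<^sup>2) \<partial>M) \<le> 32 * e n" for n
  proof -
    have "(\<integral>\<^sup>+ \<omega>. ennreal ((Y n \<omega> - L \<omega>)\<^sup>2) \<partial>M) = (\<integral>\<^sup>+ \<omega>. liminf (\<lambda>m. ennreal ((Y n \<omega> - Y m \<omega>)\<^sup>2)) \<partial>M)"
    proof (rule nn_integral_cong_AE, use conv in eventually_elim)
      case (elim \<omega>)
      then have "(\<lambda>m. ennreal ((Y n \<omega> - Y m \<omega>)\<^sup>2)) \<longlonglongrightarrow> ennreal ((Y n \<omega> - L \<omega>)\<^sup>2)"
        by (intro tendsto_intros) auto
      then show ?case by (rule lim_imp_Liminf[OF trivial_limit_sequentially, symmetric])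
    qed
    also have "\<dots> \<le> liminf (\<lambda>m. \<integral>\<^sup>+ \<omega>. ennreal ((Y n \<omega> - Y m \<omega>)\<^sup>2) \<partial>M)"
      by (intro nn_integral_liminf) measurable
    also have "\<dots> \<le> liminf (\<lambda>m. 16 * (2 * e n + 2 * e m))"
    proof (intro Liminf_mono always_eventually allI)
      fix m
      have "(\<integral>\<^sup>+ \<omega>. ennreal ((Y n \<omega> - Y m \<omega>)\<^sup>2) \<partial>M) \<le> 16 * (\<integral>\<^sup>+ s. ennreal ((g n s - g m s)\<^sup>2) \<partial>lborel)"
        by (intro has_wiener_integral_distance_le Y)
      also have "(\<integral>\<^sup>+ s. ennreal ((g n s - g m s)\<^sup>2) \<partial>lborel) \<le> 2 * e n + 2 * e m"
        unfolding e_def nn_integral_square_diff_commute[where u="g m" and v=f]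
        by (intro nn_integral_square_diff_triangle) measurable
      finally show "(\<integral>\<^sup>+ \<omega>. ennreal ((Y n \<omega> - Y m \<omega>)\<^sup>2) \<partial>M) \<le> 16 * (2 * e n + 2 * e m)"
        by (simp add: mult_left_mono)
    qed
    also have "\<dots> = 16 * (2 * e n + 2 * 0)"
      by (intro lim_imp_Liminf tendsto_add ennreal_tendsto_cmult tendsto_const e0) auto
    finally show ?thesis by (simp add: mult.assoc[symmetric])
  qed
  \<comment> \<open>Diagonal choice: for each \<open>n\<close> one step function approximates
    \<open>g n\<close> and its integral approximates \<open>Y n\<close> simultaneously.\<close>
  have "\<exists>xs. step_list xs \<and> (\<integral>\<^sup>+ s. ennreal ((step_fun xs s - g n s)\<^sup>2) \<partial>lborel) < ennreal (1 / Suc n) \<and>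
      (\<integral>\<^sup>+ \<omega>. ennreal ((step_integral B xs \<omega> - Y n \<omega>)\<^sup>2) \<partial>M) < ennreal (1 / Suc n)" for n
  proof -
    obtain \<phi> where \<phi>: "\<And>n. step_list (\<phi> n)"
      and \<phi>f: "(\<lambda>m. \<integral>\<^sup>+ s. ennreal ((step_fun (\<phi> m) s - g n s)\<^sup>2) \<partial>lborel) \<longlonglongrightarrow> 0"
      and \<phi>Y: "(\<lambda>m. \<integral>\<^sup>+ \<omega>. ennreal ((step_integral B (\<phi> m) \<omega> - Y n \<omega>)\<^sup>2) \<partial>M) \<longlonglongrightarrow> 0"
      using Y[of n] unfolding has_wiener_integral_def by blast
    have pos: "0 < ennreal (1 / Suc n)" by simp
    have "eventually (\<lambda>m. (\<integral>\<^sup>+ s. ennreal ((step_fun (\<phi> m) s - g n s)\<^sup>2) \<partial>lborel) < ennreal (1 / Suc n) \<and>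
      (\<integral>\<^sup>+ \<omega>. ennreal ((step_integral B (\<phi> m) \<omega> - Y n \<omega>)\<^sup>2) \<partial>M) < ennreal (1 / Suc n)) sequentially"
      by (intro eventually_conj order_tendstoD(2)[OF \<phi>f pos] order_tendstoD(2)[OF \<phi>Y pos])
    from eventually_happens'[OF sequentially_bot this] show ?thesis using \<phi> by blast
  qed
  then have "\<exists>\<phi>. \<forall>n. step_list (\<phi> n) \<and> (\<integral>\<^sup>+ s. ennreal ((step_fun (\<phi> n) s - g n s)\<^sup>2) \<partial>lborel) < ennreal (1 / Suc n) \<and>
      (\<integral>\<^sup>+ \<omega>. ennreal ((step_integral B (\<phi> n) \<omega> - Y n \<omega>)\<^sup>2) \<partial>M) < ennreal (1 / Suc n)"
    by (intro choice allI)
  then obtain \<phi> where \<phi>: "\<And>n. step_list (\<phi> n)"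
    and \<phi>f: "\<And>n. (\<integral>\<^sup>+ s. ennreal ((step_fun (\<phi> n) s - g n s)\<^sup>2) \<partial>lborel) < ennreal (1 / Suc n)"
    and \<phi>Y: "\<And>n. (\<integral>\<^sup>+ \<omega>. ennreal ((step_integral B (\<phi> n) \<omega> - Y n \<omega>)\<^sup>2) \<partial>M) < ennreal (1 / Suc n)"
    by blast
  have "(\<lambda>n. 1 / real (Suc n)) \<longlonglongrightarrow> 0" by (rule LIMSEQ_Suc[OF lim_1_over_n])
  then have h0: "(\<lambda>n. ennreal (1 / Suc n)) \<longlonglongrightarrow> 0"
    using tendsto_ennrealI[of "\<lambda>n. 1 / real (Suc n)" 0 sequentially] by simp
  have "has_wiener_integral M B f L"
    unfolding has_wiener_integral_def
  proof (intro conjI exI[of _ \<phi>] allI \<phi>)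
    show "(\<lambda>n. \<integral>\<^sup>+ s. ennreal ((step_fun (\<phi> n) s - f s)\<^sup>2) \<partial>lborel) \<longlonglongrightarrow> 0"
    proof (rule tendsto_sandwich[OF _ _ tendsto_const])
      show "\<forall>\<^sub>F n in sequentially. (\<integral>\<^sup>+ s. ennreal ((step_fun (\<phi> n) s - f s)\<^sup>2) \<partial>lborel) \<le> 2 * ennreal (1 / Suc n) + 2 * e n"
      proof (intro always_eventually allI)
        fix n
        have "(\<integral>\<^sup>+ s. ennreal ((step_fun (\<phi> n) s - f s)\<^sup>2) \<partial>lborel)
          \<le> 2 * (\<integral>\<^sup>+ s. ennreal ((step_fun (\<phi> n) s - g n s)\<^sup>2) \<partial>lborel) + 2 * e n"
          unfolding e_def by (intro nn_integral_square_diff_triangle) measurable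
        also have "\<dots> \<le> 2 * ennreal (1 / Suc n) + 2 * e n"
          using \<phi>f[of n] by (intro add_right_mono mult_left_mono) auto
        finally show "(\<integral>\<^sup>+ s. ennreal ((step_fun (\<phi> n) s - f s)\<^sup>2) \<partial>lborel) \<le> 2 * ennreal (1 / Suc n) + 2 * e n" .
      qed
      have "(\<lambda>n. 2 * ennreal (1 / Suc n) + 2 * e n) \<longlonglongrightarrow> 2 * 0 + 2 * 0"
        by (intro tendsto_add ennreal_tendsto_cmult h0 e0) auto
      then show "(\<lambda>n. 2 * ennreal (1 / Suc n) + 2 * e n) \<longlonglongrightarrow> 0" by simp
    qed simp
    show "(\<lambda>n. \<integral>\<^sup>+ \<omega>. ennreal ((step_integral B (\<phi> n) \<omega> - L \<omega>)\<^sup>2) \<partial>M) \<longlonglongrightarrow> 0"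
    proof (rule tendsto_sandwich[OF _ _ tendsto_const])
      show "\<forall>\<^sub>F n in sequentially. (\<integral>\<^sup>+ \<omega>. ennreal ((step_integral B (\<phi> n) \<omega> - L \<omega>)\<^sup>2) \<partial>M) \<le> 2 * ennreal (1 / Suc n) + 2 * (32 * e n)"
      proof (intro always_eventually allI)
        fix n
        have "(\<integral>\<^sup>+ \<omega>. ennreal ((step_integral B (\<phi> n) \<omega> - L \<omega>)\<^sup>2) \<partial>M)
          \<le> 2 * (\<integral>\<^sup>+ \<omega>. ennreal ((step_integral B (\<phi> n) \<omega> - Y n \<omega>)\<^sup>2) \<partial>M) + 2 * (\<integral>\<^sup>+ \<omega>. ennreal ((Y n \<omega> - L \<omega>)\<^sup>2) \<partial>M)"
          by (intro nn_integral_square_diff_triangle) measurable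
        also have "\<dots> \<le> 2 * ennreal (1 / Suc n) + 2 * (32 * e n)"
          using \<phi>Y[of n] YL[of n] by (intro add_mono mult_left_mono) auto
        finally show "(\<integral>\<^sup>+ \<omega>. ennreal ((step_integral B (\<phi> n) \<omega> - L \<omega>)\<^sup>2) \<partial>M) \<le> 2 * ennreal (1 / Suc n) + 2 * (32 * e n)" .
      qed
      have "(\<lambda>n. 2 * ennreal (1 / Suc n) + 2 * (32 * e n)) \<longlonglongrightarrow> 2 * 0 + 2 * (32 * 0)"
        by (intro tendsto_add ennreal_tendsto_cmult h0 e0) auto
      then show "(\<lambda>n. 2 * ennreal (1 / Suc n) + 2 * (32 * e n)) \<longlonglongrightarrow> 0" by simp
    qed simp
  qed simp_all
  moreover have "AE \<omega> in M. L \<omega> = Z' \<omega>" using conv by eventually_elim simp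
  ultimately show ?thesis unfolding ae_wiener_def by blast
qed

end

section \<open>Riemann-Stieltjes sums and integration by parts on compact intervals\<close>

lemma step_fun_grid_approx:
  fixes f x :: "real \<Rightarrow> real" and u :: "nat \<Rightarrow> real"
  assumes mono: "\<And>i. u i \<le> u (Suc i)"
    and close: "\<And>i s. i < N \<Longrightarrow> s \<in> {u i<..u (Suc i)} \<Longrightarrow> \<bar>f (u (Suc i)) - f s\<bar> \<le> e"
  shows "\<bar>step_fun (map (\<lambda>i. (f (u (Suc i)), u i, u (Suc i))) [0..<N]) s - indicator {u 0<..u N} s * f s\<bar>
     \<le> e * indicator {u 0<..u N} s"
proof -
  have le: "u 0 \<le> u k" for k by (induction k) (use mono order_trans in blast)+
  \<comment> \<open>Half-open cells are disjoint and fill the interval exactly, so at each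
    \<open>s\<close> the error is that of the single cell containing \<open>s\<close>.\<close>
  have ind: "(\<Sum>i<N. indicator {u i<..u (Suc i)} s) = (indicator {u 0<..u N} s :: real)"
  proof (induction N)
    case (Suc k)
    show ?case using Suc le[of k] mono[of k] by (auto split: split_indicator)
  qed simp
  have "step_fun (map (\<lambda>i. (f (u (Suc i)), u i, u (Suc i))) [0..<N]) s
      = (\<Sum>i<N. f (u (Suc i)) * indicator {u i<..u (Suc i)} s)"
    by (simp add: step_fun_def interv_sum_list_conv_sum_set_nat comp_def atLeast0LessThan)
  then have "\<bar>step_fun (map (\<lambda>i. (f (u (Suc i)), u i, u (Suc i))) [0..<N]) s - indicator {u 0<..u N} s * f s\<bar>
      = \<bar>\<Sum>i<N. (f (u (Suc i)) - f s) * indicator {u i<..u (Suc i)} s\<bar>"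
    by (simp add: ind[symmetric] sum_distrib_left sum_distrib_right sum_subtractf left_diff_distrib mult.commute)
  also have "\<dots> \<le> (\<Sum>i<N. \<bar>(f (u (Suc i)) - f s) * indicator {u i<..u (Suc i)} s\<bar>)"
    by (rule sum_abs)
  also have "\<dots> \<le> (\<Sum>i<N. e * indicator {u i<..u (Suc i)} s)"
    by (intro sum_mono) (use close in \<open>auto simp: abs_mult split: split_indicator\<close>)
  also have "\<dots> = e * indicator {u 0<..u N} s" by (simp add: sum_distrib_left[symmetric] ind)
  finally show ?thesis .
qed

text \<open>Summation by parts, with the mean value inequality on each cell applied to \<open>F - b (u i) * f\<close>.\<close>

lemma stieltjes_grid_approx:
  fixes f f' b :: "real \<Rightarrow> real" and u :: "nat \<Rightarrow> real"
  assumes mono: "\<And>i. u i \<le> u (Suc i)"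
    and der: "\<And>s. s \<in> {u 0..u N} \<Longrightarrow> (f has_real_derivative f' s) (at s within {u 0..u N})"
    and contf: "continuous_on {u 0..u N} f'" and bound: "\<And>s. s \<in> {u 0..u N} \<Longrightarrow> \<bar>f' s\<bar> \<le> K"
    and contb: "continuous_on {u 0..u N} b"
    and close: "\<And>i s. i < N \<Longrightarrow> s \<in> {u i..u (Suc i)} \<Longrightarrow> \<bar>b s - b (u i)\<bar> \<le> e"
    and e: "0 \<le> e"
  shows "\<bar>(\<Sum>i<N. f (u (Suc i)) * (b (u (Suc i)) - b (u i)))
     - (f (u N) * b (u N) - f (u 0) * b (u 0) - integral {u 0..u N} (\<lambda>s. f' s * b s))\<bar> \<le> K * e * (u N - u 0)"
proof -
  define F where "F x = integral {u 0..x} (\<lambda>s. f' s * b s)" for x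
  have le: "u i \<le> u j" if "i \<le> j" for i j using mono that by (rule lift_Suc_mono_le)
  have F': "(F has_real_derivative f' s * b s) (at s within {u 0..u N})" if "s \<in> {u 0..u N}" for s
    unfolding F_def using that by (intro integral_has_real_derivative continuous_intros contf contb) auto
  have cell: "\<bar>(F (u (Suc i)) - b (u i) * f (u (Suc i))) - (F (u i) - b (u i) * f (u i))\<bar> \<le> K * e * (u (Suc i) - u i)"
    if i: "i < N" for i
  proof -
    have sub: "{u i..u (Suc i)} \<subseteq> {u 0..u N}" using le[of 0 i] le[of "Suc i" N] i by auto
    have "norm ((F (u (Suc i)) - b (u i) * f (u (Suc i))) - (F (u i) - b (u i) * f (u i))) \<le> (K * e) * norm (u (Suc i) - u i)"
    proof (rule field_differentiable_bound[of "{u i..u (Suc i)}" _ "\<lambda>s. f' s * b s - b (u i) * f' s"])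
      fix s assume s: "s \<in> {u i..u (Suc i)}"
      then have s': "s \<in> {u 0..u N}" using sub by blast
      show "((\<lambda>x. F x - b (u i) * f x) has_field_derivative f' s * b s - b (u i) * f' s) (at s within {u i..u (Suc i)})"
        by (intro DERIV_diff DERIV_cmult DERIV_subset[OF F'[OF s'] sub] DERIV_subset[OF der[OF s'] sub])
      have "norm (f' s * b s - b (u i) * f' s) = \<bar>f' s\<bar> * \<bar>b s - b (u i)\<bar>"
        by (simp add: abs_mult[symmetric] algebra_simps)
      also have "\<dots> \<le> K * e"
        using bound[OF s'] close[OF i s] by (intro mult_mono) auto
      finally show "norm (f' s * b s - b (u i) * f' s) \<le> K * e" .
    qed (use mono in auto)
    then show ?thesis using mono[of i] by simp
  qed
  have "f (u N) * b (u N) - f (u 0) * b (u 0) = (\<Sum>i<N. f (u (Suc i)) * b (u (Suc i)) - f (u i) * b (u i))"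
    by (rule sum_lessThan_telescope[of "\<lambda>i. f (u i) * b (u i)", symmetric])
  moreover have "integral {u 0..u N} (\<lambda>s. f' s * b s) = (\<Sum>i<N. F (u (Suc i)) - F (u i))"
    using sum_lessThan_telescope[of "\<lambda>i. F (u i)" N] by (simp add: F_def)
  ultimately have "(\<Sum>i<N. f (u (Suc i)) * (b (u (Suc i)) - b (u i)))
     - (f (u N) * b (u N) - f (u 0) * b (u 0) - integral {u 0..u N} (\<lambda>s. f' s * b s))
     = (\<Sum>i<N. (F (u (Suc i)) - b (u i) * f (u (Suc i))) - (F (u i) - b (u i) * f (u i)))"
    by (simp add: sum.distrib sum_subtractf algebra_simps)
  also have "\<bar>\<dots>\<bar> \<le> (\<Sum>i<N. K * e * (u (Suc i) - u i))"
    by (rule order_trans[OF sum_abs]) (intro sum_mono cell, simp)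
  also have "\<dots> = K * e * (u N - u 0)"
    by (simp add: sum_distrib_left[symmetric] sum_lessThan_telescope)
  finally show ?thesis .
qed

lemma uniform_grid_close:
  fixes g :: "real \<Rightarrow> real" and p q e :: real
  assumes cont: "continuous_on {p..q} g" and pq: "p \<le> q" and e: "0 < e"
  shows "\<forall>\<^sub>F n in sequentially. \<forall>i < Suc n. \<forall>s t. s \<in> {p + (q - p) * i / Suc n..p + (q - p) * Suc i / Suc n} \<longrightarrow>
     t \<in> {p + (q - p) * i / Suc n..p + (q - p) * Suc i / Suc n} \<longrightarrow> \<bar>g s - g t\<bar> \<le> e"
proof -
  have "uniformly_continuous_on {p..q} g" using cont by (intro compact_uniformly_continuous) auto
  then obtain d where d: "0 < d" "\<And>s t. s \<in> {p..q} \<Longrightarrow> t \<in> {p..q} \<Longrightarrow> \<bar>s - t\<bar> < d \<Longrightarrow> \<bar>g s - g t\<bar> < e"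
    using e unfolding uniformly_continuous_on_def dist_real_def by metis
  have "(\<lambda>n. (q - p) * (1 / real (Suc n))) \<longlonglongrightarrow> (q - p) * 0"
    by (intro tendsto_mult_left LIMSEQ_Suc[OF lim_1_over_n])
  then have "\<forall>\<^sub>F n in sequentially. (q - p) * (1 / real (Suc n)) < d"
    using d(1) by (intro order_tendstoD) auto
  then show ?thesis
  proof (eventually_elim, intro allI impI)
    fix n i :: nat and s t :: real
    assume elim: "(q - p) * (1 / real (Suc n)) < d" "i < Suc n"
      "s \<in> {p + (q - p) * i / Suc n..p + (q - p) * Suc i / Suc n}"
      "t \<in> {p + (q - p) * i / Suc n..p + (q - p) * Suc i / Suc n}"
    have a: "p \<le> p + (q - p) * i / Suc n" using pq by simp
    have "(q - p) * Suc i / Suc n \<le> (q - p) * Suc n / Suc n"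
      using elim(2) pq by (intro divide_right_mono mult_left_mono) auto
    then have b: "p + (q - p) * Suc i / Suc n \<le> q" by simp
    have c: "p + (q - p) * Suc i / Suc n = p + (q - p) * i / Suc n + (q - p) * (1 / Suc n)"
      by (simp only: of_nat_Suc[of i] distrib_left add_divide_distrib mult_1_right times_divide_eq_right add.assoc add.commute)
    have "\<bar>s - t\<bar> < d" using elim(1,3,4) unfolding c by auto
    then have "\<bar>g s - g t\<bar> < e" using elim(3,4) a b by (intro d) auto
    then show "\<bar>g s - g t\<bar> \<le> e" by simp
  qed
qed

context brownian
begin

text \<open>One grid serves two limits: its step functions approximate \<open>f\<close> in mean
  square, and its sums converge path by path. The random shift \<open>c\<close> does not affect
  increments; it is there to be set to the path value at a singular endpoint later.\<close>

lemma ae_wiener_C1: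
  fixes f f' :: "real \<Rightarrow> real"
  assumes pq: "p \<le> q"
    and der: "\<And>s. s \<in> {p..q} \<Longrightarrow> (f has_real_derivative f' s) (at s within {p..q})"
    and contf: "continuous_on {p..q} f'"
  shows "ae_wiener (\<lambda>s. indicator {p<..q} s * f s)
    (\<lambda>\<omega>. f q * (B q \<omega> - c \<omega>) - f p * (B p \<omega> - c \<omega>) - (LINT s:{p..q}|lborel. f' s * (B s \<omega> - c \<omega>)))"
proof -
  define u where "u n i = p + (q - p) * real i / Suc n" for n i :: nat
  have u0 [simp]: "u n 0 = p" and uN [simp]: "u n (Suc n) = q" for n by (simp_all add: u_def)
  have mono: "u n i \<le> u n (Suc i)" for n i using pq by (simp add: u_def divide_right_mono mult_left_mono)
  define \<phi> where "\<phi> n = map (\<lambda>i. (f (u n (Suc i)), u n i, u n (Suc i))) [0..<Suc n]" for n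
  have cf: "continuous_on {p..q} f" using der by (intro DERIV_continuous_on) auto
  have mf: "(\<lambda>s. indicator {p<..q} s * f s) \<in> borel_measurable borel"
  proof -
    have "(\<lambda>s. indicator {p..q} s *\<^sub>R f s) \<in> borel_measurable borel"
      using cf by (intro borel_measurable_continuous_on_indicator) auto
    then have "(\<lambda>s. indicator {p<..q} s * (indicator {p..q} s *\<^sub>R f s)) \<in> borel_measurable borel" by simp
    also have "(\<lambda>s. indicator {p<..q} s * (indicator {p..q} s *\<^sub>R f s)) = (\<lambda>s. indicator {p<..q} s * f s)"
      by (auto simp: fun_eq_iff split: split_indicator)
    finally show ?thesis .
  qed
  show ?thesis
  proof (rule ae_wiener_closed[of _ "\<lambda>n. step_fun (\<phi> n)" "\<lambda>n. step_integral B (\<phi> n)"])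
    show "(\<lambda>s. indicator {p<..q} s * f s) \<in> borel_measurable borel" by (rule mf)
    show "ae_wiener (step_fun (\<phi> n)) (step_integral B (\<phi> n))" for n
      unfolding ae_wiener_def
      by (intro exI[of _ "step_integral B (\<phi> n)"] conjI has_wiener_integral_step)
        (use mono in \<open>auto simp: step_list_def \<phi>_def simp del: upt_Suc\<close>)
    show "(\<lambda>n. \<integral>\<^sup>+ s. ennreal ((step_fun (\<phi> n) s - indicator {p<..q} s * f s)\<^sup>2) \<partial>lborel) \<longlonglongrightarrow> 0"
    proof (rule order_tendstoI)
      fix y :: ennreal assume y: "0 < y"
      \<comment> \<open>\<open>y\<close> may be infinite, so a positive real below it serves as the
        tolerance.\<close>
      obtain z :: real where z: "0 < z" "ennreal z < y"
      proof -
        obtain w where w: "0 < w" "w < y" using dense[OF y] by blast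
        have "w \<noteq> top" using w by auto
        then have "w = ennreal (enn2real w)" "0 < enn2real w" using w by (auto simp: enn2real_positive_iff less_top)
        with w show thesis by (intro that[of "enn2real w"]) auto
      qed
      \<comment> \<open>Chosen to make \<open>e\<^sup>2 * (q - p) \<le> z\<close>; the summand 1
        keeps the denominator positive when \<open>p = q\<close>.\<close>
      define e where "e = sqrt (z / (1 + (q - p)))"
      have e: "0 < e" using z pq by (simp add: e_def)
      have e2: "e\<^sup>2 * (q - p) \<le> z"
      proof -
        have "e\<^sup>2 * (q - p) \<le> e\<^sup>2 * (1 + (q - p))" by (intro mult_left_mono) auto
        also have "\<dots> = z" using z pq by (simp add: e_def)
        finally show ?thesis .
      qed
      show "\<forall>\<^sub>F n in sequentially. (\<integral>\<^sup>+ s. ennreal ((step_fun (\<phi> n) s - indicator {p<..q} s * f s)\<^sup>2) \<partial>lborel) < y"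
        using uniform_grid_close[OF cf pq e]
      proof eventually_elim
        case (elim n)
        have ap: "\<bar>step_fun (\<phi> n) s - indicator {p<..q} s * f s\<bar> \<le> e * indicator {p<..q} s" for s
          using step_fun_grid_approx[of "u n" "Suc n" f e s, OF mono] elim mono[of n] unfolding u0 uN \<phi>_def
          by (force simp: u_def)
        have "(\<integral>\<^sup>+ s. ennreal ((step_fun (\<phi> n) s - indicator {p<..q} s * f s)\<^sup>2) \<partial>lborel)
          \<le> (\<integral>\<^sup>+ s. ennreal (e\<^sup>2) * indicator {p<..q} s \<partial>lborel)"
        proof (rule nn_integral_mono)
          fix s
          have "(step_fun (\<phi> n) s - indicator {p<..q} s * f s)\<^sup>2 \<le> (e * indicator {p<..q} s)\<^sup>2"
            using power_mono[OF ap[of s], of 2] by simp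
          then have "ennreal ((step_fun (\<phi> n) s - indicator {p<..q} s * f s)\<^sup>2) \<le> ennreal ((e * indicator {p<..q} s)\<^sup>2)"
            by (rule ennreal_leI)
          also have "\<dots> = ennreal (e\<^sup>2) * indicator {p<..q} s" by (auto split: split_indicator)
          finally show "ennreal ((step_fun (\<phi> n) s - indicator {p<..q} s * f s)\<^sup>2) \<le> ennreal (e\<^sup>2) * indicator {p<..q} s" .
        qed
        also have "\<dots> = ennreal (e\<^sup>2 * (q - p))"
          using pq by (simp add: nn_integral_cmult_indicator ennreal_mult)
        also have "\<dots> \<le> ennreal z" using e2 by (rule ennreal_leI)
        finally show ?case using z by simp
      qed
    qed simp
    show "AE \<omega> in M. (\<lambda>n. step_integral B (\<phi> n) \<omega>) \<longlonglongrightarrow>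
        f q * (B q \<omega> - c \<omega>) - f p * (B p \<omega> - c \<omega>) - (LINT s:{p..q}|lborel. f' s * (B s \<omega> - c \<omega>))"
      using AE_continuous
    proof eventually_elim
      case (elim \<omega>)
      define b where "b s = B s \<omega> - c \<omega>" for s
      have cb: "continuous_on {p..q} b" unfolding b_def
        by (intro continuous_intros continuous_on_subset[OF elim]) simp
      have lint: "(LINT s:{p..q}|lborel. f' s * b s) = integral {p..q} (\<lambda>s. f' s * b s)"
        by (intro set_borel_integral_eq_integral borel_integrable_atLeastAtMost' continuous_intros contf cb)
      have "compact (f' ` {p..q})" using contf by (intro compact_continuous_image) auto
      then obtain K where K: "\<And>s. s \<in> {p..q} \<Longrightarrow> \<bar>f' s\<bar> \<le> K"
        by (metis bounded_iff compact_imp_bounded imageI real_norm_def)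
      have K0: "0 \<le> K" using K[of p] pq by auto
      have si: "step_integral B (\<phi> n) \<omega> = (\<Sum>i<Suc n. f (u n (Suc i)) * (b (u n (Suc i)) - b (u n i)))" for n
        by (simp add: step_integral_def \<phi>_def interv_sum_list_conv_sum_set_nat comp_def atLeast0LessThan b_def
             del: upt_Suc sum.lessThan_Suc)
      have "(\<lambda>n. step_integral B (\<phi> n) \<omega>) \<longlonglongrightarrow> f q * b q - f p * b p - integral {p..q} (\<lambda>s. f' s * b s)"
      proof (rule LIMSEQ_I)
        fix r :: real assume r: "0 < r"
        \<comment> \<open>Makes the bound \<open>K * e * (q - p)\<close> at most
          \<open>r / 2\<close>, with the summand 1 covering \<open>K = 0\<close> and
          \<open>p = q\<close>.\<close>
        define e where "e = r / (2 * (1 + K * (q - p)))"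
        have pos: "0 < 1 + K * (q - p)" using K0 pq by (intro add_pos_nonneg) auto
        have e: "0 < e" using r pos by (simp add: e_def)
        have er: "K * e * (q - p) < r"
        proof -
          have "K * e * (q - p) \<le> e * (1 + K * (q - p))" using e by (simp add: algebra_simps)
          also have "\<dots> = r / 2" using pos by (simp add: e_def field_simps)
          finally show ?thesis using r by simp
        qed
        have "\<forall>\<^sub>F n in sequentially. norm (step_integral B (\<phi> n) \<omega> - (f q * b q - f p * b p - integral {p..q} (\<lambda>s. f' s * b s))) < r"
          using uniform_grid_close[OF cb pq e]
        proof eventually_elim
          case (elim n)
          have "\<bar>(\<Sum>i<Suc n. f (u n (Suc i)) * (b (u n (Suc i)) - b (u n i)))
             - (f (u n (Suc n)) * b (u n (Suc n)) - f (u n 0) * b (u n 0) - integral {u n 0..u n (Suc n)} (\<lambda>s. f' s * b s))\<bar>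
             \<le> K * e * (u n (Suc n) - u n 0)"
          proof (rule stieltjes_grid_approx[where u="u n" and N="Suc n" and f=f and f'=f' and b=b and K=K and e=e])
            fix i s assume "i < Suc n" "s \<in> {u n i..u n (Suc i)}"
            then show "\<bar>b s - b (u n i)\<bar> \<le> e"
              using elim[rule_format, of i s "u n i"] mono[of n i] by (simp add: u_def)
          qed (use der contf cb K e mono in auto)
          then show ?case using er unfolding si u0 uN by simp
        qed
        then show "\<exists>N. \<forall>n\<ge>N. norm (step_integral B (\<phi> n) \<omega> - (f q * b q - f p * b p - integral {p..q} (\<lambda>s. f' s * b s))) < r"
          by (simp add: eventually_sequentially)
      qed
      then show ?case unfolding lint[symmetric] by (simp add: b_def)
    qed
  qed
qed

text \<open>Two dominated convergences along one exhaustion of \<open>A\<close>: the square of the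
  kernel dominates in the mean-square limit, and the absolute value of the full pathwise integrand
  dominates for each path. Exhaustion is asked for almost everywhere, since singular endpoints may
  belong to \<open>A\<close>.\<close>

lemma ae_wiener_improper:
  fixes f f' :: "real \<Rightarrow> real" and p q :: "nat \<Rightarrow> real"
  assumes A [measurable]: "A \<in> sets borel" and f [measurable]: "(\<lambda>s. indicator A s * f s) \<in> borel_measurable borel"
    and L2: "(\<integral>\<^sup>+ s. ennreal ((indicator A s * f s)\<^sup>2) \<partial>lborel) < \<infinity>"
    and pq: "\<And>n. p n \<le> q n" "\<And>n. {p n..q n} \<subseteq> A"
    and exhaust: "AE s in lborel. s \<in> A \<longrightarrow> (\<forall>\<^sub>F n in sequentially. s \<in> {p n<..q n})"
    and der: "\<And>n s. s \<in> {p n..q n} \<Longrightarrow> (f has_real_derivative f' s) (at s)"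
    and contf: "\<And>n. continuous_on {p n..q n} f'"
    and lim: "AE \<omega> in M. set_integrable lborel A (\<lambda>s. f' s * (B s \<omega> - c \<omega>)) \<and>
       (\<lambda>n. f (q n) * (B (q n) \<omega> - c \<omega>)) \<longlonglongrightarrow> u \<omega> \<and> (\<lambda>n. f (p n) * (B (p n) \<omega> - c \<omega>)) \<longlonglongrightarrow> v \<omega>"
  shows "ae_wiener (\<lambda>s. indicator A s * f s) (\<lambda>\<omega>. u \<omega> - v \<omega> - (LINT s:A|lborel. f' s * (B s \<omega> - c \<omega>)))"
proof (rule ae_wiener_closed)
  show "(\<lambda>s. indicator A s * f s) \<in> borel_measurable borel" by (rule f)
  show "ae_wiener (\<lambda>s. indicator {p n<..q n} s * f s)
      (\<lambda>\<omega>. f (q n) * (B (q n) \<omega> - c \<omega>) - f (p n) * (B (p n) \<omega> - c \<omega>) - (LINT s:{p n..q n}|lborel. f' s * (B s \<omega> - c \<omega>)))" for n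
    by (rule ae_wiener_C1[OF pq(1) _ contf]) (blast intro: DERIV_subset[OF der])
  have eq: "indicator {p n<..q n} s * f s = indicator {p n<..q n} s * (indicator A s * f s)" for n s
    using subsetD[OF pq(2)[of n], of s] by (auto split: split_indicator)
  have "(\<lambda>n. \<integral>\<^sup>+ s. ennreal ((indicator {p n<..q n} s * (indicator A s * f s) - indicator A s * f s)\<^sup>2) \<partial>lborel)
      \<longlonglongrightarrow> (\<integral>\<^sup>+ (s::real). 0 \<partial>lborel)"
  proof (rule nn_integral_dominated_convergence[where w="\<lambda>s. ennreal ((indicator A s * f s)\<^sup>2)"])
    show "AE s in lborel. ennreal ((indicator {p n<..q n} s * (indicator A s * f s) - indicator A s * f s)\<^sup>2)
        \<le> ennreal ((indicator A s * f s)\<^sup>2)" for n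
      by (auto split: split_indicator)
    show "AE s in lborel. (\<lambda>n. ennreal ((indicator {p n<..q n} s * (indicator A s * f s) - indicator A s * f s)\<^sup>2)) \<longlonglongrightarrow> 0"
      using exhaust
    proof eventually_elim
      case (elim s)
      show ?case
      proof (cases "s \<in> A")
        case True
        with elim have "\<forall>\<^sub>F n in sequentially. s \<in> {p n<..q n}" by blast
        then have "\<forall>\<^sub>F n in sequentially. ennreal ((indicator {p n<..q n} s * (indicator A s * f s) - indicator A s * f s)\<^sup>2) = 0"
          by eventually_elim simp
        then show ?thesis by (rule tendsto_eventually)
      qed simp
    qed
  qed (use L2 in auto)
  then show "(\<lambda>n. \<integral>\<^sup>+ s. ennreal ((indicator {p n<..q n} s * f s - indicator A s * f s)\<^sup>2) \<partial>lborel) \<longlonglongrightarrow> 0"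
    unfolding eq by simp
  show "AE \<omega> in M. (\<lambda>n. f (q n) * (B (q n) \<omega> - c \<omega>) - f (p n) * (B (p n) \<omega> - c \<omega>) - (LINT s:{p n..q n}|lborel. f' s * (B s \<omega> - c \<omega>)))
      \<longlonglongrightarrow> u \<omega> - v \<omega> - (LINT s:A|lborel. f' s * (B s \<omega> - c \<omega>))"
    using lim
  proof eventually_elim
    case (elim \<omega>)
    then have int: "set_integrable lborel A (\<lambda>s. f' s * (B s \<omega> - c \<omega>))" by blast
    define g where "g s = indicator A s *\<^sub>R (f' s * (B s \<omega> - c \<omega>))" for s
    have g [measurable]: "integrable lborel g" using int by (simp add: set_integrable_def g_def[abs_def])
    have [measurable]: "g \<in> borel_measurable borel" using borel_measurable_integrable[OF g] by simp
    have eqg: "indicator {p n..q n} s *\<^sub>R (f' s * (B s \<omega> - c \<omega>)) = indicator {p n..q n} s * g s" for n s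
      using subsetD[OF pq(2)[of n], of s] by (auto simp: g_def split: split_indicator)
    have "(\<lambda>n. LINT s|lborel. indicator {p n..q n} s * g s) \<longlonglongrightarrow> (LINT s|lborel. g s)"
    proof (rule integral_dominated_convergence[where w="\<lambda>s. \<bar>g s\<bar>"])
      show "AE s in lborel. (\<lambda>n. indicator {p n..q n} s * g s) \<longlonglongrightarrow> g s"
        using exhaust
      proof eventually_elim
        case (elim s)
        show ?case
        proof (cases "s \<in> A")
          case True
          with elim have "\<forall>\<^sub>F n in sequentially. s \<in> {p n<..q n}" by blast
          then have "\<forall>\<^sub>F n in sequentially. indicator {p n..q n} s * g s = g s"
            by eventually_elim simp
          then show ?thesis by (rule tendsto_eventually)
        qed (simp add: g_def)
      qed
      show "AE s in lborel. norm (indicator {p n..q n} s * g s) \<le> \<bar>g s\<bar>" for n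
        by (auto split: split_indicator)
    qed (use g in auto)
    then have "(\<lambda>n. LINT s:{p n..q n}|lborel. f' s * (B s \<omega> - c \<omega>)) \<longlonglongrightarrow> (LINT s:A|lborel. f' s * (B s \<omega> - c \<omega>))"
      unfolding set_lebesgue_integral_def eqg by (simp add: g_def)
    with elim show ?case by (intro tendsto_diff) auto
  qed
qed

end

section \<open>Joint continuity of the pathwise integrals\<close>

text \<open>As \<open>1 + v \<le> 2 * max 1 v\<close>, both arguments lie within
  \<open>R = 2 * T * max 1 v\<close> of 0, where the growth estimate applies. The factor
  \<open>max 1 v powr (2 * \<delta>)\<close> is 1 for small \<open>v\<close> and is the growth loss
  for large \<open>v\<close>.\<close>

lemma scaled_increment_bound:
  assumes hg: "hoelder_growth \<delta> b" and \<delta>: "0 < \<delta>" "\<delta> < 1/2"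
  obtains C where "0 \<le> C" "\<And>T t v x y. 1 \<le> T \<Longrightarrow> t \<in> {0..T} \<Longrightarrow> 0 < v \<Longrightarrow> \<bar>x\<bar> \<le> 1 + v \<Longrightarrow> \<bar>y\<bar> \<le> 1 + v \<Longrightarrow> \<bar>x - y\<bar> \<le> v \<Longrightarrow>
    \<bar>b (t * x) - b (t * y)\<bar> \<le> C * T powr (2 * \<delta>) * (max 1 v powr (2 * \<delta>) * (t powr (1/2 - \<delta>) * v powr (1/2 - \<delta>)))"
proof -
  obtain C where C: "0 \<le> C" and b: "\<And>T s t. 1 \<le> T \<Longrightarrow> s \<in> {-T..T} \<Longrightarrow> t \<in> {-T..T} \<Longrightarrow>
      \<bar>b s - b t\<bar> \<le> C * T powr (2 * \<delta>) * \<bar>s - t\<bar> powr (1/2 - \<delta>)"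
    using hg unfolding hoelder_growth_def by blast
  show thesis
  proof (rule that[of "C * 2 powr (2 * \<delta>)"])
    show "0 \<le> C * 2 powr (2 * \<delta>)" using C by simp
    fix T t v x y :: real
    assume T: "1 \<le> T" and t: "t \<in> {0..T}" and v: "0 < v" and xy: "\<bar>x\<bar> \<le> 1 + v" "\<bar>y\<bar> \<le> 1 + v" "\<bar>x - y\<bar> \<le> v"
    define R where "R = T * (2 * max 1 v)"
    have R: "1 \<le> R" using mult_mono[of 1 T 1 "2 * max 1 v"] T by (simp add: R_def)
    have in_R: "t * z \<in> {-R..R}" if "\<bar>z\<bar> \<le> 1 + v" for z
    proof -
      have "\<bar>t * z\<bar> = t * \<bar>z\<bar>" using t by (simp add: abs_mult)
      also have "\<dots> \<le> R" unfolding R_def using t T that by (intro mult_mono) auto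
      finally show ?thesis by auto
    qed
    have "\<bar>b (t * x) - b (t * y)\<bar> \<le> C * R powr (2 * \<delta>) * \<bar>t * x - t * y\<bar> powr (1/2 - \<delta>)"
      using xy by (intro b R in_R)
    also have "\<dots> \<le> C * R powr (2 * \<delta>) * (t * v) powr (1/2 - \<delta>)"
    proof -
      have "\<bar>t * x - t * y\<bar> = t * \<bar>x - y\<bar>" using t by (simp add: right_diff_distrib[symmetric] abs_mult)
      also have "\<dots> \<le> t * v" using t xy by (intro mult_left_mono) auto
      finally show ?thesis using C \<delta> by (intro mult_left_mono powr_mono2) auto
    qed
    also have "\<dots> = C * 2 powr (2 * \<delta>) * T powr (2 * \<delta>) * (max 1 v powr (2 * \<delta>) * (t powr (1/2 - \<delta>) * v powr (1/2 - \<delta>)))"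
      using t T v by (simp add: R_def powr_mult)
    finally show "\<bar>b (t * x) - b (t * y)\<bar> \<le> C * 2 powr (2 * \<delta>) * T powr (2 * \<delta>) * (max 1 v powr (2 * \<delta>) * (t powr (1/2 - \<delta>) * v powr (1/2 - \<delta>)))" .
  qed
qed

text \<open>The exponents \<open>1 / (k + 3)\<close> stay below 1/2 and tend to 0. Being countably
  many, they keep the exceptional set null, and neither \<open>H\<close> nor \<open>t\<close>
  enters.\<close>

definition good_path :: "(real \<Rightarrow> real) \<Rightarrow> bool" where
  "good_path b \<longleftrightarrow> continuous_on UNIV b \<and> b 0 = 0 \<and> (\<forall>k::nat. hoelder_growth (1 / (real k + 3)) b)"

lemma good_path_exponent:
  fixes h :: real
  assumes "good_path b" "0 < h"
  obtains \<delta> where "0 < \<delta>" "\<delta> < 1/2" "\<delta> < h" "hoelder_growth \<delta> b"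
proof -
  obtain k :: nat where k: "1 / h < real k" using reals_Archimedean2 by blast
  have "1 < h * (real k + 3)"
  proof -
    have "1 < h * real k" using k assms(2) by (simp add: field_simps)
    also have "\<dots> \<le> h * (real k + 3)" using assms(2) by (intro mult_left_mono) auto
    finally show ?thesis .
  qed
  then have "1 / (real k + 3) < h" using assms(2) by (simp add: field_simps)
  then show thesis
    using assms(1) by (intro that[of "1 / (real k + 3)"]) (simp_all add: good_path_def field_simps)
qed

text \<open>After the substitution \<open>s = t * v\<close> (up to shift and reflection) all pathwise integrals have the
  form \<open>scaled_integral\<close>, with \<open>t powr (H - 1/2)\<close> pulled inside to absorb the singularity at \<open>t = 0\<close>.
  There \<open>0 powr a = 0\<close> yields the value \<open>0\<close>.\<close>

definition singular_kernel :: "(real \<Rightarrow> real \<Rightarrow> real) \<Rightarrow> bool" where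
  "singular_kernel \<kappa> \<longleftrightarrow>
     (\<forall>H. \<kappa> H \<in> borel_measurable borel) \<and>
     (\<forall>v>0. continuous_on {0<..<1} (\<lambda>H. \<kappa> H v)) \<and>
     (\<forall>H\<in>{0<..<1}. \<forall>v>0. \<bar>\<kappa> H v\<bar> \<le> (if v \<le> 1 then v powr (H - 3/2) else 2 * v powr (H - 5/2)))"

definition scaled_integrand :: "(real \<Rightarrow> real \<Rightarrow> real) \<Rightarrow> (real \<Rightarrow> real) \<Rightarrow> (real \<Rightarrow> real) \<Rightarrow> (real \<Rightarrow> real) \<Rightarrow> real \<Rightarrow> real \<Rightarrow> real \<Rightarrow> real" where
  "scaled_integrand \<kappa> p q b H t v = \<kappa> H v * (t powr (H - 1/2) * (b (t * p v) - b (t * q v)))"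

definition scaled_integral :: "(real \<Rightarrow> real \<Rightarrow> real) \<Rightarrow> (real \<Rightarrow> real) \<Rightarrow> (real \<Rightarrow> real) \<Rightarrow> (real \<Rightarrow> real) \<Rightarrow> real \<Rightarrow> real \<Rightarrow> real" where
  "scaled_integral \<kappa> p q b H t = (LINT v:{0<..}|lborel. scaled_integrand \<kappa> p q b H t v)"

text \<open>The two-regime shape of the bound in \<open>singular_kernel\<close>, kept after the
  increment has contributed \<open>v powr (1/2 - \<delta>)\<close> near 0 and
  \<open>v powr (1/2 + \<delta>)\<close> at infinity.\<close>

definition majorant :: "real \<Rightarrow> real \<Rightarrow> real \<Rightarrow> real" where
  "majorant \<alpha> \<beta> v = (if v \<le> 1 then v powr \<alpha> else 2 * v powr \<beta>)"

lemma borel_measurable_majorant [measurable]: "majorant \<alpha> \<beta> \<in> borel_measurable borel"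
  unfolding majorant_def by measurable

lemma set_integrable_powr_Ioc:
  fixes \<alpha> :: real
  assumes "-1 < \<alpha>"
  shows "set_integrable lborel {0<..1} (\<lambda>v. v powr \<alpha>)"
proof -
  have "(\<lambda>x. x powr \<alpha>) integrable_on {0..1}" using assms by (intro integrable_on_powr_from_0) auto
  then have "(\<lambda>x. x powr \<alpha>) absolutely_integrable_on {0..1}" by (intro nonnegative_absolutely_integrable_1) auto
  then have "set_integrable lborel {0..1} (\<lambda>x. x powr \<alpha>)"
    by (simp add: set_integrable_def integrable_completion)
  then show ?thesis by (rule set_integrable_subset) auto
qed

lemma set_integrable_powr_Ioi:
  fixes \<beta> :: real
  assumes "\<beta> < -1"
  shows "set_integrable lborel {1<..} (\<lambda>v. v powr \<beta>)"
proof -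
  have "((\<lambda>x. x powr \<beta>) has_integral -(1 powr (\<beta> + 1)) / (\<beta> + 1)) {1..}"
    using assms by (intro has_integral_powr_to_inf) auto
  then have "(\<lambda>x. x powr \<beta>) absolutely_integrable_on {1..}"
    by (intro nonnegative_absolutely_integrable_1) (auto simp: integrable_on_def)
  then have "set_integrable lborel {1..} (\<lambda>x. x powr \<beta>)"
    by (simp add: set_integrable_def integrable_completion)
  then show ?thesis by (rule set_integrable_subset) auto
qed

lemma set_integrable_majorant:
  assumes "-1 < \<alpha>" "\<beta> < -1"
  shows "set_integrable lborel {0<..} (majorant \<alpha> \<beta>)"
proof -
  have "set_integrable lborel ({0<..1} \<union> {1<..}) (majorant \<alpha> \<beta>)"
  proof (rule set_integrable_Un)
    show "set_integrable lborel {0<..1} (majorant \<alpha> \<beta>)"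
      using set_integrable_powr_Ioc[OF assms(1)] by (rule set_integrable_cong[THEN iffD1, rotated -1]) (auto simp: majorant_def)
    show "set_integrable lborel {1<..} (majorant \<alpha> \<beta>)"
      using set_integrable_mult_right[OF set_integrable_powr_Ioi[OF assms(2)], of 2]
      by (rule set_integrable_cong[THEN iffD1, rotated -1]) (auto simp: majorant_def)
  qed auto
  moreover have "{0<..1} \<union> {1<..} = {0::real<..}" by auto
  ultimately show ?thesis by simp
qed

text \<open>The arguments \<open>p v\<close>, \<open>q v\<close> of an increment at distance \<open>v\<close> of the rescaled path.\<close>

definition increment_at :: "(real \<Rightarrow> real) \<Rightarrow> (real \<Rightarrow> real) \<Rightarrow> bool" where
  "increment_at p q \<longleftrightarrow> p \<in> borel_measurable borel \<and> q \<in> borel_measurable borel \<and>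
     (\<forall>v>0. \<bar>p v\<bar> \<le> 1 + v \<and> \<bar>q v\<bar> \<le> 1 + v \<and> \<bar>p v - q v\<bar> \<le> v)"

lemma borel_measurable_scaled_integrand:
  assumes "singular_kernel \<kappa>" "increment_at p q" "good_path b"
  shows "scaled_integrand \<kappa> p q b H t \<in> borel_measurable borel"
proof -
  have [measurable]: "\<kappa> H \<in> borel_measurable borel" "p \<in> borel_measurable borel" "q \<in> borel_measurable borel"
    "b \<in> borel_measurable borel"
    using assms by (auto simp: singular_kernel_def increment_at_def good_path_def intro: borel_measurable_continuous_onI)
  show ?thesis unfolding scaled_integrand_def by measurable
qed

text \<open>The powers add up to \<open>H - \<delta>\<close> in \<open>t\<close>, to
  \<open>H - 1 - \<delta>\<close> for small \<open>v\<close> and to \<open>H - 2 + \<delta>\<close>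
  for large \<open>v\<close>. On \<open>{h1..h2}\<close> the worst exponents are those at
  \<open>h1\<close> for small \<open>v\<close> and at \<open>h2\<close> for large
  \<open>v\<close>.\<close>

lemma scaled_integrand_bound:
  assumes \<kappa>: "singular_kernel \<kappa>" and pq: "increment_at p q" and hg: "hoelder_growth \<delta> b" and \<delta>: "0 < \<delta>" "\<delta> < 1/2" and T: "1 \<le> T"
  obtains C where "0 \<le> C"
    "\<And>H t v h1 h2. 0 < h1 \<Longrightarrow> h2 < 1 \<Longrightarrow> H \<in> {h1..h2} \<Longrightarrow> t \<in> {0..T} \<Longrightarrow> 0 < v \<Longrightarrow>
      \<bar>scaled_integrand \<kappa> p q b H t v\<bar> \<le> C * t powr (H - \<delta>) * majorant (h1 - 1 - \<delta>) (h2 - 2 + \<delta>) v"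
proof -
  obtain C where C: "0 \<le> C" and b: "\<And>T t v x y. 1 \<le> T \<Longrightarrow> t \<in> {0..T} \<Longrightarrow> 0 < v \<Longrightarrow> \<bar>x\<bar> \<le> 1 + v \<Longrightarrow> \<bar>y\<bar> \<le> 1 + v \<Longrightarrow> \<bar>x - y\<bar> \<le> v \<Longrightarrow>
    \<bar>b (t * x) - b (t * y)\<bar> \<le> C * T powr (2 * \<delta>) * (max 1 v powr (2 * \<delta>) * (t powr (1/2 - \<delta>) * v powr (1/2 - \<delta>)))"
    using scaled_increment_bound[OF hg \<delta>] by blast
  show thesis
  proof (rule that[of "C * T powr (2 * \<delta>)"])
    show "0 \<le> C * T powr (2 * \<delta>)" using C by simp
    fix H t v h1 h2 :: real
    assume h: "0 < h1" "h2 < 1" and H: "H \<in> {h1..h2}" and t: "t \<in> {0..T}" and v: "0 < v"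
    have k: "\<bar>\<kappa> H v\<bar> \<le> (if v \<le> 1 then v powr (H - 3/2) else 2 * v powr (H - 5/2))"
      using \<kappa> h H v by (auto simp: singular_kernel_def)
    have inc: "\<bar>b (t * p v) - b (t * q v)\<bar> \<le> C * T powr (2 * \<delta>) * (max 1 v powr (2 * \<delta>) * (t powr (1/2 - \<delta>) * v powr (1/2 - \<delta>)))"
      using pq v by (intro b T t) (auto simp: increment_at_def)
    have "\<bar>scaled_integrand \<kappa> p q b H t v\<bar> = \<bar>\<kappa> H v\<bar> * (t powr (H - 1/2) * \<bar>b (t * p v) - b (t * q v)\<bar>)"
      by (simp add: scaled_integrand_def abs_mult)
    also have "\<dots> \<le> (if v \<le> 1 then v powr (H - 3/2) else 2 * v powr (H - 5/2)) *
       (t powr (H - 1/2) * (C * T powr (2 * \<delta>) * (max 1 v powr (2 * \<delta>) * (t powr (1/2 - \<delta>) * v powr (1/2 - \<delta>)))))"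
      using k inc by (intro mult_mono) auto
    also have "\<dots> = C * T powr (2 * \<delta>) * (t powr (H - 1/2) * t powr (1/2 - \<delta>)) *
       ((if v \<le> 1 then v powr (H - 3/2) else 2 * v powr (H - 5/2)) * (max 1 v powr (2 * \<delta>) * v powr (1/2 - \<delta>)))"
      by (simp only: mult_ac)
    also have "t powr (H - 1/2) * t powr (1/2 - \<delta>) = t powr (H - \<delta>)"
      by (simp add: powr_add[symmetric])
    also have "(if v \<le> 1 then v powr (H - 3/2) else 2 * v powr (H - 5/2)) * (max 1 v powr (2 * \<delta>) * v powr (1/2 - \<delta>))
      \<le> majorant (h1 - 1 - \<delta>) (h2 - 2 + \<delta>) v"
    proof (cases "v \<le> 1")
      case True
      then have "(if v \<le> 1 then v powr (H - 3/2) else 2 * v powr (H - 5/2)) * (max 1 v powr (2 * \<delta>) * v powr (1/2 - \<delta>))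
         = v powr (H - 1 - \<delta>)" by (simp add: max_def powr_add[symmetric] algebra_simps)
      also have "\<dots> \<le> v powr (h1 - 1 - \<delta>)" using True v H by (intro powr_mono') auto
      finally show ?thesis using True by (simp add: majorant_def)
    next
      case False
      then have "(if v \<le> 1 then v powr (H - 3/2) else 2 * v powr (H - 5/2)) * (max 1 v powr (2 * \<delta>) * v powr (1/2 - \<delta>))
         = 2 * v powr (H - 2 + \<delta>)" by (simp add: max_def powr_add[symmetric] algebra_simps)
      also have "\<dots> \<le> 2 * v powr (h2 - 2 + \<delta>)" using False v H by (intro mult_left_mono powr_mono) auto
      finally show ?thesis using False by (simp add: majorant_def)
    qed
    finally show "\<bar>scaled_integrand \<kappa> p q b H t v\<bar> \<le> C * T powr (2 * \<delta>) * t powr (H - \<delta>) * majorant (h1 - 1 - \<delta>) (h2 - 2 + \<delta>) v"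
      using C by (simp add: mult_left_mono)
  qed
qed

text \<open>Only \<open>t0 = 0\<close> is delicate, since the power may blow up there. The increment
  is of order \<open>t powr (1/2 - \<delta>)\<close>, which leaves
  \<open>t powr (H - \<delta>)\<close> with an exponent that stays positive because
  \<open>\<delta> < h1\<close>.\<close>

lemma tendsto_powr_mult_increment:
  assumes gp: "good_path b" and h: "0 < h1" "h2 < 1"
    and Hn: "\<And>n::nat. H n \<in> {h1..h2}" "H \<longlonglongrightarrow> H0" and tn: "\<And>n. 0 \<le> t n" "t \<longlonglongrightarrow> t0"
    and xy: "0 < v" "\<bar>x\<bar> \<le> 1 + v" "\<bar>y\<bar> \<le> 1 + v" "\<bar>x - y\<bar> \<le> v"
  shows "(\<lambda>n. t n powr (H n - 1/2) * (b (t n * x) - b (t n * y))) \<longlonglongrightarrow> t0 powr (H0 - 1/2) * (b (t0 * x) - b (t0 * y))"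
proof (cases "t0 = 0")
  case False
  have "continuous_on UNIV b" using gp by (simp add: good_path_def)
  then have b: "isCont b z" for z by (simp add: continuous_on_eq_continuous_at)
  show ?thesis
    by (intro tendsto_mult tendsto_diff tendsto_const tendsto_powr isCont_tendsto_compose[OF b] Hn tn False)
next
  case True
  have H0: "h1 \<le> H0" using LIMSEQ_le_const[OF Hn(2)] Hn(1) by auto
  obtain \<delta> where \<delta>: "0 < \<delta>" "\<delta> < 1/2" "\<delta> < h1" "hoelder_growth \<delta> b"
    using good_path_exponent[OF gp h(1)] by blast
  obtain C where C: "0 \<le> C" and b: "\<And>T t v x y. 1 \<le> T \<Longrightarrow> t \<in> {0..T} \<Longrightarrow> 0 < v \<Longrightarrow> \<bar>x\<bar> \<le> 1 + v \<Longrightarrow> \<bar>y\<bar> \<le> 1 + v \<Longrightarrow> \<bar>x - y\<bar> \<le> v \<Longrightarrow>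
    \<bar>b (t * x) - b (t * y)\<bar> \<le> C * T powr (2 * \<delta>) * (max 1 v powr (2 * \<delta>) * (t powr (1/2 - \<delta>) * v powr (1/2 - \<delta>)))"
    using scaled_increment_bound[OF \<delta>(4,1,2)] by blast
  define K where "K = C * (max 1 v powr (2 * \<delta>) * v powr (1/2 - \<delta>))"
  have "(\<lambda>n. t n powr (H n - 1/2) * (b (t n * x) - b (t n * y))) \<longlonglongrightarrow> 0"
  proof (rule Lim_null_comparison)
    have "\<forall>\<^sub>F n in sequentially. t n < 1" using tn(2) True by (intro order_tendstoD) auto
    then show "\<forall>\<^sub>F n in sequentially. norm (t n powr (H n - 1/2) * (b (t n * x) - b (t n * y))) \<le> K * t n powr (H n - \<delta>)"
    proof eventually_elim
      case (elim n)
      have "norm (t n powr (H n - 1/2) * (b (t n * x) - b (t n * y))) = t n powr (H n - 1/2) * \<bar>b (t n * x) - b (t n * y)\<bar>"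
        by (simp add: abs_mult)
      also have "\<dots> \<le> t n powr (H n - 1/2) * (C * 1 powr (2 * \<delta>) * (max 1 v powr (2 * \<delta>) * (t n powr (1/2 - \<delta>) * v powr (1/2 - \<delta>))))"
        using elim tn(1)[of n] xy by (intro mult_left_mono b) auto
      also have "\<dots> = K * (t n powr (H n - 1/2) * t n powr (1/2 - \<delta>))" by (simp add: K_def mult_ac)
      also have "t n powr (H n - 1/2) * t n powr (1/2 - \<delta>) = t n powr (H n - \<delta>)" by (simp add: powr_add[symmetric])
      finally show ?case .
    qed
    have "(\<lambda>n. K * t n powr (H n - \<delta>)) \<longlonglongrightarrow> K * 0 powr (H0 - \<delta>)"
      using H0 \<delta> tn True by (intro tendsto_mult tendsto_const tendsto_powr' tendsto_diff Hn) auto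
    then show "(\<lambda>n. K * t n powr (H n - \<delta>)) \<longlonglongrightarrow> 0" by simp
  qed
  then show ?thesis using True by simp
qed

lemma set_integrable_scaled_integrand:
  assumes \<kappa>: "singular_kernel \<kappa>" and pq: "increment_at p q" and gp: "good_path b" and H: "H \<in> {0<..<1}" and t: "0 \<le> t"
  shows "set_integrable lborel {0<..} (scaled_integrand \<kappa> p q b H t)"
proof -
  note [measurable] = borel_measurable_scaled_integrand[OF \<kappa> pq gp]
  obtain \<delta> where \<delta>: "0 < \<delta>" "\<delta> < 1/2" "\<delta> < min H (1 - H)" "hoelder_growth \<delta> b"
    using good_path_exponent[OF gp, of "min H (1 - H)"] H by auto
  obtain C where C: "0 \<le> C"
    "\<And>H t' v h1 h2. 0 < h1 \<Longrightarrow> h2 < 1 \<Longrightarrow> H \<in> {h1..h2} \<Longrightarrow> t' \<in> {0..max 1 t} \<Longrightarrow> 0 < v \<Longrightarrow>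
      \<bar>scaled_integrand \<kappa> p q b H t' v\<bar> \<le> C * t' powr (H - \<delta>) * majorant (h1 - 1 - \<delta>) (h2 - 2 + \<delta>) v"
    using scaled_integrand_bound[OF \<kappa> pq \<delta>(4,1,2), of "max 1 t"] by auto
  have "set_integrable lborel {0<..} (\<lambda>v. C * t powr (H - \<delta>) * majorant (H - 1 - \<delta>) (H - 2 + \<delta>) v)"
    using \<delta> by (intro set_integrable_mult_right set_integrable_majorant) auto
  then show ?thesis
  proof (rule set_integrable_bound)
    show "AE v in lborel. v \<in> {0<..} \<longrightarrow> norm (scaled_integrand \<kappa> p q b H t v)
        \<le> norm (C * t powr (H - \<delta>) * majorant (H - 1 - \<delta>) (H - 2 + \<delta>) v)"
    proof (intro AE_I2 impI)
      fix v :: real assume "v \<in> {0<..}"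
      \<comment> \<open>The uniform bound is used on the degenerate interval
        \<open>h1 = h2 = H\<close>.\<close>
      then have "norm (scaled_integrand \<kappa> p q b H t v) \<le> C * t powr (H - \<delta>) * majorant (H - 1 - \<delta>) (H - 2 + \<delta>) v"
        using C(2)[of H H H t v] H t by auto
      then show "norm (scaled_integrand \<kappa> p q b H t v) \<le> norm (C * t powr (H - \<delta>) * majorant (H - 1 - \<delta>) (H - 2 + \<delta>) v)"
        by simp
    qed
  qed (simp add: set_borel_measurable_def)
qed

lemma continuous_on_scaled_integral_box:
  assumes \<kappa>: "singular_kernel \<kappa>" and pq: "increment_at p q" and gp: "good_path b" and h: "0 < h1" "h2 < 1" and T: "1 \<le> T"
  shows "continuous_on ({h1..h2} \<times> {0..T}) (\<lambda>(H, t). scaled_integral \<kappa> p q b H t)"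
  unfolding continuous_on_sequentially
proof (intro allI ballI impI)
  note [measurable] = borel_measurable_scaled_integrand[OF \<kappa> pq gp]
  fix x a assume a: "a \<in> {h1..h2} \<times> {0..T}" and x: "(\<forall>n. x n \<in> {h1..h2} \<times> {0..T}) \<and> x \<longlonglongrightarrow> a"
  define H t where "H n = fst (x n)" and "t n = snd (x n)" for n
  have lim: "H \<longlonglongrightarrow> fst a" "t \<longlonglongrightarrow> snd a"
    using x unfolding H_def t_def by (auto intro: tendsto_fst tendsto_snd)
  have rng: "H n \<in> {h1..h2}" "t n \<in> {0..T}" for n
    using x unfolding H_def t_def by (auto simp: mem_Times_iff)
  \<comment> \<open>\<delta> below \<open>h1\<close> makes the majorant integrable at 0, \<delta>
    below \<open>1 - h2\<close> at infinity; one choice works for the whole box.\<close>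
  have m: "0 < min h1 (1 - h2)" using h by simp
  obtain \<delta> where \<delta>: "0 < \<delta>" "\<delta> < 1/2" "\<delta> < min h1 (1 - h2)" "hoelder_growth \<delta> b"
    using good_path_exponent[OF gp m] by blast
  obtain C where C: "0 \<le> C"
    "\<And>H t v h1 h2. 0 < h1 \<Longrightarrow> h2 < 1 \<Longrightarrow> H \<in> {h1..h2} \<Longrightarrow> t \<in> {0..T} \<Longrightarrow> 0 < v \<Longrightarrow>
      \<bar>scaled_integrand \<kappa> p q b H t v\<bar> \<le> C * t powr (H - \<delta>) * majorant (h1 - 1 - \<delta>) (h2 - 2 + \<delta>) v"
    using scaled_integrand_bound[OF \<kappa> pq \<delta>(4,1,2) T] by blast
  have maj0: "0 \<le> majorant \<alpha> \<beta> v" for \<alpha> \<beta> v by (simp add: majorant_def)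
  have "(\<lambda>n. LINT v|lborel. indicator {0<..} v *\<^sub>R scaled_integrand \<kappa> p q b (H n) (t n) v)
    \<longlonglongrightarrow> (LINT v|lborel. indicator {0<..} v *\<^sub>R scaled_integrand \<kappa> p q b (fst a) (snd a) v)"
  proof (rule integral_dominated_convergence[where w="\<lambda>v. indicator {0<..} v *\<^sub>R (C * T * majorant (h1 - 1 - \<delta>) (h2 - 2 + \<delta>) v)"])
    show "integrable lborel (\<lambda>v. indicator {0<..} v *\<^sub>R (C * T * majorant (h1 - 1 - \<delta>) (h2 - 2 + \<delta>) v))"
      unfolding set_integrable_def[symmetric] using \<delta> by (intro set_integrable_mult_right set_integrable_majorant) auto
    show "AE v in lborel. (\<lambda>n. indicator {0<..} v *\<^sub>R scaled_integrand \<kappa> p q b (H n) (t n) v)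
      \<longlonglongrightarrow> indicator {0<..} v *\<^sub>R scaled_integrand \<kappa> p q b (fst a) (snd a) v"
    proof (intro AE_I2)
      fix v :: real
      show "(\<lambda>n. indicator {0<..} v *\<^sub>R scaled_integrand \<kappa> p q b (H n) (t n) v)
        \<longlonglongrightarrow> indicator {0<..} v *\<^sub>R scaled_integrand \<kappa> p q b (fst a) (snd a) v"
      proof (cases "0 < v")
        case True
        have "continuous_on {0<..<1} (\<lambda>H. \<kappa> H v)" using \<kappa> True by (simp add: singular_kernel_def)
        moreover have "H n \<in> {0<..<1}" "fst a \<in> {0<..<1}" for n using rng(1)[of n] a h by auto
        ultimately have "(\<lambda>n. \<kappa> (H n) v) \<longlonglongrightarrow> \<kappa> (fst a) v"
          using lim(1) by (auto simp: continuous_on_sequentially comp_def)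
        then show ?thesis unfolding scaled_integrand_def
          using True pq rng lim
          by (intro tendsto_scaleR tendsto_const tendsto_mult tendsto_powr_mult_increment[OF gp h, where v=v])
            (auto simp: increment_at_def)
      qed simp
    qed
    show "AE v in lborel. norm (indicator {0<..} v *\<^sub>R scaled_integrand \<kappa> p q b (H n) (t n) v)
        \<le> indicator {0<..} v *\<^sub>R (C * T * majorant (h1 - 1 - \<delta>) (h2 - 2 + \<delta>) v)" for n
    proof (intro AE_I2)
      fix v :: real
      \<comment> \<open>With the exponent in the unit interval and \<open>1 \<le> T\<close>, the
        power of \<open>t n\<close> is at most \<open>T\<close>, which frees the dominating function
        from \<open>n\<close>.\<close>
      have Hn: "0 \<le> H n - \<delta>" "H n - \<delta> \<le> 1" using rng(1)[of n] \<delta> h by auto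
      have "t n powr (H n - \<delta>) \<le> T powr (H n - \<delta>)" using rng(2)[of n] Hn by (intro powr_mono2) auto
      also have "\<dots> \<le> T powr 1" using T Hn by (intro powr_mono) auto
      finally have tT: "t n powr (H n - \<delta>) \<le> T" using T by simp
      have "\<bar>scaled_integrand \<kappa> p q b (H n) (t n) v\<bar> \<le> C * T * majorant (h1 - 1 - \<delta>) (h2 - 2 + \<delta>) v" if "0 < v"
      proof -
        have "\<bar>scaled_integrand \<kappa> p q b (H n) (t n) v\<bar> \<le> C * t n powr (H n - \<delta>) * majorant (h1 - 1 - \<delta>) (h2 - 2 + \<delta>) v"
          by (rule C(2)[OF h rng that])
        also have "\<dots> \<le> C * T * majorant (h1 - 1 - \<delta>) (h2 - 2 + \<delta>) v"
          using C(1) tT maj0 by (intro mult_right_mono mult_left_mono) auto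
        finally show ?thesis .
      qed
      then show "norm (indicator {0<..} v *\<^sub>R scaled_integrand \<kappa> p q b (H n) (t n) v)
        \<le> indicator {0<..} v *\<^sub>R (C * T * majorant (h1 - 1 - \<delta>) (h2 - 2 + \<delta>) v)"
        by (simp split: split_indicator)
    qed
  qed simp_all
  then show "((\<lambda>(H, t). scaled_integral \<kappa> p q b H t) \<circ> x) \<longlonglongrightarrow> (\<lambda>(H, t). scaled_integral \<kappa> p q b H t) a"
    by (simp add: scaled_integral_def set_lebesgue_integral_def H_def t_def comp_def case_prod_unfold)
qed

lemma continuous_on_from_boxes:
  fixes F :: "real \<times> real \<Rightarrow> real"
  assumes "\<And>h1 h2 T. 0 < h1 \<Longrightarrow> h2 < 1 \<Longrightarrow> 1 \<le> T \<Longrightarrow> continuous_on ({h1..h2} \<times> {0..T}) F"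
  shows "continuous_on ({0<..<1} \<times> {0..}) F"
  unfolding continuous_on_eq_continuous_within
proof
  fix a :: "real \<times> real" assume a: "a \<in> {0<..<1} \<times> {0..}"
  define h1 h2 T where "h1 = fst a / 2" and "h2 = (1 + fst a) / 2" and "T = snd a + 1"
  \<comment> \<open>The lower bound -1 lets the open set \<open>U\<close> contain points with
    \<open>t = 0\<close>, so continuity up to that edge is included.\<close>
  define U where "U = {h1<..<h2} \<times> {-1<..<T}"
  have U: "open U" "a \<in> U" using a by (auto simp: U_def h1_def h2_def T_def open_Times mem_Times_iff)
  have "continuous_on ({h1..h2} \<times> {0..T}) F"
    using a by (intro assms) (auto simp: h1_def h2_def T_def mem_Times_iff)
  moreover have "({0<..<1} \<times> {0..}) \<inter> U \<subseteq> {h1..h2} \<times> {0..T}" by (auto simp: U_def)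
  ultimately have "continuous_on (({0<..<1} \<times> {0..}) \<inter> U) F" by (rule continuous_on_subset)
  then have "continuous (at a within (({0<..<1} \<times> {0..}) \<inter> U)) F"
    using a U by (simp add: continuous_on_eq_continuous_within)
  moreover have "at a within (({0<..<1} \<times> {0..}) \<inter> U) = at a within {0<..<1} \<times> {0..}"
    by (rule at_within_nhd[OF U(2,1)]) auto
  ultimately show "continuous (at a within {0<..<1} \<times> {0..}) F" by simp
qed

lemma continuous_on_scaled_integral:
  assumes "singular_kernel \<kappa>" "increment_at p q" "good_path b"
  shows "continuous_on ({0<..<1} \<times> {0..}) (\<lambda>(H, t). scaled_integral \<kappa> p q b H t)"
  by (rule continuous_on_from_boxes) (rule continuous_on_scaled_integral_box[OF assms])

lemma continuous_on_powr_mult_path: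
  assumes gp: "good_path b"
  shows "continuous_on ({0<..<1} \<times> {0..}) (\<lambda>(H, t). t powr (H - 1/2) * b t)"
proof (rule continuous_on_from_boxes, unfold continuous_on_sequentially, intro allI ballI impI)
  fix h1 h2 T :: real and x a
  assume h: "0 < h1" "h2 < 1" and a: "a \<in> {h1..h2} \<times> {0..T}" and x: "(\<forall>n. x n \<in> {h1..h2} \<times> {0..T}) \<and> x \<longlonglongrightarrow> a"
  have b0: "b 0 = 0" using gp by (simp add: good_path_def)
  \<comment> \<open>Since \<open>b 0 = 0\<close>, the value \<open>b t\<close> is the increment
    between the rescaled points 1 and 0.\<close>
  have "(\<lambda>n. snd (x n) powr (fst (x n) - 1/2) * (b (snd (x n) * 1) - b (snd (x n) * 0)))
     \<longlonglongrightarrow> snd a powr (fst a - 1/2) * (b (snd a * 1) - b (snd a * 0))"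
    using x by (intro tendsto_powr_mult_increment[OF gp h, where v=1]) (auto simp: mem_Times_iff intro: tendsto_fst tendsto_snd)
  then show "((\<lambda>(H, t). t powr (H - 1/2) * b t) \<circ> x) \<longlonglongrightarrow> (\<lambda>(H, t). t powr (H - 1/2) * b t) a"
    by (simp add: comp_def case_prod_unfold b0)
qed

section \<open>The two kernels, and the substitutions reducing the pathwise integrals to
  them\<close>

definition near_kernel :: "real \<Rightarrow> real \<Rightarrow> real" where
  "near_kernel H v = indicator {0..1} v * v powr (H - 3/2)"

text \<open>As in \<open>near_kernel\<close>, \<open>v\<close> is the distance from the singular
  endpoint in units of \<open>t\<close>. The sign makes the kernel nonnegative for
  \<open>v > 0\<close>, opposite to the integrands it represents; hence the minus signs in
  \<open>integral_plus_far\<close> and \<open>integral_minus_far\<close>.\<close>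

definition far_kernel :: "real \<Rightarrow> real \<Rightarrow> real" where
  "far_kernel H v = v powr (H - 3/2) - (1 + v) powr (H - 3/2)"

text \<open>Mean value inequality; because \<open>a < 1\<close>, the derivative is largest in
  absolute value at the left end \<open>x\<close>. The full power gained for large \<open>x\<close>
  is what makes the integrals and boundary terms at infinity tractable.\<close>

lemma powr_diff_shift_bound:
  fixes a t x :: real
  assumes "a < 1" "0 \<le> t" "0 < x"
  shows "\<bar>(t + x) powr a - x powr a\<bar> \<le> \<bar>a\<bar> * x powr (a - 1) * t"
proof -
  have "norm ((t + x) powr a - x powr a) \<le> (\<bar>a\<bar> * x powr (a - 1)) * norm ((t + x) - x)"
  proof (rule field_differentiable_bound[of "{x..t + x}" "\<lambda>y. y powr a" "\<lambda>y. a * y powr (a - 1)"])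
    fix y assume y: "y \<in> {x..t + x}"
    show "((\<lambda>y. y powr a) has_field_derivative a * y powr (a - 1)) (at y within {x..t + x})"
      using y assms by (intro has_field_derivative_at_within[OF has_real_derivative_powr]) auto
    have "y powr (a - 1) \<le> x powr (a - 1)" using y assms by (intro powr_mono2') auto
    then show "norm (a * y powr (a - 1)) \<le> \<bar>a\<bar> * x powr (a - 1)"
      by (simp add: abs_mult mult_left_mono)
  qed (use assms in auto)
  then show ?thesis using assms by simp
qed

lemma singular_near_kernel: "singular_kernel near_kernel"
  unfolding singular_kernel_def
proof (intro conjI allI ballI impI)
  show "near_kernel H \<in> borel_measurable borel" for H unfolding near_kernel_def by measurable
  show "continuous_on {0<..<1} (\<lambda>H. near_kernel H v)" if "0 < v" for v
    unfolding near_kernel_def using that by (intro continuous_intros) auto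
  show "\<bar>near_kernel H v\<bar> \<le> (if v \<le> 1 then v powr (H - 3/2) else 2 * v powr (H - 5/2))" for H v
    by (simp add: near_kernel_def indicator_def)
qed

lemma singular_far_kernel: "singular_kernel far_kernel"
  unfolding singular_kernel_def
proof (intro conjI allI ballI impI)
  show "far_kernel H \<in> borel_measurable borel" for H unfolding far_kernel_def by measurable
  show "continuous_on {0<..<1} (\<lambda>H. far_kernel H v)" if "0 < v" for v
    unfolding far_kernel_def using that by (intro continuous_intros) auto
  fix H v :: real assume H: "H \<in> {0<..<1}" and v: "0 < v"
  show "\<bar>far_kernel H v\<bar> \<le> (if v \<le> 1 then v powr (H - 3/2) else 2 * v powr (H - 5/2))"
  proof (cases "v \<le> 1")
    case True
    have "(1 + v) powr (H - 3/2) \<le> v powr (H - 3/2)" using H v by (intro powr_mono2') auto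
    then show ?thesis using True by (simp add: far_kernel_def)
  next
    case False
    have "\<bar>far_kernel H v\<bar> \<le> \<bar>H - 3/2\<bar> * v powr (H - 3/2 - 1) * 1"
      using powr_diff_shift_bound[of "H - 3/2" 1 v] H v by (simp add: far_kernel_def abs_minus_commute)
    also have "\<dots> \<le> 2 * v powr (H - 3/2 - 1)" using H by (auto intro!: mult_right_mono)
    also have "H - 3/2 - 1 = H - 5/2" by simp
    finally show ?thesis using False by simp
  qed
qed

text \<open>Substitution \<open>s = d + c * v\<close>. Requiring \<open>eq\<close> for every real
  \<open>v\<close> encodes that the integrand vanishes outside the image of the positive half-line,
  so a single identity gives both existence and value.\<close>

lemma set_integral_affine:
  fixes g h :: "real \<Rightarrow> real"
  assumes c: "c \<noteq> 0" and eq: "\<And>v. \<bar>c\<bar> * (indicator A (d + c * v) * g (d + c * v)) = indicator {0<..} v * h v"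
  shows "set_integrable lborel A g \<longleftrightarrow> set_integrable lborel {0<..} h"
    and "(LINT s:A|lborel. g s) = (LINT v:{0<..}|lborel. h v)"
proof -
  have "set_integrable lborel A g \<longleftrightarrow> integrable lborel (\<lambda>v. indicator A (d + c * v) * g (d + c * v))"
    using lborel_integrable_real_affine_iff[OF c, of "\<lambda>s. indicator A s * g s" d] by (simp add: set_integrable_def)
  also have "\<dots> \<longleftrightarrow> integrable lborel (\<lambda>v. \<bar>c\<bar> * (indicator A (d + c * v) * g (d + c * v)))"
    using c by simp
  finally show "set_integrable lborel A g \<longleftrightarrow> set_integrable lborel {0<..} h"
    by (simp only: eq set_integrable_def real_scaleR_def)
  have "(LINT s:A|lborel. g s) = (LINT v|lborel. \<bar>c\<bar> * (indicator A (d + c * v) * g (d + c * v)))"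
    using lborel_integral_real_affine[OF c, of "\<lambda>s. indicator A s * g s" d] by (simp add: set_lebesgue_integral_def)
  then show "(LINT s:A|lborel. g s) = (LINT v:{0<..}|lborel. h v)"
    by (simp only: eq set_lebesgue_integral_def real_scaleR_def)
qed

text \<open>\<open>t powr (H - 1/2)\<close> is the factor kept in \<open>scaled_integrand\<close>,
  and the division by \<open>t\<close> cancels the Jacobian.\<close>

lemma powr_scale:
  fixes t v H :: real
  assumes "0 < t" "0 \<le> v"
  shows "(t * v) powr (H - 3/2) = t powr (H - 1/2) * v powr (H - 3/2) / t"
proof -
  have "t powr (H - 1/2) = t powr 1 * t powr (H - 3/2)" unfolding powr_add[symmetric] by simp
  then show ?thesis using assms by (simp add: powr_mult)
qed

context
  fixes b :: "real \<Rightarrow> real" and H t :: real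
  assumes gp: "good_path b" and H: "H \<in> {0<..<1}" and t: "0 < t"
begin

text \<open>Substitution \<open>s = t * (1 - v)\<close>, with the singular endpoint \<open>t\<close>
  at \<open>v = 0\<close>.\<close>

lemma
  shows set_integrable_plus_near: "set_integrable lborel {0..t} (\<lambda>s. (t - s) powr (H - 3/2) * (b t - b s))"
    and integral_plus_near: "(LINT s:{0..t}|lborel. (t - s) powr (H - 3/2) * (b t - b s))
      = scaled_integral near_kernel (\<lambda>v. 1) (\<lambda>v. 1 - v) b H t"
proof -
  have inc: "increment_at (\<lambda>v. 1) (\<lambda>v. 1 - v)" by (auto simp: increment_at_def)
  have eq: "\<bar>-t\<bar> * (indicator {0..t} (t + (-t) * v) * ((t - (t + (-t) * v)) powr (H - 3/2) * (b t - b (t + (-t) * v))))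
    = indicator {0<..} v * scaled_integrand near_kernel (\<lambda>v. 1) (\<lambda>v. 1 - v) b H t v" for v
  proof (cases "0 < v")
    case True
    have i: "indicator {0..t} (t + (-t) * v) = (indicator {0..1} v :: real)"
      using True t by (auto simp: indicator_def mult_le_cancel_left1 mult_le_0_iff)
    have e: "t + (-t) * v = t * (1 - v)" "t - t * (1 - v) = t * v" by (simp_all add: algebra_simps)
    show ?thesis
      unfolding i scaled_integrand_def near_kernel_def unfolding e unfolding powr_scale[OF t less_imp_le[OF True]]
      using True t by simp
  next
    case False
    \<comment> \<open>For \<open>v = 0\<close> the point \<open>s = t\<close> still lies in the
      closed interval, but the integrand vanishes there.\<close>
    then show ?thesis using t by (cases "v = 0") (auto simp: indicator_def mult_le_0_iff zero_le_mult_iff)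
  qed
  have "- t \<noteq> 0" using t by simp
  note * = set_integral_affine[OF this eq]
  show "set_integrable lborel {0..t} (\<lambda>s. (t - s) powr (H - 3/2) * (b t - b s))"
    unfolding * by (intro set_integrable_scaled_integrand singular_near_kernel inc gp H less_imp_le t)
  show "(LINT s:{0..t}|lborel. (t - s) powr (H - 3/2) * (b t - b s))
      = scaled_integral near_kernel (\<lambda>v. 1) (\<lambda>v. 1 - v) b H t"
    unfolding * scaled_integral_def ..
qed

text \<open>Substitution \<open>s = - t * v\<close>. The path value is the increment from 0, which
  also makes the integrand vanish at \<open>v = 0\<close>.\<close>

lemma
  shows set_integrable_plus_far: "set_integrable lborel {..0} (\<lambda>s. ((t - s) powr (H - 3/2) - (- s) powr (H - 3/2)) * b s)"
    and integral_plus_far: "(LINT s:{..0}|lborel. ((t - s) powr (H - 3/2) - (- s) powr (H - 3/2)) * b s)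
      = - scaled_integral far_kernel (\<lambda>v. - v) (\<lambda>v. 0) b H t"
proof -
  have inc: "increment_at (\<lambda>v. - v) (\<lambda>v. 0)" by (auto simp: increment_at_def)
  have b0: "b 0 = 0" using gp by (simp add: good_path_def)
  have eq: "\<bar>-t\<bar> * (indicator {..0} (0 + (-t) * v) * (((t - (0 + (-t) * v)) powr (H - 3/2) - (- (0 + (-t) * v)) powr (H - 3/2)) * b (0 + (-t) * v)))
    = indicator {0<..} v * (- scaled_integrand far_kernel (\<lambda>v. - v) (\<lambda>v. 0) b H t v)" for v
  proof (cases "0 < v")
    case True
    have i: "indicator {..0} (0 + (-t) * v) = (1 :: real)"
      using True t by (auto simp: indicator_def mult_le_0_iff zero_le_mult_iff)
    have e: "0 + (-t) * v = t * (-v)" "t - t * (-v) = t * (1 + v)" "- (t * (-v)) = t * v" by (simp_all add: algebra_simps)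
    have "0 \<le> 1 + v" using True by simp
    note p = powr_scale[OF t this] powr_scale[OF t less_imp_le[OF True]]
    show ?thesis
      unfolding i scaled_integrand_def far_kernel_def unfolding e unfolding p
      using True t by (simp add: b0 field_simps)
  next
    case False
    then show ?thesis using t b0 by (cases "v = 0") (auto simp: indicator_def mult_le_0_iff zero_le_mult_iff)
  qed
  have "- t \<noteq> 0" using t by simp
  note * = set_integral_affine[OF this eq]
  have "set_integrable lborel {0<..} (scaled_integrand far_kernel (\<lambda>v. - v) (\<lambda>v. 0) b H t)"
    by (intro set_integrable_scaled_integrand singular_far_kernel inc gp H less_imp_le t)
  then show "set_integrable lborel {..0} (\<lambda>s. ((t - s) powr (H - 3/2) - (- s) powr (H - 3/2)) * b s)"
    unfolding * by (simp add: set_integrable_def)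
  show "(LINT s:{..0}|lborel. ((t - s) powr (H - 3/2) - (- s) powr (H - 3/2)) * b s)
      = - scaled_integral far_kernel (\<lambda>v. - v) (\<lambda>v. 0) b H t"
    unfolding * scaled_integral_def by (simp add: set_lebesgue_integral_def)
qed

text \<open>Substitution \<open>s = t * v\<close>, with the singular endpoint 0 at
  \<open>v = 0\<close>.\<close>

lemma
  shows set_integrable_minus_near: "set_integrable lborel {0..t} (\<lambda>s. s powr (H - 3/2) * b s)"
    and integral_minus_near: "(LINT s:{0..t}|lborel. s powr (H - 3/2) * b s)
      = scaled_integral near_kernel (\<lambda>v. v) (\<lambda>v. 0) b H t"
proof -
  have inc: "increment_at (\<lambda>v. v) (\<lambda>v. 0)" by (auto simp: increment_at_def)
  have b0: "b 0 = 0" using gp by (simp add: good_path_def)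
  have eq: "\<bar>t\<bar> * (indicator {0..t} (0 + t * v) * ((0 + t * v) powr (H - 3/2) * b (0 + t * v)))
    = indicator {0<..} v * scaled_integrand near_kernel (\<lambda>v. v) (\<lambda>v. 0) b H t v" for v
  proof (cases "0 < v")
    case True
    have i: "indicator {0..t} (0 + t * v) = (indicator {0..1} v :: real)"
      using True t by (auto simp: indicator_def mult_le_cancel_left1 mult_le_cancel_left2)
    have e: "0 + t * v = t * v" by simp
    show ?thesis
      unfolding i scaled_integrand_def near_kernel_def unfolding e unfolding powr_scale[OF t less_imp_le[OF True]]
      using True t by (simp add: b0)
  next
    case False
    then show ?thesis using t b0 by (cases "v = 0") (auto simp: indicator_def zero_le_mult_iff)
  qed
  have "t \<noteq> 0" using t by simp
  note * = set_integral_affine[OF this eq]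
  show "set_integrable lborel {0..t} (\<lambda>s. s powr (H - 3/2) * b s)"
    unfolding * by (intro set_integrable_scaled_integrand singular_near_kernel inc gp H less_imp_le t)
  show "(LINT s:{0..t}|lborel. s powr (H - 3/2) * b s) = scaled_integral near_kernel (\<lambda>v. v) (\<lambda>v. 0) b H t"
    unfolding * scaled_integral_def ..
qed

text \<open>Substitution \<open>s = t * (1 + v)\<close>, with the singular endpoint \<open>t\<close>
  at \<open>v = 0\<close>.\<close>

lemma
  shows set_integrable_minus_far: "set_integrable lborel {t..} (\<lambda>s. (s powr (H - 3/2) - (s - t) powr (H - 3/2)) * (b s - b t))"
    and integral_minus_far: "(LINT s:{t..}|lborel. (s powr (H - 3/2) - (s - t) powr (H - 3/2)) * (b s - b t))
      = - scaled_integral far_kernel (\<lambda>v. 1 + v) (\<lambda>v. 1) b H t"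
proof -
  have inc: "increment_at (\<lambda>v. 1 + v) (\<lambda>v. 1)" by (auto simp: increment_at_def)
  have eq: "\<bar>t\<bar> * (indicator {t..} (t + t * v) * (((t + t * v) powr (H - 3/2) - (t + t * v - t) powr (H - 3/2)) * (b (t + t * v) - b t)))
    = indicator {0<..} v * (- scaled_integrand far_kernel (\<lambda>v. 1 + v) (\<lambda>v. 1) b H t v)" for v
  proof (cases "0 < v")
    case True
    have i: "indicator {t..} (t + t * v) = (1 :: real)"
      using True t by (auto simp: indicator_def zero_le_mult_iff)
    have e: "t + t * v = t * (1 + v)" "t * (1 + v) - t = t * v" by (simp_all add: algebra_simps)
    have "0 \<le> 1 + v" using True by simp
    note p = powr_scale[OF t this] powr_scale[OF t less_imp_le[OF True]]
    show ?thesis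
      unfolding i scaled_integrand_def far_kernel_def unfolding e unfolding p
      using True t by (simp add: field_simps)
  next
    case False
    then show ?thesis using t by (cases "v = 0") (auto simp: indicator_def zero_le_mult_iff)
  qed
  have "t \<noteq> 0" using t by simp
  note * = set_integral_affine[OF this eq]
  have "set_integrable lborel {0<..} (scaled_integrand far_kernel (\<lambda>v. 1 + v) (\<lambda>v. 1) b H t)"
    by (intro set_integrable_scaled_integrand singular_far_kernel inc gp H less_imp_le t)
  then show "set_integrable lborel {t..} (\<lambda>s. (s powr (H - 3/2) - (s - t) powr (H - 3/2)) * (b s - b t))"
    unfolding * by (simp add: set_integrable_def)
  show "(LINT s:{t..}|lborel. (s powr (H - 3/2) - (s - t) powr (H - 3/2)) * (b s - b t))
      = - scaled_integral far_kernel (\<lambda>v. 1 + v) (\<lambda>v. 1) b H t"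
    unfolding * scaled_integral_def by (simp add: set_lebesgue_integral_def)
qed

end

section \<open>Continuity of the two pathwise fields\<close>

lemma scaled_integral_zero [simp]: "scaled_integral \<kappa> p q b H 0 = 0"
  by (simp add: scaled_integral_def scaled_integrand_def set_lebesgue_integral_def)

text \<open>The formula also holds at \<open>t = 0\<close>, because \<open>0 powr a = 0\<close>.
  Thus the case distinction disappears and continuity can be checked term by term.\<close>

lemma Xt_plus_eq:
  assumes "good_path (\<lambda>s. B s \<omega>)" "H \<in> {0<..<1}" "0 \<le> t"
  shows "Xt_plus B H t \<omega> = t powr (H - 1/2) * B t \<omega>
     - (H - 1/2) * scaled_integral near_kernel (\<lambda>v. 1) (\<lambda>v. 1 - v) (\<lambda>s. B s \<omega>) H t
     - (H - 1/2) * scaled_integral far_kernel (\<lambda>v. - v) (\<lambda>v. 0) (\<lambda>s. B s \<omega>) H t"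
proof (cases "t = 0")
  case True
  then show ?thesis by (simp add: Xt_plus_def)
next
  case False
  with assms(3) have "0 < t" by simp
  note * = integral_plus_near[OF assms(1,2) this] integral_plus_far[OF assms(1,2) this]
  show ?thesis using False by (simp add: Xt_plus_def *)
qed

lemma Xt_minus_eq:
  assumes "good_path (\<lambda>s. B s \<omega>)" "H \<in> {0<..<1}" "0 \<le> t"
  shows "Xt_minus B H t \<omega> = - (t powr (H - 1/2) * B t \<omega>)
     + (H - 1/2) * scaled_integral near_kernel (\<lambda>v. v) (\<lambda>v. 0) (\<lambda>s. B s \<omega>) H t
     - (H - 1/2) * scaled_integral far_kernel (\<lambda>v. 1 + v) (\<lambda>v. 1) (\<lambda>s. B s \<omega>) H t"
proof (cases "t = 0")
  case True
  then show ?thesis by (simp add: Xt_minus_def)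
next
  case False
  with assms(3) have "0 < t" by simp
  note * = integral_minus_near[OF assms(1,2) this] integral_minus_far[OF assms(1,2) this]
  show ?thesis using False by (simp add: Xt_minus_def *)
qed

lemma continuous_on_Xt_plus:
  assumes gp: "good_path (\<lambda>s. B s \<omega>)"
  shows "continuous_on ({0<..<1} \<times> {0..}) (\<lambda>(H, t). Xt_plus B H t \<omega>)"
proof -
  have inc: "increment_at (\<lambda>v. 1) (\<lambda>v. 1 - v)" "increment_at (\<lambda>v. - v) (\<lambda>v. 0)" by (auto simp: increment_at_def)
  have lin: "continuous_on ({0<..<1} \<times> {0..}) (\<lambda>x :: real \<times> real. fst x - 1/2)"
    by (intro continuous_intros)
  note c = continuous_on_powr_mult_path[OF gp, unfolded case_prod_unfold]
    continuous_on_scaled_integral[OF singular_near_kernel inc(1) gp, unfolded case_prod_unfold]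
    continuous_on_scaled_integral[OF singular_far_kernel inc(2) gp, unfolded case_prod_unfold]
  have "continuous_on ({0<..<1} \<times> {0..}) (\<lambda>x. snd x powr (fst x - 1/2) * B (snd x) \<omega>
     - (fst x - 1/2) * scaled_integral near_kernel (\<lambda>v. 1) (\<lambda>v. 1 - v) (\<lambda>s. B s \<omega>) (fst x) (snd x)
     - (fst x - 1/2) * scaled_integral far_kernel (\<lambda>v. - v) (\<lambda>v. 0) (\<lambda>s. B s \<omega>) (fst x) (snd x))"
    by (intro continuous_on_diff continuous_on_mult[OF lin] c)
  then show ?thesis
    by (rule continuous_on_cong[THEN iffD1, OF refl, rotated]) (auto simp: Xt_plus_eq[where B=B and \<omega>=\<omega>, OF gp])
qed

lemma continuous_on_Xt_minus:
  assumes gp: "good_path (\<lambda>s. B s \<omega>)"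
  shows "continuous_on ({0<..<1} \<times> {0..}) (\<lambda>(H, t). Xt_minus B H t \<omega>)"
proof -
  have inc: "increment_at (\<lambda>v. v) (\<lambda>v. 0)" "increment_at (\<lambda>v. 1 + v) (\<lambda>v. 1)" by (auto simp: increment_at_def)
  have lin: "continuous_on ({0<..<1} \<times> {0..}) (\<lambda>x :: real \<times> real. fst x - 1/2)"
    by (intro continuous_intros)
  note c = continuous_on_powr_mult_path[OF gp, unfolded case_prod_unfold]
    continuous_on_scaled_integral[OF singular_near_kernel inc(1) gp, unfolded case_prod_unfold]
    continuous_on_scaled_integral[OF singular_far_kernel inc(2) gp, unfolded case_prod_unfold]
  have "continuous_on ({0<..<1} \<times> {0..}) (\<lambda>x. - (snd x powr (fst x - 1/2) * B (snd x) \<omega>)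
     + (fst x - 1/2) * scaled_integral near_kernel (\<lambda>v. v) (\<lambda>v. 0) (\<lambda>s. B s \<omega>) (fst x) (snd x)
     - (fst x - 1/2) * scaled_integral far_kernel (\<lambda>v. 1 + v) (\<lambda>v. 1) (\<lambda>s. B s \<omega>) (fst x) (snd x))"
    by (intro continuous_on_diff continuous_on_add continuous_on_minus continuous_on_mult[OF lin] c)
  then show ?thesis
    by (rule continuous_on_cong[THEN iffD1, OF refl, rotated]) (auto simp: Xt_minus_eq[where B=B and \<omega>=\<omega>, OF gp])
qed

section \<open>Integration by parts\<close>

context brownian
begin

lemma AE_good_path: "AE \<omega> in M. good_path (\<lambda>t. B t \<omega>)"
proof -
  have "AE \<omega> in M. \<forall>k::nat. hoelder_growth (1 / (real k + 3)) (\<lambda>t. B t \<omega>)"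
    unfolding AE_all_countable by (intro allI AE_hoelder_growth) (auto simp: field_simps)
  with AE_continuous AE_B_zero show ?thesis
    by eventually_elim (simp add: good_path_def)
qed

end

section \<open>Vanishing of the boundary terms\<close>

lemma path_increment_bound:
  assumes "hoelder_growth \<delta> b"
  obtains C where "0 \<le> C" "\<And>r y. \<bar>b (r + y) - b r\<bar> \<le> C * (1 + \<bar>r\<bar> + \<bar>y\<bar>) powr (2 * \<delta>) * \<bar>y\<bar> powr (1/2 - \<delta>)"
proof -
  obtain C where C: "0 \<le> C" and b: "\<And>T s t. 1 \<le> T \<Longrightarrow> s \<in> {-T..T} \<Longrightarrow> t \<in> {-T..T} \<Longrightarrow>
      \<bar>b s - b t\<bar> \<le> C * T powr (2 * \<delta>) * \<bar>s - t\<bar> powr (1/2 - \<delta>)"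
    using assms unfolding hoelder_growth_def by blast
  show thesis
  proof (rule that[OF C])
    fix r y :: real
    show "\<bar>b (r + y) - b r\<bar> \<le> C * (1 + \<bar>r\<bar> + \<bar>y\<bar>) powr (2 * \<delta>) * \<bar>y\<bar> powr (1/2 - \<delta>)"
      \<comment> \<open>Here \<open>T\<close> is adapted to the pair of points, so one bound covers
        both short and long increments.\<close>
      using b[of "1 + \<bar>r\<bar> + \<bar>y\<bar>" "r + y" r] by (simp add: abs_le_iff) linarith
  qed
qed

text \<open>Boundary term at a singular endpoint \<open>r\<close>: the power and the increment
  combine to \<open>\<bar>y\<bar> powr (H - \<delta>)\<close> with \<open>\<delta> < H\<close>. For
  \<open>H < 1/2\<close> the power alone diverges, hence the subtraction of
  \<open>b r\<close>.\<close>

lemma near_boundary_tendsto: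
  fixes y :: "nat \<Rightarrow> real"
  assumes gp: "good_path b" and H: "0 < H" and y: "y \<longlonglongrightarrow> 0"
  shows "(\<lambda>n. \<bar>y n\<bar> powr (H - 1/2) * (b (r + y n) - b r)) \<longlonglongrightarrow> 0"
proof -
  obtain \<delta> where \<delta>: "0 < \<delta>" "\<delta> < 1/2" "\<delta> < H" "hoelder_growth \<delta> b"
    using good_path_exponent[OF gp H] by blast
  obtain C where C: "0 \<le> C" and b: "\<And>r y. \<bar>b (r + y) - b r\<bar> \<le> C * (1 + \<bar>r\<bar> + \<bar>y\<bar>) powr (2 * \<delta>) * \<bar>y\<bar> powr (1/2 - \<delta>)"
    using path_increment_bound[OF \<delta>(4)] by blast
  show ?thesis
  proof (rule Lim_null_comparison)
    show "\<forall>\<^sub>F n in sequentially. norm (\<bar>y n\<bar> powr (H - 1/2) * (b (r + y n) - b r))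
        \<le> C * (1 + \<bar>r\<bar> + \<bar>y n\<bar>) powr (2 * \<delta>) * \<bar>y n\<bar> powr (H - \<delta>)"
    proof (intro always_eventually allI)
      fix n
      have "norm (\<bar>y n\<bar> powr (H - 1/2) * (b (r + y n) - b r)) = \<bar>y n\<bar> powr (H - 1/2) * \<bar>b (r + y n) - b r\<bar>"
        by (simp add: abs_mult)
      also have "\<dots> \<le> \<bar>y n\<bar> powr (H - 1/2) * (C * (1 + \<bar>r\<bar> + \<bar>y n\<bar>) powr (2 * \<delta>) * \<bar>y n\<bar> powr (1/2 - \<delta>))"
        by (intro mult_left_mono b) auto
      also have "\<dots> = C * (1 + \<bar>r\<bar> + \<bar>y n\<bar>) powr (2 * \<delta>) * (\<bar>y n\<bar> powr (H - 1/2) * \<bar>y n\<bar> powr (1/2 - \<delta>))"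
        by (simp only: mult_ac)
      also have "\<bar>y n\<bar> powr (H - 1/2) * \<bar>y n\<bar> powr (1/2 - \<delta>) = \<bar>y n\<bar> powr (H - \<delta>)"
        by (simp add: powr_add[symmetric])
      finally show "norm (\<bar>y n\<bar> powr (H - 1/2) * (b (r + y n) - b r))
        \<le> C * (1 + \<bar>r\<bar> + \<bar>y n\<bar>) powr (2 * \<delta>) * \<bar>y n\<bar> powr (H - \<delta>)" .
    qed
    have "(\<lambda>n. C * (1 + \<bar>r\<bar> + \<bar>y n\<bar>) powr (2 * \<delta>) * \<bar>y n\<bar> powr (H - \<delta>))
      \<longlonglongrightarrow> C * (1 + \<bar>r\<bar> + \<bar>0\<bar>) powr (2 * \<delta>) * \<bar>0\<bar> powr (H - \<delta>)"
      using \<delta> by (intro tendsto_mult tendsto_const tendsto_powr' tendsto_add tendsto_rabs y) auto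
    then show "(\<lambda>n. C * (1 + \<bar>r\<bar> + \<bar>y n\<bar>) powr (2 * \<delta>) * \<bar>y n\<bar> powr (H - \<delta>)) \<longlonglongrightarrow> 0" by simp
  qed
qed

lemma near_boundary_shift_tendsto:
  fixes y :: "nat \<Rightarrow> real"
  assumes gp: "good_path b" and H: "0 < H" and t: "0 < t" and y: "y \<longlonglongrightarrow> 0"
  shows "(\<lambda>n. ((t + \<bar>y n\<bar>) powr (H - 1/2) - \<bar>y n\<bar> powr (H - 1/2)) * (b (r + y n) - b r)) \<longlonglongrightarrow> 0"
proof -
  have "continuous_on UNIV b" using gp by (simp add: good_path_def)
  then have b: "isCont b z" for z by (simp add: continuous_on_eq_continuous_at)
  have "(\<lambda>n. (t + \<bar>y n\<bar>) powr (H - 1/2) * (b (r + y n) - b r)) \<longlonglongrightarrow> (t + \<bar>0\<bar>) powr (H - 1/2) * (b (r + 0) - b r)"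
    using t by (intro tendsto_mult tendsto_diff tendsto_const tendsto_powr tendsto_add tendsto_rabs isCont_tendsto_compose[OF b] y) auto
  from tendsto_diff[OF this near_boundary_tendsto[OF gp H y, of r]]
  show ?thesis by (simp add: left_diff_distrib)
qed

text \<open>The kernel difference is of order \<open>x powr (H - 3/2)\<close> and the path of order
  \<open>x powr (1/2 + \<delta>)\<close>, so the product is of order
  \<open>x powr (H - 1 + \<delta>)\<close>, a negative power once
  \<open>\<delta> < 1 - H\<close>.\<close>

lemma far_boundary_tendsto:
  fixes x y :: "nat \<Rightarrow> real"
  assumes gp: "good_path b" and H: "H \<in> {0<..<1}" and t: "0 \<le> t"
    and x: "filterlim x at_top sequentially" and y: "\<And>n. \<bar>y n\<bar> \<le> x n + t"
  shows "(\<lambda>n. ((t + x n) powr (H - 1/2) - x n powr (H - 1/2)) * (b (r + y n) - b r)) \<longlonglongrightarrow> 0"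
proof -
  obtain \<delta> where \<delta>: "0 < \<delta>" "\<delta> < 1/2" "\<delta> < 1 - H" "hoelder_growth \<delta> b"
    using good_path_exponent[OF gp, of "1 - H"] H by auto
  obtain C where C: "0 \<le> C" and b: "\<And>r y. \<bar>b (r + y) - b r\<bar> \<le> C * (1 + \<bar>r\<bar> + \<bar>y\<bar>) powr (2 * \<delta>) * \<bar>y\<bar> powr (1/2 - \<delta>)"
    using path_increment_bound[OF \<delta>(4)] by blast
  \<comment> \<open>\<open>L\<close> absorbs all constants:
    \<open>1 + \<bar>r\<bar> + \<bar>y n\<bar> \<le> L * x n\<close> as soon as
    \<open>1 \<le> x n\<close>.\<close>
  define L where "L = 2 + \<bar>r\<bar> + t"
  define K where "K = \<bar>H - 1/2\<bar> * t * (C * L powr (2 * \<delta>) * L powr (1/2 - \<delta>))"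
  have L: "0 < L" using t by (simp add: L_def)
  show ?thesis
  proof (rule Lim_null_comparison)
    have "\<forall>\<^sub>F n in sequentially. 1 \<le> x n" using x by (simp add: filterlim_at_top)
    then show "\<forall>\<^sub>F n in sequentially. norm (((t + x n) powr (H - 1/2) - x n powr (H - 1/2)) * (b (r + y n) - b r))
        \<le> K * x n powr (H - 1 + \<delta>)"
    proof eventually_elim
      case (elim n)
      have A: "\<bar>(t + x n) powr (H - 1/2) - x n powr (H - 1/2)\<bar> \<le> \<bar>H - 1/2\<bar> * x n powr (H - 1/2 - 1) * t"
        using H t elim by (intro powr_diff_shift_bound) auto
      have l1: "1 + \<bar>r\<bar> + \<bar>y n\<bar> \<le> L * x n"
      proof -
        have "1 + \<bar>r\<bar> + \<bar>y n\<bar> \<le> (1 + \<bar>r\<bar> + t) * 1 + x n" using y[of n] by simp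
        also have "\<dots> \<le> (1 + \<bar>r\<bar> + t) * x n + x n" using elim t by (intro add_right_mono mult_left_mono) auto
        finally show ?thesis by (simp add: L_def algebra_simps)
      qed
      have "\<bar>b (r + y n) - b r\<bar> \<le> C * (1 + \<bar>r\<bar> + \<bar>y n\<bar>) powr (2 * \<delta>) * \<bar>y n\<bar> powr (1/2 - \<delta>)" by (rule b)
      also have "\<dots> \<le> C * (L * x n) powr (2 * \<delta>) * (L * x n) powr (1/2 - \<delta>)"
        using C \<delta> l1 by (intro mult_mono mult_left_mono powr_mono2) auto
      also have "\<dots> = C * L powr (2 * \<delta>) * L powr (1/2 - \<delta>) * (x n powr (2 * \<delta>) * x n powr (1/2 - \<delta>))"
        using L elim by (simp add: powr_mult)
      finally have Bd: "\<bar>b (r + y n) - b r\<bar> \<le> C * L powr (2 * \<delta>) * L powr (1/2 - \<delta>) * (x n powr (2 * \<delta>) * x n powr (1/2 - \<delta>))" .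
      have "norm (((t + x n) powr (H - 1/2) - x n powr (H - 1/2)) * (b (r + y n) - b r))
         = \<bar>(t + x n) powr (H - 1/2) - x n powr (H - 1/2)\<bar> * \<bar>b (r + y n) - b r\<bar>" by (simp add: abs_mult)
      also have "\<dots> \<le> (\<bar>H - 1/2\<bar> * x n powr (H - 1/2 - 1) * t) *
          (C * L powr (2 * \<delta>) * L powr (1/2 - \<delta>) * (x n powr (2 * \<delta>) * x n powr (1/2 - \<delta>)))"
        using A Bd t by (intro mult_mono) auto
      also have "\<dots> = K * (x n powr (H - 1/2 - 1) * (x n powr (2 * \<delta>) * x n powr (1/2 - \<delta>)))"
        by (simp only: K_def mult_ac)
      also have "x n powr (H - 1/2 - 1) * (x n powr (2 * \<delta>) * x n powr (1/2 - \<delta>)) = x n powr (H - 1 + \<delta>)"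
        by (simp add: powr_add[symmetric] algebra_simps)
      finally show ?case .
    qed
    have "(\<lambda>n. x n powr (H - 1 + \<delta>)) \<longlonglongrightarrow> 0"
      using \<delta> x by (intro tendsto_neg_powr) auto
    then show "(\<lambda>n. K * x n powr (H - 1 + \<delta>)) \<longlonglongrightarrow> 0" by (rule tendsto_mult_right_zero)
  qed
qed

section \<open>Square integrability of the four kernels\<close>

lemma square_integrable_affine:
  fixes f :: "real \<Rightarrow> real"
  assumes f: "(\<lambda>s. indicator A s * f s) \<in> borel_measurable borel" and c: "c \<noteq> 0"
    and \<alpha>\<beta>: "-1 < \<alpha>" "\<beta> < -1"
    and bound: "\<And>v. v \<noteq> 0 \<Longrightarrow> (indicator A (d + c * v) * f (d + c * v))\<^sup>2 \<le> K * (indicator {0<..} v * majorant \<alpha> \<beta> v)"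
  shows "(\<integral>\<^sup>+ s. ennreal ((indicator A s * f s)\<^sup>2) \<partial>lborel) < \<infinity>"
proof -
  have int: "integrable lborel (\<lambda>v. K * (indicator {0<..} v * majorant \<alpha> \<beta> v))"
    using set_integrable_majorant[OF \<alpha>\<beta>] by (simp add: set_integrable_def)
  have m: "(\<lambda>s. ennreal ((indicator A s * f s)\<^sup>2)) \<in> borel_measurable borel" using f by measurable
  have "(\<integral>\<^sup>+ s. ennreal ((indicator A s * f s)\<^sup>2) \<partial>lborel)
     = \<bar>c\<bar> * (\<integral>\<^sup>+ v. ennreal ((indicator A (d + c * v) * f (d + c * v))\<^sup>2) \<partial>lborel)"
    by (rule nn_integral_real_affine[OF m c])
  also have "\<dots> \<le> \<bar>c\<bar> * (\<integral>\<^sup>+ v. ennreal (norm (K * (indicator {0<..} v * majorant \<alpha> \<beta> v))) \<partial>lborel)"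
  proof (intro mult_left_mono nn_integral_mono_AE)
    show "AE v in lborel. ennreal ((indicator A (d + c * v) * f (d + c * v))\<^sup>2) \<le> ennreal (norm (K * (indicator {0<..} v * majorant \<alpha> \<beta> v)))"
      using AE_lborel_singleton[of "0::real"]
    proof eventually_elim
      case (elim v)
      show ?case by (intro ennreal_leI order_trans[OF bound[OF elim]]) (simp only: real_norm_def abs_ge_self)
    qed
  qed simp
  also have "\<dots> < \<infinity>"
  proof -
    have "(\<integral>\<^sup>+ v. ennreal (norm (K * (indicator {0<..} v * majorant \<alpha> \<beta> v))) \<partial>lborel) < \<infinity>"
      using int unfolding integrable_iff_bounded by (rule conjunct2)
    then show ?thesis unfolding infinity_ennreal_def ennreal_mult_less_top by (simp only: ennreal_less_top simp_thms)
  qed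
  finally show ?thesis .
qed

context
  fixes H t :: real
  assumes H: "H \<in> {0<..<1}" and t: "0 < t"
begin

text \<open>The squared kernel is a power with exponent \<open>2 * H - 1 > -1\<close>. Beyond
  \<open>v = 1\<close> it vanishes, so any \<open>\<beta> < -1\<close> would do. The two
  alternatives place the singularity at 0 or at \<open>t\<close>.\<close>

lemma square_integrable_near:
  fixes c d :: real and f :: "real \<Rightarrow> real"
  assumes c: "c = t \<and> d = 0 \<and> f = (\<lambda>s. s powr (H - 1/2)) \<or> c = - t \<and> d = t \<and> f = (\<lambda>s. (t - s) powr (H - 1/2))"
  shows "(\<integral>\<^sup>+ s. ennreal ((indicator {0..t} s * f s)\<^sup>2) \<partial>lborel) < \<infinity>"
proof (rule square_integrable_affine[where c=c and d=d and \<alpha>="2 * H - 1" and \<beta>="-2" and K="t powr (2 * H - 1)"])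
  show "(\<lambda>s. indicator {0..t} s * f s) \<in> borel_measurable borel"
    using c by auto
  fix v :: real assume "v \<noteq> 0"
  have i: "indicator {0..t} (d + c * v) = (indicator {0..1} v :: real)"
    using c t by (auto simp: indicator_def mult_le_cancel_left1 mult_le_cancel_left2 mult_le_0_iff zero_le_mult_iff)
  have f: "f (d + c * v) = (t * v) powr (H - 1/2)" using c by auto
  show "(indicator {0..t} (d + c * v) * f (d + c * v))\<^sup>2 \<le> t powr (2 * H - 1) * (indicator {0<..} v * majorant (2 * H - 1) (-2) v)"
  proof (cases "0 < v \<and> v \<le> 1")
    case True
    have sq: "(x powr (H - 1/2))\<^sup>2 = x powr (2 * H - 1)" for x :: real
      by (simp add: power2_eq_square powr_add[symmetric])
    have "((t * v) powr (H - 1/2))\<^sup>2 = t powr (2 * H - 1) * v powr (2 * H - 1)"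
      unfolding sq using True t by (simp add: powr_mult)
    then show ?thesis unfolding i f using True by (simp add: majorant_def)
  next
    case False
    then have "indicator {0..1} v = (0::real)" using \<open>v \<noteq> 0\<close> by (auto simp: indicator_def)
    then show ?thesis unfolding i by (simp add: majorant_def)
  qed
qed (use H t c in auto)

text \<open>Near the singularity the kernel is at most
  \<open>(t + 2) * v powr - \<bar>H - 1/2\<bar>\<close> whatever the sign of \<open>H - 1/2\<close>,
  and \<open>\<bar>2 * H - 1\<bar> < 1\<close>. At infinity the mean value inequality leaves
  \<open>v powr (H - 3/2)\<close>, whose square has exponent \<open>2 * H - 3 < -1\<close>.\<close>

lemma square_integrable_far:
  fixes c d :: real and A :: "real set" and f :: "real \<Rightarrow> real"
  assumes c: "c = -1 \<and> d = 0 \<and> A = {..0} \<and> f = (\<lambda>s. (t - s) powr (H - 1/2) - (- s) powr (H - 1/2)) \<or>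
    c = 1 \<and> d = t \<and> A = {t..} \<and> f = (\<lambda>s. s powr (H - 1/2) - (s - t) powr (H - 1/2))"
  shows "(\<integral>\<^sup>+ s. ennreal ((indicator A s * f s)\<^sup>2) \<partial>lborel) < \<infinity>"
proof (rule square_integrable_affine[where c=c and d=d and \<alpha>="- \<bar>2 * H - 1\<bar>" and \<beta>="2 * H - 3" and K="(t + 2)\<^sup>2"])
  show "(\<lambda>s. indicator A s * f s) \<in> borel_measurable borel"
    using c by auto
  fix v :: real assume "v \<noteq> 0"
  have i: "indicator A (d + c * v) = (indicator {0..} v :: real)" using c by (auto simp: indicator_def)
  have f: "f (d + c * v) = (t + v) powr (H - 1/2) - v powr (H - 1/2)" using c by auto
  show "(indicator A (d + c * v) * f (d + c * v))\<^sup>2 \<le> (t + 2)\<^sup>2 * (indicator {0<..} v * majorant (- \<bar>2 * H - 1\<bar>) (2 * H - 3) v)"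
  proof (cases "0 < v")
    case v: True
    define h where "h = \<bar>(t + v) powr (H - 1/2) - v powr (H - 1/2)\<bar>"
    have "h\<^sup>2 \<le> (t + 2)\<^sup>2 * majorant (- \<bar>2 * H - 1\<bar>) (2 * H - 3) v"
    proof (cases "v \<le> 1")
      case True
      have "h \<le> (t + 2) * v powr - \<bar>H - 1/2\<bar>"
      proof (cases "1/2 \<le> H")
        case ge: True
        have "v powr (H - 1/2) \<le> (t + v) powr (H - 1/2)" using v t ge by (intro powr_mono2) auto
        then have "h \<le> (t + v) powr (H - 1/2)" by (simp add: h_def)
        also have "\<dots> \<le> (t + 1) powr (H - 1/2)" using v t ge True by (intro powr_mono2) auto
        also have "\<dots> \<le> (t + 1) powr 1" using t H by (intro powr_mono) auto
        also have "\<dots> \<le> (t + 2) * 1" using t by simp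
        also have "\<dots> \<le> (t + 2) * v powr - \<bar>H - 1/2\<bar>"
          using t v True powr_mono'[of "- \<bar>H - 1/2\<bar>" 0 v] by (intro mult_left_mono) auto
        finally show ?thesis .
      next
        case False
        have "(t + v) powr (H - 1/2) \<le> v powr (H - 1/2)" using v t False by (intro powr_mono2') auto
        then have "h \<le> 1 * v powr (H - 1/2)" by (simp add: h_def)
        also have "\<dots> \<le> (t + 2) * v powr (H - 1/2)" using t by (intro mult_right_mono) auto
        finally show ?thesis using False by simp
      qed
      then have "h\<^sup>2 \<le> ((t + 2) * v powr - \<bar>H - 1/2\<bar>)\<^sup>2" by (intro power_mono) (auto simp: h_def)
      also have "\<dots> = (t + 2)\<^sup>2 * v powr (- \<bar>H - 1/2\<bar> + - \<bar>H - 1/2\<bar>)"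
        unfolding power_mult_distrib powr_add by (simp add: power2_eq_square)
      also have "- \<bar>H - 1/2\<bar> + - \<bar>H - 1/2\<bar> = - \<bar>2 * H - 1\<bar>" by (simp add: abs_if)
      finally show ?thesis using True by (simp add: majorant_def)
    next
      case False
      have "h \<le> \<bar>H - 1/2\<bar> * v powr (H - 1/2 - 1) * t"
        unfolding h_def using H t v by (intro powr_diff_shift_bound) auto
      also have "\<dots> \<le> 1 * v powr (H - 1/2 - 1) * (t + 2)" using H t by (intro mult_mono) auto
      finally have "h \<le> (t + 2) * v powr (H - 1/2 - 1)" by (simp only: mult_1_left mult.commute)
      then have "h\<^sup>2 \<le> ((t + 2) * v powr (H - 1/2 - 1))\<^sup>2" by (intro power_mono) (auto simp: h_def)
      also have "\<dots> = (t + 2)\<^sup>2 * v powr (2 * H - 3)"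
      proof -
        have "(v powr (H - 1/2 - 1))\<^sup>2 = v powr (2 * H - 3)" by (simp add: power2_eq_square powr_add[symmetric])
        then show ?thesis by (simp only: power_mult_distrib)
      qed
      also have "\<dots> \<le> (t + 2)\<^sup>2 * (2 * v powr (2 * H - 3))" by (intro mult_left_mono) auto
      finally show ?thesis using False by (simp add: majorant_def)
    qed
    then show ?thesis unfolding i f using v by (simp add: h_def)
  next
    case False
    then have "indicator {0..} v = (0::real)" using \<open>v \<noteq> 0\<close> by (auto simp: indicator_def)
    then show ?thesis unfolding i by (simp add: majorant_def)
  qed
qed (use H c in auto)

end

lemma has_real_derivative_powr_shift:
  fixes d s H :: real
  assumes "d < s"
  shows "((\<lambda>s. (s - d) powr (H - 1/2)) has_real_derivative (H - 1/2) * (s - d) powr (H - 3/2)) (at s)"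
proof -
  have "((\<lambda>s. (s - d) powr (H - 1/2)) has_real_derivative ((H - 1/2) * (s - d) powr (H - 1/2 - 1)) * 1) (at s)"
    using assms by (intro DERIV_chain2[OF has_real_derivative_powr]) (auto intro!: derivative_eq_intros)
  then show ?thesis by simp
qed

lemma has_real_derivative_powr_reflect:
  fixes d s H :: real
  assumes "s < d"
  shows "((\<lambda>s. (d - s) powr (H - 1/2)) has_real_derivative - (H - 1/2) * (d - s) powr (H - 3/2)) (at s)"
proof -
  have "((\<lambda>s. (d - s) powr (H - 1/2)) has_real_derivative ((H - 1/2) * (d - s) powr (H - 1/2 - 1)) * (-1)) (at s)"
    using assms by (intro DERIV_chain2[OF has_real_derivative_powr]) (auto intro!: derivative_eq_intros)
  moreover have "H - 1/2 - 1 = H - 3/2" by simp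
  ultimately show ?thesis by (simp only: mult_minus1_right mult_minus_left)
qed

lemma inverse_Suc_tendsto: "(\<lambda>n. c * (1 / real (Suc n))) \<longlonglongrightarrow> 0"
  using tendsto_mult_left[OF LIMSEQ_Suc[OF lim_1_over_n], of c] by simp

lemma eventually_less_Suc: "\<forall>\<^sub>F n in sequentially. c < real (Suc n)"
  using filterlim_Suc[THEN filterlim_compose[OF filterlim_real_sequentially]]
  by (simp add: filterlim_at_top_dense)

lemma eventually_inverse_Suc_less: "0 < e \<Longrightarrow> \<forall>\<^sub>F n in sequentially. c * (1 / real (Suc n)) < e"
  using order_tendstoD(2)[OF inverse_Suc_tendsto] by blast

lemma filterlim_Suc_at_top: "filterlim (\<lambda>n. real (Suc n)) at_top sequentially"
  by (intro filterlim_compose[OF filterlim_real_sequentially] filterlim_Suc)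

section \<open>The four Wiener integrals evaluated by parts\<close>

context brownian
begin

lemma ae_wiener_AE_cong:
  assumes "ae_wiener f Z" "AE \<omega> in M. Z \<omega> = Z' \<omega>"
  shows "ae_wiener f Z'"
proof -
  from assms(1) obtain Y where Y: "has_wiener_integral M B f Y" "AE \<omega> in M. Y \<omega> = Z \<omega>"
    unfolding ae_wiener_def by blast
  from Y(2) assms(2) have "AE \<omega> in M. Y \<omega> = Z' \<omega>" by eventually_elim simp
  with Y(1) show ?thesis unfolding ae_wiener_def by blast
qed

context
  fixes H t :: real
  assumes H: "H \<in> {0<..<1}" and t: "0 < t"
begin

text \<open>The shift is 0, the path value at the singular point 0. Both boundary terms vanish, one
  by smallness at 0 and one by cancellation at infinity.\<close>

lemma ae_wiener_plus_far:
  "ae_wiener (\<lambda>s. indicator {..0} s * ((t - s) powr (H - 1/2) - (- s) powr (H - 1/2)))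
    (\<lambda>\<omega>. (H - 1/2) * (LINT s:{..0}|lborel. ((t - s) powr (H - 3/2) - (- s) powr (H - 3/2)) * B s \<omega>))"
proof -
  define K where "K s = (t - s) powr (H - 3/2) - (- s) powr (H - 3/2)" for s
  have "ae_wiener (\<lambda>s. indicator {..0} s * ((t - s) powr (H - 1/2) - (- s) powr (H - 1/2)))
     (\<lambda>\<omega>. 0 - 0 - (LINT s:{..0}|lborel. (- (H - 1/2) * K s) * (B s \<omega> - 0)))"
  proof (rule ae_wiener_improper[where p="\<lambda>n. - real (Suc n)" and q="\<lambda>n. - (1 / real (Suc n))"])
    show "(\<integral>\<^sup>+ s. ennreal ((indicator {..0} s * ((t - s) powr (H - 1/2) - (- s) powr (H - 1/2)))\<^sup>2) \<partial>lborel) < \<infinity>"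
      by (rule square_integrable_far[OF H t, of "-1" 0 "{..0}"]) simp
    show "- real (Suc n) \<le> - (1 / real (Suc n))" for n by (simp add: field_simps)
    have neg: "- (1 / real (Suc n)) < 0" for n by simp
    then show "{- real (Suc n)..- (1 / real (Suc n))} \<subseteq> {..0}" for n by (auto intro: order_trans less_imp_le)
    show "AE s in lborel. s \<in> {..0} \<longrightarrow> (\<forall>\<^sub>F n in sequentially. s \<in> {- real (Suc n)<..- (1 / real (Suc n))})"
      using AE_lborel_singleton[of "0::real"]
    proof eventually_elim
      case (elim s)
      show ?case
      proof
        assume "s \<in> {..0}"
        with elim have "0 < - s" by auto
        from eventually_less_Suc[of "- s"] eventually_inverse_Suc_less[OF this, of 1]
        show "\<forall>\<^sub>F n in sequentially. s \<in> {- real (Suc n)<..- (1 / real (Suc n))}"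
          by eventually_elim auto
      qed
    qed
    have below: "s < 0" if "s \<in> {- real (Suc n)..- (1 / real (Suc n))}" for n s
      using that neg[of n] unfolding atLeastAtMost_iff by linarith
    show "((\<lambda>s. (t - s) powr (H - 1/2) - (- s) powr (H - 1/2)) has_real_derivative - (H - 1/2) * K s) (at s)"
      if "s \<in> {- real (Suc n)..- (1 / real (Suc n))}" for n s
    proof -
      have s: "s < 0" using that by (rule below)
      have "((\<lambda>s. (t - s) powr (H - 1/2) - (0 - s) powr (H - 1/2)) has_real_derivative
          - (H - 1/2) * (t - s) powr (H - 3/2) - (- (H - 1/2) * (0 - s) powr (H - 3/2))) (at s)"
        using s t by (intro DERIV_diff has_real_derivative_powr_reflect) auto
      then show ?thesis by (simp add: K_def algebra_simps)
    qed
    show "continuous_on {- real (Suc n)..- (1 / real (Suc n))} (\<lambda>s. - (H - 1/2) * K s)" for n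
      unfolding K_def using t by (intro continuous_intros) (use below in fastforce)+
    show "AE \<omega> in M. set_integrable lborel {..0} (\<lambda>s. (- (H - 1/2) * K s) * (B s \<omega> - 0)) \<and>
       (\<lambda>n. ((t - - (1 / real (Suc n))) powr (H - 1/2) - (- (- (1 / real (Suc n)))) powr (H - 1/2)) * (B (- (1 / real (Suc n))) \<omega> - 0)) \<longlonglongrightarrow> 0 \<and>
       (\<lambda>n. ((t - - real (Suc n)) powr (H - 1/2) - (- (- real (Suc n))) powr (H - 1/2)) * (B (- real (Suc n)) \<omega> - 0)) \<longlonglongrightarrow> 0"
      using AE_good_path
    proof eventually_elim
      case gp: (elim \<omega>)
      then have b0: "B 0 \<omega> = 0" by (simp add: good_path_def)
      show ?case
      proof (intro conjI)
        show "set_integrable lborel {..0} (\<lambda>s. (- (H - 1/2) * K s) * (B s \<omega> - 0))"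
          using set_integrable_mult_right[OF set_integrable_plus_far[OF gp H t], of "- (H - 1/2)"]
          by (simp only: K_def diff_0_right mult.assoc)
        show "(\<lambda>n. ((t - - (1 / real (Suc n))) powr (H - 1/2) - (- (- (1 / real (Suc n)))) powr (H - 1/2)) * (B (- (1 / real (Suc n))) \<omega> - 0)) \<longlonglongrightarrow> 0"
          using near_boundary_shift_tendsto[OF gp _ t, of H "\<lambda>n. - (1 / real (Suc n))" 0] H inverse_Suc_tendsto[of "-1"]
          by (simp add: b0)
        show "(\<lambda>n. ((t - - real (Suc n)) powr (H - 1/2) - (- (- real (Suc n))) powr (H - 1/2)) * (B (- real (Suc n)) \<omega> - 0)) \<longlonglongrightarrow> 0"
          using far_boundary_tendsto[OF gp H less_imp_le[OF t] filterlim_Suc_at_top, of "\<lambda>n. - real (Suc n)" 0] t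
          by (simp add: b0 del: of_nat_Suc)
      qed
    qed
  qed auto
  moreover have "0 - 0 - (LINT s:{..0}|lborel. (- (H - 1/2) * K s) * (B s \<omega> - 0))
      = (H - 1/2) * (LINT s:{..0}|lborel. K s * B s \<omega>)" for \<omega>
    unfolding mult.assoc diff_0_right set_integral_mult_right by (simp only: mult_minus_left diff_0 diff_self minus_minus)
  ultimately show ?thesis by (simp only: K_def)
qed

text \<open>The singularity at \<open>t\<close> calls for the shift \<open>B t\<close>. The boundary
  term there vanishes, while the one at 0 is \<open>- (t powr (H - 1/2) * B t)\<close> and enters
  with a minus sign.\<close>

lemma ae_wiener_plus_near:
  "ae_wiener (\<lambda>s. indicator {0..t} s * (t - s) powr (H - 1/2))
    (\<lambda>\<omega>. t powr (H - 1/2) * B t \<omega> - (H - 1/2) * (LINT s:{0..t}|lborel. (t - s) powr (H - 3/2) * (B t \<omega> - B s \<omega>)))"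
proof (rule ae_wiener_AE_cong)
  have flip: "- a * P * (x - y) = a * (P * (y - x))" for a P x y :: real by (simp add: algebra_simps)
  define q where "q n = t - t * (1 / real (Suc n))" for n
  have q: "0 \<le> q n" "q n < t" for n using t by (auto simp: q_def field_simps)
  show "ae_wiener (\<lambda>s. indicator {0..t} s * (t - s) powr (H - 1/2))
     (\<lambda>\<omega>. 0 - (t - 0) powr (H - 1/2) * (B 0 \<omega> - B t \<omega>)
        - (LINT s:{0..t}|lborel. (- (H - 1/2) * (t - s) powr (H - 3/2)) * (B s \<omega> - B t \<omega>)))"
  proof (rule ae_wiener_improper[where p="\<lambda>n. 0" and q=q])
    show "(\<integral>\<^sup>+ s. ennreal ((indicator {0..t} s * (t - s) powr (H - 1/2))\<^sup>2) \<partial>lborel) < \<infinity>"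
      by (rule square_integrable_near[OF H t, of "-t" t]) simp
    show "0 \<le> q n" "{0..q n} \<subseteq> {0..t}" for n using q[of n] by auto
    show "AE s in lborel. s \<in> {0..t} \<longrightarrow> (\<forall>\<^sub>F n in sequentially. s \<in> {0<..q n})"
      using AE_lborel_singleton[of "0::real"] AE_lborel_singleton[of t]
    proof eventually_elim
      case (elim s)
      show ?case
      proof
        assume "s \<in> {0..t}"
        with elim have s: "0 < s" "0 < t - s" by auto
        from eventually_inverse_Suc_less[OF s(2), of t]
        show "\<forall>\<^sub>F n in sequentially. s \<in> {0<..q n}"
          by eventually_elim (use s in \<open>auto simp: q_def\<close>)
      qed
    qed
    show "((\<lambda>s. (t - s) powr (H - 1/2)) has_real_derivative - (H - 1/2) * (t - s) powr (H - 3/2)) (at s)"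
      if "s \<in> {0..q n}" for n s
      using that q[of n] by (intro has_real_derivative_powr_reflect) auto
    show "continuous_on {0..q n} (\<lambda>s. - (H - 1/2) * (t - s) powr (H - 3/2))" for n
      using q[of n] by (intro continuous_intros) auto
    show "AE \<omega> in M. set_integrable lborel {0..t} (\<lambda>s. (- (H - 1/2) * (t - s) powr (H - 3/2)) * (B s \<omega> - B t \<omega>)) \<and>
       (\<lambda>n. (t - q n) powr (H - 1/2) * (B (q n) \<omega> - B t \<omega>)) \<longlonglongrightarrow> 0 \<and>
       (\<lambda>n. (t - 0) powr (H - 1/2) * (B 0 \<omega> - B t \<omega>)) \<longlonglongrightarrow> (t - 0) powr (H - 1/2) * (B 0 \<omega> - B t \<omega>)"
      using AE_good_path
    proof eventually_elim
      case gp: (elim \<omega>)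
      show ?case
      proof (intro conjI tendsto_const)
        have e: "(- (H - 1/2) * (t - s) powr (H - 3/2)) * (B s \<omega> - B t \<omega>) = (H - 1/2) * ((t - s) powr (H - 3/2) * (B t \<omega> - B s \<omega>))" for s
          by (rule flip)
        show "set_integrable lborel {0..t} (\<lambda>s. (- (H - 1/2) * (t - s) powr (H - 3/2)) * (B s \<omega> - B t \<omega>))"
          unfolding e by (intro set_integrable_mult_right set_integrable_plus_near[OF gp H t])
        show "(\<lambda>n. (t - q n) powr (H - 1/2) * (B (q n) \<omega> - B t \<omega>)) \<longlonglongrightarrow> 0"
          using near_boundary_tendsto[OF gp _ inverse_Suc_tendsto[of "-t"], of H t] H t
          by (simp add: q_def abs_mult)
      qed
    qed
  qed auto
  show "AE \<omega> in M. 0 - (t - 0) powr (H - 1/2) * (B 0 \<omega> - B t \<omega>)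
        - (LINT s:{0..t}|lborel. (- (H - 1/2) * (t - s) powr (H - 3/2)) * (B s \<omega> - B t \<omega>))
     = t powr (H - 1/2) * B t \<omega> - (H - 1/2) * (LINT s:{0..t}|lborel. (t - s) powr (H - 3/2) * (B t \<omega> - B s \<omega>))"
    using AE_B_zero
  proof eventually_elim
    case (elim \<omega>)
    have e: "(- (H - 1/2) * (t - s) powr (H - 3/2)) * (B s \<omega> - B t \<omega>) = (H - 1/2) * ((t - s) powr (H - 3/2) * (B t \<omega> - B s \<omega>))" for s
      by (rule flip)
    show ?case unfolding e set_integral_mult_right using elim by simp
  qed
qed

text \<open>Singularity at 0 with shift 0: the boundary term at 0 vanishes and the regular one at
  \<open>t\<close> remains.\<close>

lemma ae_wiener_minus_near:
  "ae_wiener (\<lambda>s. indicator {0..t} s * s powr (H - 1/2))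
    (\<lambda>\<omega>. t powr (H - 1/2) * B t \<omega> - (H - 1/2) * (LINT s:{0..t}|lborel. s powr (H - 3/2) * B s \<omega>))"
proof -
  define p where "p n = t * (1 / real (Suc n))" for n
  have p: "0 < p n" "p n \<le> t" for n using t by (auto simp: p_def field_simps)
  have "ae_wiener (\<lambda>s. indicator {0..t} s * s powr (H - 1/2))
     (\<lambda>\<omega>. t powr (H - 1/2) * (B t \<omega> - 0) - 0
        - (LINT s:{0..t}|lborel. ((H - 1/2) * s powr (H - 3/2)) * (B s \<omega> - 0)))"
  proof (rule ae_wiener_improper[where p=p and q="\<lambda>n. t"])
    show "(\<integral>\<^sup>+ s. ennreal ((indicator {0..t} s * s powr (H - 1/2))\<^sup>2) \<partial>lborel) < \<infinity>"
      by (rule square_integrable_near[OF H t, of t 0]) simp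
    show "p n \<le> t" "{p n..t} \<subseteq> {0..t}" for n using p[of n] by auto
    show "AE s in lborel. s \<in> {0..t} \<longrightarrow> (\<forall>\<^sub>F n in sequentially. s \<in> {p n<..t})"
      using AE_lborel_singleton[of "0::real"]
    proof eventually_elim
      case (elim s)
      show ?case
      proof
        assume "s \<in> {0..t}"
        with elim have s: "0 < s" "s \<le> t" by auto
        from eventually_inverse_Suc_less[OF s(1), of t]
        show "\<forall>\<^sub>F n in sequentially. s \<in> {p n<..t}"
          by eventually_elim (use s in \<open>auto simp: p_def\<close>)
      qed
    qed
    show "((\<lambda>s. s powr (H - 1/2)) has_real_derivative (H - 1/2) * s powr (H - 3/2)) (at s)"
      if "s \<in> {p n..t}" for n s
      using that p[of n] has_real_derivative_powr_shift[of 0 s H] by simp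
    show "continuous_on {p n..t} (\<lambda>s. (H - 1/2) * s powr (H - 3/2))" for n
      using p[of n] by (intro continuous_intros) auto
    show "AE \<omega> in M. set_integrable lborel {0..t} (\<lambda>s. ((H - 1/2) * s powr (H - 3/2)) * (B s \<omega> - 0)) \<and>
       (\<lambda>n. t powr (H - 1/2) * (B t \<omega> - 0)) \<longlonglongrightarrow> t powr (H - 1/2) * (B t \<omega> - 0) \<and>
       (\<lambda>n. p n powr (H - 1/2) * (B (p n) \<omega> - 0)) \<longlonglongrightarrow> 0"
      using AE_good_path
    proof eventually_elim
      case gp: (elim \<omega>)
      then have b0: "B 0 \<omega> = 0" by (simp add: good_path_def)
      show ?case
      proof (intro conjI tendsto_const)
        show "set_integrable lborel {0..t} (\<lambda>s. ((H - 1/2) * s powr (H - 3/2)) * (B s \<omega> - 0))"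
          unfolding mult.assoc diff_0_right by (intro set_integrable_mult_right set_integrable_minus_near[OF gp H t])
        show "(\<lambda>n. p n powr (H - 1/2) * (B (p n) \<omega> - 0)) \<longlonglongrightarrow> 0"
          using near_boundary_tendsto[OF gp _ inverse_Suc_tendsto[of t], of H 0] H t
          by (simp add: p_def abs_mult b0)
      qed
    qed
  qed auto
  then show ?thesis by (simp only: mult.assoc diff_0_right set_integral_mult_right)
qed

text \<open>The singularity at \<open>t\<close> fixes the shift \<open>B t\<close>, and both
  boundary terms vanish. The minus sign is undone by the one in front of this integral in
  \<open>X_minus\<close>.\<close>

lemma ae_wiener_minus_far:
  "ae_wiener (\<lambda>s. indicator {t..} s * (s powr (H - 1/2) - (s - t) powr (H - 1/2)))
    (\<lambda>\<omega>. - ((H - 1/2) * (LINT s:{t..}|lborel. (s powr (H - 3/2) - (s - t) powr (H - 3/2)) * (B s \<omega> - B t \<omega>))))"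
proof -
  define K where "K s = s powr (H - 3/2) - (s - t) powr (H - 3/2)" for s
  have "ae_wiener (\<lambda>s. indicator {t..} s * (s powr (H - 1/2) - (s - t) powr (H - 1/2)))
     (\<lambda>\<omega>. 0 - 0 - (LINT s:{t..}|lborel. ((H - 1/2) * K s) * (B s \<omega> - B t \<omega>)))"
  proof (rule ae_wiener_improper[where p="\<lambda>n. t + 1 / real (Suc n)" and q="\<lambda>n. t + real (Suc n)"])
    show "(\<integral>\<^sup>+ s. ennreal ((indicator {t..} s * (s powr (H - 1/2) - (s - t) powr (H - 1/2)))\<^sup>2) \<partial>lborel) < \<infinity>"
      by (rule square_integrable_far[OF H t, of 1 t "{t..}"]) simp
    show "t + 1 / real (Suc n) \<le> t + real (Suc n)" for n by (simp add: field_simps)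
    have pos: "0 < 1 / real (Suc n)" for n by simp
    show "{t + 1 / real (Suc n)..t + real (Suc n)} \<subseteq> {t..}" for n
      using pos[of n] by auto
    show "AE s in lborel. s \<in> {t..} \<longrightarrow> (\<forall>\<^sub>F n in sequentially. s \<in> {t + 1 / real (Suc n)<..t + real (Suc n)})"
      using AE_lborel_singleton[of t]
    proof eventually_elim
      case (elim s)
      show ?case
      proof
        assume "s \<in> {t..}"
        with elim have "0 < s - t" by auto
        from eventually_less_Suc[of "s - t"] eventually_inverse_Suc_less[OF this, of 1]
        show "\<forall>\<^sub>F n in sequentially. s \<in> {t + 1 / real (Suc n)<..t + real (Suc n)}"
          by eventually_elim auto
      qed
    qed
    have above: "t < s" if "s \<in> {t + 1 / real (Suc n)..t + real (Suc n)}" for n s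
      using that pos[of n] unfolding atLeastAtMost_iff by linarith
    show "((\<lambda>s. s powr (H - 1/2) - (s - t) powr (H - 1/2)) has_real_derivative (H - 1/2) * K s) (at s)"
      if "s \<in> {t + 1 / real (Suc n)..t + real (Suc n)}" for n s
    proof -
      have s: "t < s" using that by (rule above)
      have "((\<lambda>s. (s - 0) powr (H - 1/2) - (s - t) powr (H - 1/2)) has_real_derivative
          (H - 1/2) * (s - 0) powr (H - 3/2) - (H - 1/2) * (s - t) powr (H - 3/2)) (at s)"
        using s t by (intro DERIV_diff has_real_derivative_powr_shift) auto
      then show ?thesis by (simp add: K_def algebra_simps)
    qed
    show "continuous_on {t + 1 / real (Suc n)..t + real (Suc n)} (\<lambda>s. (H - 1/2) * K s)" for n
      unfolding K_def using t by (intro continuous_intros) (use above in fastforce)+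
    show "AE \<omega> in M. set_integrable lborel {t..} (\<lambda>s. ((H - 1/2) * K s) * (B s \<omega> - B t \<omega>)) \<and>
       (\<lambda>n. ((t + real (Suc n)) powr (H - 1/2) - (t + real (Suc n) - t) powr (H - 1/2)) * (B (t + real (Suc n)) \<omega> - B t \<omega>)) \<longlonglongrightarrow> 0 \<and>
       (\<lambda>n. ((t + 1 / real (Suc n)) powr (H - 1/2) - (t + 1 / real (Suc n) - t) powr (H - 1/2)) * (B (t + 1 / real (Suc n)) \<omega> - B t \<omega>)) \<longlonglongrightarrow> 0"
      using AE_good_path
    proof eventually_elim
      case gp: (elim \<omega>)
      show ?case
      proof (intro conjI)
        show "set_integrable lborel {t..} (\<lambda>s. ((H - 1/2) * K s) * (B s \<omega> - B t \<omega>))"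
          unfolding mult.assoc K_def by (intro set_integrable_mult_right set_integrable_minus_far[OF gp H t])
        show "(\<lambda>n. ((t + real (Suc n)) powr (H - 1/2) - (t + real (Suc n) - t) powr (H - 1/2)) * (B (t + real (Suc n)) \<omega> - B t \<omega>)) \<longlonglongrightarrow> 0"
          using far_boundary_tendsto[OF gp H less_imp_le[OF t] filterlim_Suc_at_top, of "\<lambda>n. real (Suc n)" t] t
          by simp
        show "(\<lambda>n. ((t + 1 / real (Suc n)) powr (H - 1/2) - (t + 1 / real (Suc n) - t) powr (H - 1/2)) * (B (t + 1 / real (Suc n)) \<omega> - B t \<omega>)) \<longlonglongrightarrow> 0"
          using near_boundary_shift_tendsto[OF gp _ t inverse_Suc_tendsto[of 1], of H t] H
          by simp
      qed
    qed
  qed auto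
  moreover have "0 - 0 - (LINT s:{t..}|lborel. ((H - 1/2) * K s) * (B s \<omega> - B t \<omega>))
      = - ((H - 1/2) * (LINT s:{t..}|lborel. K s * (B s \<omega> - B t \<omega>)))" for \<omega>
    by (simp only: mult.assoc set_integral_mult_right diff_self diff_0)
  ultimately show ?thesis by (simp only: K_def)
qed

end

section \<open>Identification of the fields and conclusion\<close>

lemma wiener_integral_AE_eq:
  assumes "ae_wiener (\<lambda>s. indicator A s * f s) Z"
  shows "wiener_integral M B A f \<in> borel_measurable M" "AE \<omega> in M. wiener_integral M B A f \<omega> = Z \<omega>"
proof -
  have "\<exists>Y. has_wiener_integral M B (\<lambda>s. indicator A s * f s) Y" using assms unfolding ae_wiener_def by blast
  then have w: "has_wiener_integral M B (\<lambda>s. indicator A s * f s) (wiener_integral M B A f)"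
    \<comment> \<open>Existence makes the choice operator return a genuine representative;
      uniqueness then identifies it with \<open>Z\<close> almost surely.\<close>
    unfolding wiener_integral_def by (rule someI_ex)
  then show "wiener_integral M B A f \<in> borel_measurable M" by (simp add: has_wiener_integral_def)
  show "AE \<omega> in M. wiener_integral M B A f \<omega> = Z \<omega>" by (rule ae_wiener_AE_eq[OF assms w])
qed

lemma X_plus_AE_eq:
  assumes "H \<in> {0<..<1}" "0 \<le> t"
  shows "X_plus M B H t \<in> borel_measurable M" "AE \<omega> in M. Xt_plus B H t \<omega> = X_plus M B H t \<omega>"
proof -
  have "X_plus M B H t \<in> borel_measurable M \<and> (AE \<omega> in M. Xt_plus B H t \<omega> = X_plus M B H t \<omega>)"
  proof (cases "t = 0")
    case True
    then show ?thesis by (simp add: X_plus_def[abs_def] Xt_plus_def)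
  next
    case False
    with assms have t: "0 < t" by simp
    note far = wiener_integral_AE_eq[OF ae_wiener_plus_far[OF assms(1) t]]
    note near = wiener_integral_AE_eq[OF ae_wiener_plus_near[OF assms(1) t]]
    have "X_plus M B H t \<in> borel_measurable M" unfolding X_plus_def[abs_def] using far(1) near(1) False by simp
    moreover have "AE \<omega> in M. Xt_plus B H t \<omega> = X_plus M B H t \<omega>"
      using far(2) near(2) by eventually_elim (simp add: X_plus_def Xt_plus_def)
    ultimately show ?thesis by blast
  qed
  then show "X_plus M B H t \<in> borel_measurable M" "AE \<omega> in M. Xt_plus B H t \<omega> = X_plus M B H t \<omega>" by auto
qed

lemma X_minus_AE_eq:
  assumes "H \<in> {0<..<1}" "0 \<le> t"
  shows "X_minus M B H t \<in> borel_measurable M" "AE \<omega> in M. Xt_minus B H t \<omega> = X_minus M B H t \<omega>"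
proof -
  have "X_minus M B H t \<in> borel_measurable M \<and> (AE \<omega> in M. Xt_minus B H t \<omega> = X_minus M B H t \<omega>)"
  proof (cases "t = 0")
    case True
    then show ?thesis by (simp add: X_minus_def[abs_def] Xt_minus_def)
  next
    case False
    with assms have t: "0 < t" by simp
    note far = wiener_integral_AE_eq[OF ae_wiener_minus_far[OF assms(1) t]]
    note near = wiener_integral_AE_eq[OF ae_wiener_minus_near[OF assms(1) t]]
    have "X_minus M B H t \<in> borel_measurable M" unfolding X_minus_def[abs_def] using far(1) near(1) False by simp
    moreover have "AE \<omega> in M. Xt_minus B H t \<omega> = X_minus M B H t \<omega>"
      using far(2) near(2) by eventually_elim (simp add: X_minus_def Xt_minus_def)
    ultimately show ?thesis by blast
  qed
  then show "X_minus M B H t \<in> borel_measurable M" "AE \<omega> in M. Xt_minus B H t \<omega> = X_minus M B H t \<omega>" by auto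
qed

end

text \<open>Preimages under \<open>f\<close> and \<open>g\<close> differ by a null set, hence agree
  in measurability after completion. This is how the pathwise fields inherit measurability from the
  Wiener integrals.\<close>

lemma borel_measurable_completion_AE:
  fixes f g :: "'b \<Rightarrow> real"
  assumes f: "f \<in> borel_measurable M" and eq: "AE x in M. g x = f x"
  shows "g \<in> borel_measurable (completion M)"
proof (rule measurableI)
  fix S :: "real set" assume S: "S \<in> sets borel"
  have f': "f \<in> borel_measurable (completion M)" using f by (rule measurable_completion)
  show "g -` S \<inter> space (completion M) \<in> sets (completion M)"
  proof (rule completion.in_sets_AE)
    show "AE x in completion M. (x \<in> f -` S \<inter> space (completion M)) = (x \<in> g -` S \<inter> space (completion M))"
      using AE_completion[OF eq] by eventually_elim simp
    show "f -` S \<inter> space (completion M) \<in> sets (completion M)" using f' S by (rule measurable_sets)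
  qed auto
qed simp

theorem proposition1:
  fixes M :: "'a measure" and B :: "real \<Rightarrow> 'a \<Rightarrow> real"
  assumes "two_sided_brownian_motion M B"
  shows "((AE \<omega> in M. \<forall>H\<in>{0<..<1}. \<forall>t>0. Xt_plus_exists B H t \<omega>) \<and>
          continuous_modification M (Xt_plus B) (X_plus M B)) \<and>
         ((AE \<omega> in M. \<forall>H\<in>{0<..<1}. \<forall>t>0. Xt_minus_exists B H t \<omega>) \<and>
          continuous_modification M (Xt_minus B) (X_minus M B))"
proof -
  interpret brownian M B by unfold_locales (rule assms)
  \<comment> \<open>The quantifiers over \<open>H\<close> and \<open>t\<close> may stand inside the
    almost sure statement because \<open>good_path\<close> involves neither.\<close>
  have ex: "AE \<omega> in M. \<forall>H\<in>{0<..<1}. \<forall>t>0. Xt_plus_exists B H t \<omega>"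
    "AE \<omega> in M. \<forall>H\<in>{0<..<1}. \<forall>t>0. Xt_minus_exists B H t \<omega>"
    using AE_good_path by (auto simp: Xt_plus_exists_def Xt_minus_exists_def elim!: eventually_mono
        intro: set_integrable_plus_near set_integrable_plus_far set_integrable_minus_near set_integrable_minus_far)
  have cont: "AE \<omega> in M. continuous_on ({0<..<1} \<times> {0..}) (\<lambda>(H, t). Xt_plus B H t \<omega>)"
    "AE \<omega> in M. continuous_on ({0<..<1} \<times> {0..}) (\<lambda>(H, t). Xt_minus B H t \<omega>)"
    using AE_good_path continuous_on_Xt_plus continuous_on_Xt_minus by (auto elim!: eventually_mono)
  have X: "random_field M (X_plus M B)" "random_field M (X_minus M B)"
    unfolding random_field_def by (auto intro!: measurable_completion X_plus_AE_eq(1) X_minus_AE_eq(1))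
  have Xt: "random_field M (Xt_plus B)" "random_field M (Xt_minus B)"
    unfolding random_field_def
    by (auto intro!: borel_measurable_completion_AE[OF X_plus_AE_eq] borel_measurable_completion_AE[OF X_minus_AE_eq])
  show ?thesis
    unfolding continuous_modification_def
    by (intro conjI ex cont X Xt ballI allI impI X_plus_AE_eq(2) X_minus_AE_eq(2))
qed

end
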